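(* Let $\mathcal{A}=\mathcal{A}(\tilde{\mathbf{X}},\tilde B)$ be the quantum cluster algebra associated with an acyclic quantum seed $(\tilde{\mathbf{X}},\tilde B)$, and let $\lhd$ be an arbitrary linear order on $[1,n]$. Then the elements $E_a$ for $a\in\mathbb{Z}^m$ form a basis of $\mathcal{A}$ as a $\mathbb{Z}[v,v^{-1}]$-module, and with respect to the bar-involution on $\mathcal{A}$ and the partial order on $\mathbb{Z}^m$ given by $a'\prec a\iff r(a')<r(a)$ this basis satisfies $$\overline{E_a}-E_a\in\bigoplus_{a'\prec a}\mathbb{Z}[v,v^{-1}]E_{a'}\qquad(a\in\mathbb{Z}^m).$$ Therefore, this basis gives rise to a $\mathbb{Z}[v,v^{-1}]$-basis $\{C_a:a\in\mathbb{Z}^m\}$ of $\mathcal{A}$ uniquely determined by the conditions $$\overline{C_a}=C_a,\qquad C_a-E_a\in\bigoplus_{a'\in\mathbb{Z}^m}v\mathbb{Z}[v]E_{a'}\qquad(a\in\mathbb{Z}^m).$$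
   Context: Notation: $[p,q]=\{p,p+1,\dots,q\}$; $[c]_+=\max(c,0)$ for $c\in\mathbb{Z}$, applied componentwise to integer vectors; $e_1,\dots,e_m$ is the standard basis of $\mathbb{Z}^m$. Quantum seeds. A quantum seed $(\tilde{\mathbf{X}},\tilde B)$ consists of: integers $m\ge n\ge 1$; an $m\times n$ integer matrix $\tilde B=(b_{ij})$ with columns $b_1,\dots,b_n\in\mathbb{Z}^m$; positive integers $d_1,\dots,d_n$; a skew-symmetric bilinear form $\Lambda:\mathbb{Z}^m\times\mathbb{Z}^m\to\mathbb{Z}$ with $\Lambda(b_j,e_i)=\delta_{ij}d_j$ for $i\in[1,m]$, $j\in[1,n]$; and the based quantum torus $\mathcal{T}=\mathcal{T}(\Lambda)$, i.e. the $\mathbb{Z}[v,v^{-1}]$-algebra with $\mathbb{Z}[v,v^{-1}]$-basis $\{X^e:e\in\mathbb{Z}^m\}$ and multiplication $X^eX^f=v^{\Lambda(e,f)}X^{e+f}$. $\mathcal{T}$ is an Ore domain; $\mathcal{F}$ is its skew-field of fractions. Write $X_i=X^{e_i}$; $\tilde{\mathbf{X}}=\{X_1,\dots,X_m\}$ is the extended cluster, $\{X_1,\dots,X_n\}$ the cluster, and $X_{n+1},\dots,X_m$ the frozen variables. $B=(b_{ij})_{i,j\in[1,n]}$ is the exchange matrix. $\mathbb{P}$ is the multiplicative subgroup of $\mathcal{T}$ generated by $v$ and the frozen variables, and $\mathbb{Z}\mathbb{P}$ is the ring of (noncommutative) Laurent polynomials in the frozen variables with coefficients in $\mathbb{Z}[v,v^{-1}]$.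 Mutation. For $k\in[1,n]$ put $e'_k=-e_k+[b_k]_+$ and $X'_k=X^{e'_k}+X^{-e_k+[-b_k]_+}$. The mutated seed $\mu_k(\tilde{\mathbf{X}},\tilde B)=(\tilde{\mathbf{X}}',\tilde B')$ has extended cluster obtained by replacing $X_k$ with $X'_k$; matrix entries $b'_{ij}=-b_{ij}$ if $i=k$ or $j=k$, and $b'_{ij}=b_{ij}+[b_{ik}]_+[b_{kj}]_+-[-b_{ik}]_+[-b_{kj}]_+$ otherwise; the same $d_j$; and the skew-symmetric form $\Lambda'$ with $\Lambda'(e_i,e_j)=\Lambda(e_i,e_j)$ for $i,j\ne k$, $\Lambda'(e_k,e_j)=\Lambda(e'_k,e_j)$ for $j\neq k$. The torus $\mathcal{T}'=\mathcal{T}(\Lambda')$ is identified with the subalgebra of $\mathcal{F}$ generated by the elements of $\tilde{\mathbf{X}}'$ and their inverses, its distinguished basis element $(X')^{e_i}$ being the $i$th element of $\tilde{\mathbf{X}}'$. The quantum cluster algebra $\mathcal{A}(\tilde{\mathbf{X}},\tilde B)$ is the $\mathbb{Z}\mathbb{P}$-subalgebra of $\mathcal{F}$ generated by the union of the clusters of all quantum seeds obtained from $(\tilde{\mathbf{X}},\tilde B)$ by finite sequences of mutations. It is contained in the quantum torus of each of its seeds. The seed is acyclic if the directed graph $\Gamma(B)$ with vertex set $[1,n]$ and edges $j\to i$ for all $(i,j)$ with $b_{ij}>0$ has no oriented cycles. Bar-involution: the $\mathbb{Z}$-linear involution of $\mathcal{T}$ with $\overline{fX}=\overline f\,\overline X$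 for $f\in\mathbb{Z}[v,v^{-1}]$ ($\overline f(v)=f(v^{-1})$) and $\overline{X^a}=X^a$ for all $a\in\mathbb{Z}^m$. It satisfies $\overline{XY}=\overline Y\,\overline X$ and preserves $\mathcal{A}$. Elements $E_a$. For $a\in\mathbb{Z}^m$ let $$E_a^\circ=X^{\sum_{i\in[n+1,m]}a_ie_i+\sum_{j\in[1,n]}[a_j]_+e_j}\cdot\prod_{k\in[1,n]}^{\lhd}(X'_k)^{[-a_k]_+},$$ the product being in increasing order with respect to $\lhd$. The leading term $LT(E_a^\circ)\in\mathcal{T}$ is obtained from this expression by replacing each $X'_k$ with $X^{e'_k}$. Put $E_a=v^{\nu(a)}E_a^\circ$, where $\nu(a)\in\mathbb{Z}$ is determined by the condition that $v^{\nu(a)}LT(E_a^\circ)$ is invariant under the bar-involution. Finally, $r(a)=\sum_{k\in[1,n]}[-a_k]_+$. *)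

theory Defs
  imports Complex_Main "HOL-Library.Poly_Mapping"
begin

abbreviation single where "single \<equiv> Poly_Mapping.single"
abbreviation lookup where "lookup \<equiv> Poly_Mapping.lookup"
abbreviation keys where "keys \<equiv> Poly_Mapping.keys"

section \<open>Exponent vectors and Laurent polynomials\<close>

type_synonym ivec = "nat \<Rightarrow>\<^sub>0 int"

definition zlattice :: "nat \<Rightarrow> ivec set" where  \<comment> \<open>\<open>\<int>\<^sup>m\<close>, coordinates indexed by \<open>1, \<dots>, m\<close>\<close>
  "zlattice m = {e. keys e \<subseteq> {1..m}}"

abbreviation unit_vec :: "nat \<Rightarrow> ivec" where
  "unit_vec i \<equiv> single i 1"

abbreviation pos :: "int \<Rightarrow> int" where
  "pos c \<equiv> max c 0"

definition pos_vec :: "ivec \<Rightarrow> ivec" where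
  "pos_vec e = Poly_Mapping.map pos e"

text \<open>\<open>\<int>[v,v\<inverse>]\<close> is the group ring of \<open>(\<int>,+)\<close> with its library ring structure
  (convolution); \<open>v\<^sup>k\<close> is \<open>single k 1\<close>.\<close>

type_synonym laurent = "int \<Rightarrow>\<^sub>0 int"

definition bar_laurent :: "laurent \<Rightarrow> laurent" where
  "bar_laurent p = Poly_Mapping.map_key uminus p"

definition v_poly :: "laurent set" where  \<comment> \<open>\<open>v\<int>[v]\<close>\<close>
  "v_poly = {p. keys p \<subseteq> {1..}}"

section \<open>The based quantum torus\<close>

text \<open>A bilinear form on \<open>\<int>\<^sup>m\<close> is given by its Gram matrix \<open>L i j = \<Lambda>(e\<^sub>i, e\<^sub>j)\<close>.\<close>

definition bil :: "nat \<Rightarrow> (nat \<Rightarrow> nat \<Rightarrow> int) \<Rightarrow> ivec \<Rightarrow> ivec \<Rightarrow> int" where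
  "bil m L e f = (\<Sum>i=1..m. \<Sum>j=1..m. lookup e i * L i j * lookup f j)"

text \<open>The element \<open>\<Sum>\<^sub>e p\<^sub>e X\<^sup>e\<close> is the finitely supported function \<open>e \<mapsto> p\<^sub>e\<close>, so \<open>X\<^sup>e\<close> is
  \<open>single e 1\<close>.  The product of the torus is \<open>torus_mult\<close>, not the (untwisted,
  commutative) \<open>*\<close> of type \<open>ivec \<Rightarrow>\<^sub>0 laurent\<close>; both have the same unit \<open>1 = single 0 1\<close>.\<close>

type_synonym torus_elem = "ivec \<Rightarrow>\<^sub>0 laurent"

definition torus :: "nat \<Rightarrow> torus_elem set" where
  "torus m = {t. keys t \<subseteq> zlattice m}"

definition torus_mult ::
    "nat \<Rightarrow> (nat \<Rightarrow> nat \<Rightarrow> int) \<Rightarrow> torus_elem \<Rightarrow> torus_elem \<Rightarrow> torus_elem" where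
  "torus_mult m L s t =
    (\<Sum>e\<in>keys s. \<Sum>f\<in>keys t. single (e + f) (single (bil m L e f) 1 * lookup s e * lookup t f))"

lemma torus_mult_monomials:
  "torus_mult m L (single e 1) (single f 1) = single (e + f) (single (bil m L e f) 1)"
  by (simp add: torus_mult_def)

definition bar_torus :: "torus_elem \<Rightarrow> torus_elem" where
  "bar_torus t = Poly_Mapping.map bar_laurent t"

text \<open>\<open>emb\<close> exhibits the division ring \<open>'f\<close> as the skew-field of fractions \<open>\<F>\<close> of the quantum
  torus; this determines \<open>\<F>\<close> and \<open>emb\<close> up to unique isomorphism.\<close>

definition skew_field_of_fractions ::
    "nat \<Rightarrow> (nat \<Rightarrow> nat \<Rightarrow> int) \<Rightarrow> (torus_elem \<Rightarrow> 'f::division_ring) \<Rightarrow> bool" where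
  "skew_field_of_fractions m L emb \<longleftrightarrow>
     inj_on emb (torus m) \<and> emb 1 = 1 \<and>
     (\<forall>s\<in>torus m. \<forall>t\<in>torus m. emb (s + t) = emb s + emb t) \<and>
     (\<forall>s\<in>torus m. \<forall>t\<in>torus m. emb (torus_mult m L s t) = emb s * emb t) \<and>
     (\<forall>x. \<exists>s\<in>torus m. \<exists>t\<in>torus m. t \<noteq> 0 \<and> x = emb s * inverse (emb t))"

definition scale :: "(torus_elem \<Rightarrow> 'f::division_ring) \<Rightarrow> laurent \<Rightarrow> 'f \<Rightarrow> 'f" where
  "scale emb p x = emb (single 0 p) * x"

definition v_elt :: "(torus_elem \<Rightarrow> 'f::division_ring) \<Rightarrow> 'f" where  \<comment> \<open>the element \<open>v\<close> of \<open>\<F>\<close>\<close>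
  "v_elt emb = emb (single 0 (single 1 1))"

text \<open>The bar-involution, transported to the image of the torus in \<open>\<F>\<close>; only meaningful there.\<close>

definition bar :: "nat \<Rightarrow> (torus_elem \<Rightarrow> 'f::division_ring) \<Rightarrow> 'f \<Rightarrow> 'f" where
  "bar m emb x = emb (bar_torus (inv_into (torus m) emb x))"

lemma module_scale:
  fixes emb :: "torus_elem \<Rightarrow> 'f::division_ring"
  assumes "skew_field_of_fractions m L emb"
  shows "module (scale emb)"
proof
  have T: "single 0 p \<in> torus m" for p :: laurent
    by (auto simp: torus_def zlattice_def)
  have M: "torus_mult m L (single 0 p) (single 0 r) = single 0 (p * r)" for p r :: laurent
    by (cases "p = 0"; cases "r = 0") (simp_all add: torus_mult_def bil_def)
  fix p r :: laurent and x y :: 'f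
  show "scale emb p (x + y) = scale emb p x + scale emb p y"
    by (simp add: scale_def distrib_left)
  show "scale emb (p + r) x = scale emb p x + scale emb r x"
    using assms T by (simp add: scale_def skew_field_of_fractions_def single_add distrib_right)
  show "scale emb p (scale emb r x) = scale emb (p * r) x"
    using assms T by (simp add: scale_def skew_field_of_fractions_def M[symmetric] mult.assoc)
  show "scale emb 1 x = x"
    using assms by (simp add: scale_def skew_field_of_fractions_def)
qed

section \<open>Quantum seeds and mutation\<close>

definition column :: "nat \<Rightarrow> (nat \<Rightarrow> nat \<Rightarrow> int) \<Rightarrow> nat \<Rightarrow> ivec" where
  "column m B j = (\<Sum>i=1..m. single i (B i j))"

definition quantum_seed ::
    "nat \<Rightarrow> nat \<Rightarrow> (nat \<Rightarrow> nat \<Rightarrow> int) \<Rightarrow> (nat \<Rightarrow> int) \<Rightarrow> (nat \<Rightarrow> nat \<Rightarrow> int) \<Rightarrow> bool" where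
  "quantum_seed m n B d L \<longleftrightarrow>
     1 \<le> n \<and> n \<le> m \<and> (\<forall>j\<in>{1..n}. d j > 0) \<and>
     (\<forall>i\<in>{1..m}. \<forall>j\<in>{1..m}. L i j = - L j i) \<and>
     (\<forall>i\<in>{1..m}. \<forall>j\<in>{1..n}. bil m L (column m B j) (unit_vec i) = (if i = j then d j else 0))"

definition acyclic_seed :: "nat \<Rightarrow> (nat \<Rightarrow> nat \<Rightarrow> int) \<Rightarrow> bool" where
  "acyclic_seed n B \<longleftrightarrow> acyclic {(j, i). i \<in> {1..n} \<and> j \<in> {1..n} \<and> B i j > 0}"

text \<open>A seed inside \<open>\<F>\<close>.  \<open>frame s e\<close> is the distinguished basis element \<open>X\<^sup>e\<close> of the torus of
  \<open>s\<close>, viewed in \<open>\<F>\<close>; in particular the extended cluster of \<open>s\<close> is \<open>frame s (unit_vec i)\<close>,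
  \<open>1 \<le> i \<le> m\<close>.\<close>

record 'f seed =
  frame :: "ivec \<Rightarrow> 'f"
  exmat :: "nat \<Rightarrow> nat \<Rightarrow> int"
  gram :: "nat \<Rightarrow> nat \<Rightarrow> int"

definition initial_seed ::
    "(nat \<Rightarrow> nat \<Rightarrow> int) \<Rightarrow> (nat \<Rightarrow> nat \<Rightarrow> int) \<Rightarrow> (torus_elem \<Rightarrow> 'f::division_ring) \<Rightarrow> 'f seed" where
  "initial_seed B L emb = \<lparr>frame = (\<lambda>e. emb (single e 1)), exmat = B, gram = L\<rparr>"

text \<open>The basis element \<open>X\<^sup>e\<close> in terms of the extended cluster \<open>x\<close>:
  \<open>X\<^sup>e X\<^sup>f = v\<^bsup>\<Lambda>(e,f)\<^esup> X\<^bsup>e+f\<^esup>\<close> gives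
  \<open>x\<^sub>1\<^bsup>e1\<^esup> \<cdots> x\<^sub>m\<^bsup>em\<^esup> = v\<^bsup>s\<^esup> X\<^sup>e\<close> with \<open>s = \<Sum>\<^bsub>i<j\<^esub> \<Lambda>(e\<^sub>i,e\<^sub>j) e\<^sub>i e\<^sub>j\<close>.\<close>

definition based_monomial ::
    "nat \<Rightarrow> 'f \<Rightarrow> (nat \<Rightarrow> nat \<Rightarrow> int) \<Rightarrow> (nat \<Rightarrow> 'f) \<Rightarrow> ivec \<Rightarrow> 'f::division_ring" where
  "based_monomial m v L x e =
     v powi (- (\<Sum>j=1..m. \<Sum>i=1..<j. L i j * lookup e i * lookup e j)) *
     prod_list (map (\<lambda>i. x i powi lookup e i) [1..<Suc m])"

definition exch_vec :: "nat \<Rightarrow> (nat \<Rightarrow> nat \<Rightarrow> int) \<Rightarrow> nat \<Rightarrow> ivec" where  \<comment> \<open>\<open>e'\<^sub>k\<close>\<close>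
  "exch_vec m B k = - unit_vec k + pos_vec (column m B k)"

definition new_variable :: "nat \<Rightarrow> 'f seed \<Rightarrow> nat \<Rightarrow> 'f::division_ring" where  \<comment> \<open>\<open>X'\<^sub>k\<close>\<close>
  "new_variable m s k =
     frame s (exch_vec m (exmat s) k) +
     frame s (- unit_vec k + pos_vec (- column m (exmat s) k))"

definition mutate_matrix :: "(nat \<Rightarrow> nat \<Rightarrow> int) \<Rightarrow> nat \<Rightarrow> nat \<Rightarrow> nat \<Rightarrow> int" where
  "mutate_matrix B k i j =
     (if i = k \<or> j = k then - B i j
      else B i j + pos (B i k) * pos (B k j) - pos (- B i k) * pos (- B k j))"

definition mutate_gram ::
    "nat \<Rightarrow> (nat \<Rightarrow> nat \<Rightarrow> int) \<Rightarrow> (nat \<Rightarrow> nat \<Rightarrow> int) \<Rightarrow> nat \<Rightarrow> nat \<Rightarrow> nat \<Rightarrow> int" where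
  "mutate_gram m B L k i j =
     (if i = k \<and> j = k then 0
      else if i = k then bil m L (exch_vec m B k) (unit_vec j)
      else if j = k then - bil m L (exch_vec m B k) (unit_vec i)
      else L i j)"

definition mutate :: "nat \<Rightarrow> 'f \<Rightarrow> nat \<Rightarrow> 'f seed \<Rightarrow> 'f::division_ring seed" where
  "mutate m v k s =
     (let x = (\<lambda>i. if i = k then new_variable m s k else frame s (unit_vec i));
          L = mutate_gram m (exmat s) (gram s) k
      in \<lparr>frame = based_monomial m v L x, exmat = mutate_matrix (exmat s) k, gram = L\<rparr>)"

inductive_set reachable_seeds :: "nat \<Rightarrow> nat \<Rightarrow> 'f \<Rightarrow> 'f seed \<Rightarrow> 'f::division_ring seed set"
  for m n :: nat and v :: 'f and s0 :: "'f seed" where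
  initial: "s0 \<in> reachable_seeds m n v s0"
| step: "s \<in> reachable_seeds m n v s0 \<Longrightarrow> k \<in> {1..n} \<Longrightarrow> mutate m v k s \<in> reachable_seeds m n v s0"

section \<open>The quantum cluster algebra\<close>

definition ZP :: "nat \<Rightarrow> nat \<Rightarrow> (torus_elem \<Rightarrow> 'f::division_ring) \<Rightarrow> 'f set" where
  "ZP m n emb = emb ` {t. \<forall>e\<in>keys t. keys e \<subseteq> {n+1..m}}"

text \<open>Since \<open>\<int>\<P>\<close> is not central, a \<open>\<int>\<P>\<close>-subalgebra of \<open>\<F>\<close> is a subring containing \<open>\<int>\<P>\<close>
  (which already contains \<open>0\<close>, \<open>1\<close> and \<open>-1\<close>).\<close>

inductive_set cluster_algebra ::
    "nat \<Rightarrow> nat \<Rightarrow> (nat \<Rightarrow> nat \<Rightarrow> int) \<Rightarrow> (nat \<Rightarrow> nat \<Rightarrow> int) \<Rightarrow>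
     (torus_elem \<Rightarrow> 'f) \<Rightarrow> 'f::division_ring set"
  for m n :: nat and B L :: "nat \<Rightarrow> nat \<Rightarrow> int" and emb :: "torus_elem \<Rightarrow> 'f" where
  coeff: "x \<in> ZP m n emb \<Longrightarrow> x \<in> cluster_algebra m n B L emb"
| cluster: "s \<in> reachable_seeds m n (v_elt emb) (initial_seed B L emb) \<Longrightarrow> i \<in> {1..n} \<Longrightarrow>
    frame s (unit_vec i) \<in> cluster_algebra m n B L emb"
| add: "x \<in> cluster_algebra m n B L emb \<Longrightarrow> y \<in> cluster_algebra m n B L emb \<Longrightarrow>
    x + y \<in> cluster_algebra m n B L emb"
| uminus: "x \<in> cluster_algebra m n B L emb \<Longrightarrow> - x \<in> cluster_algebra m n B L emb"
| mult: "x \<in> cluster_algebra m n B L emb \<Longrightarrow> y \<in> cluster_algebra m n B L emb \<Longrightarrow>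
    x * y \<in> cluster_algebra m n B L emb"

section \<open>The elements \<open>E\<^sub>a\<close>\<close>

definition increasing_list :: "'i set \<Rightarrow> 'i rel \<Rightarrow> 'i list" where
  "increasing_list I ord =
     (THE ks. set ks = I \<and> distinct ks \<and> sorted_wrt (\<lambda>i j. (i, j) \<in> ord) ks)"

definition ordered_prod :: "'i set \<Rightarrow> 'i rel \<Rightarrow> ('i \<Rightarrow> 'f::monoid_mult) \<Rightarrow> 'f" where
  "ordered_prod I ord f = prod_list (map f (increasing_list I ord))"

text \<open>The common shape of \<open>E\<^sub>a\<^sup>\<circ>\<close> and its leading term: \<open>y k\<close> is \<open>X'\<^sub>k\<close> for the former and
  \<open>X\<close> to the power \<open>e'\<^sub>k\<close> for the latter.\<close>

definition E_expr ::
    "nat \<Rightarrow> nat \<Rightarrow> (torus_elem \<Rightarrow> 'f::division_ring) \<Rightarrow> nat rel \<Rightarrow> (nat \<Rightarrow> 'f) \<Rightarrow> ivec \<Rightarrow> 'f" where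
  "E_expr m n emb ord y a =
     emb (single ((\<Sum>i=n+1..m. single i (lookup a i)) + (\<Sum>j=1..n. single j (pos (lookup a j)))) 1) *
     ordered_prod {1..n} ord (\<lambda>k. y k ^ nat (pos (- lookup a k)))"

definition E_circ ::
    "nat \<Rightarrow> nat \<Rightarrow> (nat \<Rightarrow> nat \<Rightarrow> int) \<Rightarrow> (nat \<Rightarrow> nat \<Rightarrow> int) \<Rightarrow>
     (torus_elem \<Rightarrow> 'f::division_ring) \<Rightarrow> nat rel \<Rightarrow> ivec \<Rightarrow> 'f" where
  "E_circ m n B L emb ord a = E_expr m n emb ord (new_variable m (initial_seed B L emb)) a"

definition LT_E ::
    "nat \<Rightarrow> nat \<Rightarrow> (nat \<Rightarrow> nat \<Rightarrow> int) \<Rightarrow>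
     (torus_elem \<Rightarrow> 'f::division_ring) \<Rightarrow> nat rel \<Rightarrow> ivec \<Rightarrow> 'f" where
  "LT_E m n B emb ord a = E_expr m n emb ord (\<lambda>k. emb (single (exch_vec m B k) 1)) a"

definition nu ::
    "nat \<Rightarrow> nat \<Rightarrow> (nat \<Rightarrow> nat \<Rightarrow> int) \<Rightarrow>
     (torus_elem \<Rightarrow> 'f::division_ring) \<Rightarrow> nat rel \<Rightarrow> ivec \<Rightarrow> int" where
  "nu m n B emb ord a =
     (THE N. bar m emb (scale emb (single N 1) (LT_E m n B emb ord a)) =
             scale emb (single N 1) (LT_E m n B emb ord a))"

definition E_elt ::
    "nat \<Rightarrow> nat \<Rightarrow> (nat \<Rightarrow> nat \<Rightarrow> int) \<Rightarrow> (nat \<Rightarrow> nat \<Rightarrow> int) \<Rightarrow>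
     (torus_elem \<Rightarrow> 'f::division_ring) \<Rightarrow> nat rel \<Rightarrow> ivec \<Rightarrow> 'f" where
  "E_elt m n B L emb ord a = scale emb (single (nu m n B emb ord a) 1) (E_circ m n B L emb ord a)"

definition neg_total :: "nat \<Rightarrow> ivec \<Rightarrow> int" where
  "neg_total n a = (\<Sum>k=1..n. pos (- lookup a k))"

definition prec :: "nat \<Rightarrow> ivec \<Rightarrow> ivec \<Rightarrow> bool" where
  "prec n a' a \<longleftrightarrow> neg_total n a' < neg_total n a"

section \<open>Bases and coefficient-restricted combinations\<close>

definition family_basis ::
    "('k::comm_ring_1 \<Rightarrow> 'f::ab_group_add \<Rightarrow> 'f) \<Rightarrow> 'i set \<Rightarrow> ('i \<Rightarrow> 'f) \<Rightarrow> 'f set \<Rightarrow> bool" where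
  "family_basis scl I b M \<longleftrightarrow>
     inj_on b I \<and> \<not> module.dependent scl (b ` I) \<and> module.span scl (b ` I) = M"

text \<open>\<open>\<Sum>\<^bsub>i\<in>I\<^esub> P b\<^sub>i\<close>, which is \<open>\<Oplus>\<^bsub>i\<in>I\<^esub> P b\<^sub>i\<close> when the \<open>b\<^sub>i\<close> are linearly independent.\<close>

definition combinations ::
    "('k::comm_ring_1 \<Rightarrow> 'f::ab_group_add \<Rightarrow> 'f) \<Rightarrow> 'k set \<Rightarrow> 'i set \<Rightarrow> ('i \<Rightarrow> 'f) \<Rightarrow> 'f set" where
  "combinations scl P I b =
     {\<Sum>i\<in>S. scl (c i) (b i) | S c. finite S \<and> S \<subseteq> I \<and> (\<forall>i\<in>S. c i \<in> P)}"

end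

(*
  Write T for the quantum torus of a seed and S_j for the subring of T generated by the X^e with
  e_j >= 0 and by X'_j; S_j is the intersection of T with the torus of the seed mutated at j.
  Let U be the intersection of S_1, ..., S_n.

  U(mu_k s) is contained in U(s) for every seed s: an element of S_j(mu_k s) lands in S_j(s) after
  multiplication by a power of X'_k, and X'_k cancels in S_j, because its two monomials have
  different degrees in the grading Lambda(-, e_k), in which S_j is homogeneous.  Hence the cluster
  algebra lies in U of the initial seed.

  Now let the initial seed be acyclic.  The leading exponent pi(a) of E_a is a bijection of Z^m, and
  E_a is supported on the parallelepiped pi(a) - sum_k c_k b_k with 0 <= c_k <= [-a_k]_+.  An element
  y of U whose support has the maximal exponent pi(a) also has an exponent pi(a) - sum_k t_k b_k with
  t_k >= [-a_k]_+: descend along b_1, b_2, ... in topological order, each step being at least as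
  long as divisibility by powers of X'_k forces.  So subtracting a multiple of E_a from y does not
  leave a prescribed finite convex box of exponents, and the elimination terminates.  This gives
  U = span E_a; applied to bar(E_a) - E_a and the parallelepiped of E_a it gives triangularity, since
  every other E_a' supported in that parallelepiped has r(a') < r(a).  The basis C_a then follows
  from Lusztig's lemma, by recursion on r.
*)
theory Submission
  imports Defs "HOL-Library.FuncSet"
begin

section \<open>Exponent vectors\<close>

text \<open>The argument closes the chain span E <= A <= U <= span E, so the cluster algebra is
  never presented by relations. Compatibility supplies the degrees w_k = Lambda(-, e_k), with
  w_k(b_j) = d_k if j = k and 0 otherwise. They make the columns independent, read off the
  coefficients of a combination of columns and measure how wide a support is along b_j. The obstacle
  is termination: infinitely many exponents lie below a given one, and each subtracted E_a brings in
  new ones. So the far corner of its parallelepiped has to be controlled along with its leading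
  exponent. Two linear orders occur. \<open>ord\<close> arranges the factors of E_a, which affects
  coefficients but neither the leading exponent nor the enclosing parallelepiped; elimination
  follows a topological order. In the latter, rows of later vertices have nonnegative entries in
  earlier columns. This makes the passage from a to pi(a) unitriangular, and makes each descent step
  lower the later coordinates far enough. A mutated torus is not contained in the initial one, so
  independence of its monomials is an assertion about F and needs its own proof.\<close>

lemma zlattice_simps [simp]:
  "0 \<in> zlattice m"
  "i \<in> {1..m} \<Longrightarrow> single i c \<in> zlattice m"
  by (auto simp: zlattice_def)

lemma zlattice_iff: "e \<in> zlattice m \<longleftrightarrow> (\<forall>i. i \<notin> {1..m} \<longrightarrow> lookup e i = 0)"
  unfolding zlattice_def by (auto simp: in_keys_iff subset_iff)

lemma zlattice_add [intro, simp]: "e \<in> zlattice m \<Longrightarrow> f \<in> zlattice m \<Longrightarrow> e + f \<in> zlattice m"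
  and zlattice_diff [intro, simp]: "e \<in> zlattice m \<Longrightarrow> f \<in> zlattice m \<Longrightarrow> e - f \<in> zlattice m"
  and zlattice_uminus [intro, simp]: "e \<in> zlattice m \<Longrightarrow> - e \<in> zlattice m"
  and zlattice_cmul [intro, simp]: "e \<in> zlattice m \<Longrightarrow> frag_cmul c e \<in> zlattice m"
  by (auto simp: zlattice_iff lookup_add lookup_minus)

lemma zlattice_sum [intro, simp]:
  "(\<And>i. i \<in> I \<Longrightarrow> f i \<in> zlattice m) \<Longrightarrow> sum f I \<in> zlattice m"
  by (induction I rule: infinite_finite_induct) auto

lemma lookup_column: "lookup (column m B j) i = (if i \<in> {1..m} then B i j else 0)"
  by (auto simp: column_def lookup_sum lookup_single when_def)

lemma column_in_zlattice [simp]: "column m B j \<in> zlattice m"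
  by (auto simp: column_def)

lemma lookup_pos_vec [simp]: "lookup (pos_vec e) i = pos (lookup e i)"
  by (simp add: pos_vec_def Poly_Mapping.map.rep_eq when_def)

lemma pos_vec_in_zlattice [simp]: "e \<in> zlattice m \<Longrightarrow> pos_vec e \<in> zlattice m"
  by (auto simp: zlattice_iff)

lemma lookup_exch_vec:
  "lookup (exch_vec m B k) i = (if i \<in> {1..m} then pos (B i k) else 0) - (if i = k then 1 else 0)"
  by (auto simp: exch_vec_def lookup_add lookup_minus lookup_single lookup_column when_def)

lemma bil_add_left: "bil m L (e + f) g = bil m L e g + bil m L f g"
  and bil_add_right: "bil m L e (f + g) = bil m L e f + bil m L e g"
  by (simp_all add: bil_def lookup_add algebra_simps sum.distrib)

lemma bil_uminus_left: "bil m L (- e) g = - bil m L e g"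
  and bil_uminus_right: "bil m L e (- g) = - bil m L e g"
  by (simp_all add: bil_def sum_negf)

lemma bil_diff_left: "bil m L (e - f) g = bil m L e g - bil m L f g"
  and bil_diff_right: "bil m L e (f - g) = bil m L e f - bil m L e g"
  by (simp_all add: bil_def lookup_minus algebra_simps sum_subtractf)

lemma bil_cmul_left: "bil m L (frag_cmul c e) g = c * bil m L e g"
  and bil_cmul_right: "bil m L e (frag_cmul c g) = c * bil m L e g"
  by (simp_all add: bil_def sum_distrib_left mult_ac)

lemma bil_zero [simp]: "bil m L 0 g = 0" "bil m L e 0 = 0"
  by (simp_all add: bil_def)

lemmas bil_linear = bil_add_left bil_add_right bil_uminus_left bil_uminus_right
  bil_diff_left bil_diff_right bil_cmul_left bil_cmul_right

lemma bil_unit_right: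
  assumes "i \<in> {1..m}"
  shows "bil m L e (unit_vec i) = (\<Sum>k=1..m. lookup e k * L k i)"
proof -
  have "(\<Sum>j=1..m. lookup e k * L k j * lookup (unit_vec i) j) =
      (\<Sum>j=1..m. if j = i then lookup e k * L k i else 0)" for k
    by (rule sum.cong) (auto simp: lookup_single when_def)
  then show ?thesis
    using assms by (simp add: bil_def)
qed

lemma bil_unit_unit:
  assumes "i \<in> {1..m}" "j \<in> {1..m}"
  shows "bil m L (unit_vec i) (unit_vec j) = L i j"
proof -
  have "(\<Sum>k=1..m. lookup (unit_vec i) k * L k j) = (\<Sum>k=1..m. if k = i then L i j else 0)"
    by (rule sum.cong) (auto simp: lookup_single when_def)
  then show ?thesis
    using assms by (simp add: bil_unit_right)
qed

lemma bil_expand_right: "bil m L e f = (\<Sum>i=1..m. lookup f i * bil m L e (unit_vec i))"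
proof -
  have "(\<Sum>i=1..m. lookup f i * bil m L e (unit_vec i)) =
      (\<Sum>i=1..m. lookup f i * (\<Sum>k=1..m. lookup e k * L k i))"
    by (auto intro!: sum.cong simp: bil_unit_right)
  also have "\<dots> = bil m L e f"
    unfolding bil_def sum_distrib_left by (subst sum.swap) (simp add: mult_ac)
  finally show ?thesis ..
qed

lemma bil_skew:
  assumes "\<forall>i\<in>{1..m}. \<forall>j\<in>{1..m}. L i j = - L j i"
  shows "bil m L e f = - bil m L f e"
proof -
  have "bil m L f e = (\<Sum>i=1..m. \<Sum>j=1..m. lookup e i * L j i * lookup f j)"
    unfolding bil_def by (subst sum.swap) (simp add: mult_ac)
  also have "\<dots> = (\<Sum>i=1..m. \<Sum>j=1..m. - (lookup e i * L i j * lookup f j))"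
    using assms by (intro sum.cong refl) (metis mult_minus_left mult_minus_right)
  also have "\<dots> = - bil m L e f"
    by (simp add: bil_def sum_negf)
  finally show ?thesis by simp
qed

text \<open>Identities between additive maps on the lattice need only be checked on unit vectors;
  this is how the mutated form is compared with a pullback of the old one.\<close>

lemma zlattice_induct [consumes 1, case_names zero add uminus unit]:
  assumes "e \<in> zlattice m" "P 0"
    "\<And>e f. e \<in> zlattice m \<Longrightarrow> f \<in> zlattice m \<Longrightarrow> P e \<Longrightarrow> P f \<Longrightarrow> P (e + f)"
    "\<And>e. e \<in> zlattice m \<Longrightarrow> P e \<Longrightarrow> P (- e)"
    "\<And>i. i \<in> keys e \<Longrightarrow> P (unit_vec i)"
  shows "P e"
proof -
  have "keys e \<subseteq> keys e \<inter> {1..m}"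
    using assms(1) by (auto simp: zlattice_def)
  then have "P e \<and> e \<in> zlattice m"
  proof (induction rule: frag_induction)
    case (diff a b)
    then show ?case
      using assms(3)[of a "- b"] assms(4)[of b] by auto
  qed (use assms in auto)
  then show ?thesis ..
qed

section \<open>Central scalars and based frames\<close>

text \<open>The scalars are kept apart from any frame because all seeds reached by mutation share
  the same copy of Z[v,1/v] in F.\<close>

locale central_scalars =
  fixes \<kappa> :: "laurent \<Rightarrow> 'f::division_ring"
  assumes kappa_one: "\<kappa> 1 = 1"
    and kappa_add: "\<kappa> (p + q) = \<kappa> p + \<kappa> q"
    and kappa_mult: "\<kappa> (p * q) = \<kappa> p * \<kappa> q"
    and kappa_central: "\<kappa> p * x = x * \<kappa> p"
begin

definition sc :: "laurent \<Rightarrow> 'f \<Rightarrow> 'f" where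
  "sc p x = \<kappa> p * x"

sublocale module sc
  by standard
    (simp_all add: sc_def kappa_add kappa_mult kappa_one distrib_left distrib_right mult.assoc)

definition vp :: "int \<Rightarrow> 'f" where
  "vp k = \<kappa> (single k 1)"

lemma vp_0 [simp]: "vp 0 = 1"
  using kappa_one by (simp add: vp_def)

lemma vp_add: "vp (a + b) = vp a * vp b"
  by (simp add: vp_def mult_single flip: kappa_mult)

lemma vp_central: "vp a * x = x * vp a"
  by (simp add: vp_def kappa_central)

text \<open>The \<open>NO_MATCH\<close> guard stops two powers of v from being swapped forever when
  this is a rewrite rule.\<close>

lemma vp_left_commute: "NO_MATCH (vp c) x \<Longrightarrow> x * (vp a * y) = vp a * (x * y)"
  by (metis mult.assoc vp_central)

lemma vp_vp: "vp a * (vp c * x) = vp (a + c) * x"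
  by (simp add: vp_add mult.assoc)

lemma vp_nonzero [simp]: "vp a \<noteq> 0"
  using vp_add[of a "- a"] by auto

lemma vp_minus: "vp (- a) = inverse (vp a)"
  using vp_add[of "- a" a] by (metis add.left_inverse inverse_unique nonzero_inverse_inverse_eq vp_0 vp_nonzero)

lemma vp_cancel [simp]: "vp a * (vp (- a) * x) = x" "vp (- a) * (vp a * x) = x"
  by (simp_all add: vp_minus flip: mult.assoc)

lemma vp_powi: "vp 1 powi k = vp k"
proof -
  have *: "vp 1 ^ i = vp (int i)" for i
    by (induction i) (simp_all add: vp_add)
  show ?thesis
    using *[of "nat (- k)"]
    by (cases "k \<ge> 0") (simp_all add: power_int_def * power_inverse vp_minus)
qed

lemma sc_vp: "sc (single k 1) x = vp k * x"
  by (simp add: sc_def vp_def)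

lemma sc_mult: "sc p (x * y) = sc p x * y" "sc p (x * y) = x * sc p y"
  by (simp_all add: sc_def mult.assoc) (metis kappa_central mult.assoc)

lemma span_scale_iff: "vp k * x \<in> span S \<longleftrightarrow> x \<in> span S"
  by (metis sc_vp span_scale vp_cancel(2))

end

text \<open>A quantum torus sitting in F, described by its monomials alone. A mutated frame can thus
  be another instance although its monomials leave the original torus.\<close>

locale based_frame = central_scalars \<kappa> for \<kappa> :: "laurent \<Rightarrow> 'f::division_ring" +
  fixes m :: nat and L :: "nat \<Rightarrow> nat \<Rightarrow> int" and X :: "ivec \<Rightarrow> 'f"
  assumes gram_skew: "\<forall>i\<in>{1..m}. \<forall>j\<in>{1..m}. L i j = - L j i"
    and X_zero [simp]: "X 0 = 1"
    and X_mult: "e \<in> zlattice m \<Longrightarrow> f \<in> zlattice m \<Longrightarrow> X e * X f = vp (bil m L e f) * X (e + f)"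
    and X_indep: "finite S \<Longrightarrow> S \<subseteq> zlattice m \<Longrightarrow> (\<Sum>e\<in>S. sc (c e) (X e)) = 0 \<Longrightarrow> e \<in> S \<Longrightarrow> c e = 0"
begin

abbreviation Z :: "ivec set" where "Z \<equiv> zlattice m"

abbreviation Lam :: "ivec \<Rightarrow> ivec \<Rightarrow> int" where "Lam \<equiv> bil m L"

lemma Lam_skew: "Lam e f = - Lam f e"
  by (rule bil_skew[OF gram_skew])

lemma Lam_same [simp]: "Lam e e = 0"
  using Lam_skew[of e e] by simp

lemma X_add: "e \<in> Z \<Longrightarrow> f \<in> Z \<Longrightarrow> X (e + f) = vp (- Lam e f) * (X e * X f)"
  by (simp add: X_mult)

lemma X_inverse: "e \<in> Z \<Longrightarrow> X e * X (- e) = 1" "e \<in> Z \<Longrightarrow> X (- e) * X e = 1"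
  using X_mult[of e "- e"] X_mult[of "- e" e] by (simp_all add: bil_linear)

lemma X_nonzero [simp]: "e \<in> Z \<Longrightarrow> X e \<noteq> 0"
  using X_inverse[of e] by auto

lemma X_uminus: "e \<in> Z \<Longrightarrow> X (- e) = inverse (X e)"
  using X_inverse[of e] by (simp add: inverse_unique)

lemma X_commute: "e \<in> Z \<Longrightarrow> f \<in> Z \<Longrightarrow> X e * X f = vp (2 * Lam e f) * (X f * X e)"
  using Lam_skew[of f e] by (simp add: X_mult add.commute flip: mult.assoc vp_add)

lemma X_power: "e \<in> Z \<Longrightarrow> X e ^ k = X (frag_cmul (int k) e)"
proof (induction k)
  case (Suc k)
  have "frag_cmul (int (Suc k)) e = e + frag_cmul (int k) e"
    by (simp add: frag_cmul_distrib)
  with Suc show ?case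
    by (simp add: X_mult bil_linear)
qed simp

section \<open>Coefficients and supports in the quantum torus\<close>

definition torus_span :: "'f set" where
  "torus_span = span (X ` Z)"

definition represents :: "'f \<Rightarrow> (ivec \<Rightarrow> laurent) \<Rightarrow> bool" where
  "represents y c \<longleftrightarrow> finite {e. c e \<noteq> 0} \<and> {e. c e \<noteq> 0} \<subseteq> Z \<and> y = (\<Sum>e | c e \<noteq> 0. sc (c e) (X e))"

lemma represents_superset:
  assumes "represents y c" "finite S" "{e. c e \<noteq> 0} \<subseteq> S"
  shows "y = (\<Sum>e\<in>S. sc (c e) (X e))"
  using assms unfolding represents_def
  by (metis (mono_tags, lifting) DiffD2 mem_Collect_eq scale_zero_left sum.mono_neutral_left)

lemma represents_intro:
  assumes "finite S" "S \<subseteq> Z" "\<And>e. e \<notin> S \<Longrightarrow> c e = 0" "y = (\<Sum>e\<in>S. sc (c e) (X e))"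
  shows "represents y c"
proof -
  have *: "{e. c e \<noteq> 0} \<subseteq> S"
    using assms by auto
  then show ?thesis
    using assms finite_subset[OF *] unfolding represents_def
    by (auto intro!: sum.mono_neutral_right)
qed

lemma represents_add:
  assumes "represents y c" "represents z c'"
  shows "represents (y + z) (\<lambda>e. c e + c' e)"
proof (rule represents_intro)
  let ?S = "{e. c e \<noteq> 0} \<union> {e. c' e \<noteq> 0}"
  show fin: "finite ?S"
    using assms by (auto simp: represents_def)
  show "y + z = (\<Sum>e\<in>?S. sc (c e + c' e) (X e))"
    unfolding represents_superset[OF assms(1) fin Un_upper1]
      represents_superset[OF assms(2) fin Un_upper2]
    by (simp add: sum.distrib scale_left_distrib)
qed (use assms in \<open>auto simp: represents_def\<close>)

lemma represents_scale:
  assumes "represents y c"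
  shows "represents (sc p y) (\<lambda>e. p * c e)"
  using assms unfolding represents_def
  by (intro represents_intro[where S = "{e. c e \<noteq> 0}", unfolded represents_def])
    (auto simp: scale_sum_right)

lemma represents_X: "e \<in> Z \<Longrightarrow> represents (X e) (\<lambda>f. if f = e then 1 else 0)"
  by (rule represents_intro[where S = "{e}"]) auto

lemma represents_zero: "represents 0 (\<lambda>_. 0)"
  by (rule represents_intro[where S = "{}"]) auto

lemma represents_unique:
  assumes "represents y c" "represents y c'"
  shows "c = c'"
proof
  fix e
  let ?c = "\<lambda>e. c e + (- 1) * c' e"
  have "represents (y + sc (- 1) y) ?c"
    using assms by (intro represents_add represents_scale)
  then have *: "represents 0 ?c"
    by simp
  then have "?c e = 0" if "e \<in> {e. ?c e \<noteq> 0}"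
    using X_indep[of "{e. ?c e \<noteq> 0}" ?c e] that unfolding represents_def by argo
  then show "c e = c' e"
    by auto
qed

lemma represents_exists: "y \<in> torus_span \<Longrightarrow> \<exists>c. represents y c"
  unfolding torus_span_def
proof (induction y rule: span_induct_alt)
  case base
  then show ?case
    using represents_zero by blast
next
  case (step c x y)
  then show ?case
    using represents_add represents_scale represents_X by blast
qed

definition cf :: "'f \<Rightarrow> ivec \<Rightarrow> laurent" where
  "cf y = (THE c. represents y c)"

lemma cf_eq: "represents y c \<Longrightarrow> cf y = c"
  unfolding cf_def using represents_unique by blast

lemma represents_cf: "y \<in> torus_span \<Longrightarrow> represents y (cf y)"
  using represents_exists cf_eq by metis

lemma represents_torus: "represents y c \<Longrightarrow> y \<in> torus_span"
  unfolding represents_def torus_span_def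
  by (auto intro!: span_sum span_scale intro: span_base)

definition supp :: "'f \<Rightarrow> ivec set" where
  "supp y = {e. cf y e \<noteq> 0}"

lemma cf_add: "y \<in> torus_span \<Longrightarrow> z \<in> torus_span \<Longrightarrow> cf (y + z) e = cf y e + cf z e"
  by (simp add: cf_eq[OF represents_add[OF represents_cf represents_cf]])

lemma cf_scale: "y \<in> torus_span \<Longrightarrow> cf (sc p y) e = p * cf y e"
  by (simp add: cf_eq[OF represents_scale[OF represents_cf]])

lemma cf_zero [simp]: "cf 0 e = 0"
  by (simp add: cf_eq[OF represents_zero])

lemma cf_X: "f \<in> Z \<Longrightarrow> cf (X f) e = (if e = f then 1 else 0)"
  by (simp add: cf_eq[OF represents_X])

lemma torus_closed [intro, simp]:
  "0 \<in> torus_span"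
  "y \<in> torus_span \<Longrightarrow> z \<in> torus_span \<Longrightarrow> y + z \<in> torus_span"
  "y \<in> torus_span \<Longrightarrow> z \<in> torus_span \<Longrightarrow> y - z \<in> torus_span"
  "y \<in> torus_span \<Longrightarrow> - y \<in> torus_span"
  "y \<in> torus_span \<Longrightarrow> sc p y \<in> torus_span"
  "y \<in> torus_span \<Longrightarrow> vp k * y \<in> torus_span"
  "f \<in> Z \<Longrightarrow> X f \<in> torus_span"
  unfolding torus_span_def
  by (rule span_zero span_add span_diff span_neg span_scale span_scale_iff[THEN iffD2]
      span_base[OF imageI]; assumption)+

lemma torus_sum [intro, simp]: "(\<And>i. i \<in> I \<Longrightarrow> f i \<in> torus_span) \<Longrightarrow> sum f I \<in> torus_span"
  by (simp add: torus_span_def span_sum)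

lemma torus_induct [consumes 1, case_names zero step]:
  assumes "y \<in> torus_span" "P 0"
    and "\<And>c f z. f \<in> Z \<Longrightarrow> z \<in> torus_span \<Longrightarrow> P z \<Longrightarrow> P (sc c (X f) + z)"
  shows "P y"
proof -
  have "y \<in> torus_span \<and> P y"
    using assms(1)[unfolded torus_span_def]
  proof (induction y rule: span_induct_alt)
    case (step c x y)
    then show ?case
      using assms(3) by auto
  qed (simp add: assms(2))
  then show ?thesis ..
qed

lemma cf_uminus: "y \<in> torus_span \<Longrightarrow> cf (- y) e = - cf y e"
  using cf_scale[of y "- 1" e] by simp

lemma cf_diff: "y \<in> torus_span \<Longrightarrow> z \<in> torus_span \<Longrightarrow> cf (y - z) e = cf y e - cf z e"
  using cf_add[of y "- z" e] cf_uminus[of z e] by simp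

lemma cf_sum: "(\<And>i. i \<in> I \<Longrightarrow> f i \<in> torus_span) \<Longrightarrow> cf (sum f I) e = (\<Sum>i\<in>I. cf (f i) e)"
  by (induction I rule: infinite_finite_induct) (auto simp: cf_add)

lemma cf_vp: "y \<in> torus_span \<Longrightarrow> cf (vp k * y) e = single k 1 * cf y e"
  using cf_scale[of y "single k 1" e] by (simp add: sc_vp)

lemma finite_supp [simp]: "y \<in> torus_span \<Longrightarrow> finite (supp y)"
  using represents_cf unfolding represents_def supp_def by blast

lemma supp_subset: "y \<in> torus_span \<Longrightarrow> supp y \<subseteq> Z"
  using represents_cf unfolding represents_def supp_def by blast

lemma torus_expand: "y \<in> torus_span \<Longrightarrow> y = (\<Sum>e\<in>supp y. sc (cf y e) (X e))"
  using represents_cf unfolding represents_def supp_def by blast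

lemma torus_eqI:
  assumes "y \<in> torus_span" "z \<in> torus_span" "\<And>e. cf y e = cf z e"
  shows "y = z"
proof -
  have "cf y = cf z"
    using assms(3) by blast
  then show ?thesis
    using represents_cf[OF assms(1)] represents_cf[OF assms(2)] by (simp add: represents_def)
qed

lemma supp_empty: "y \<in> torus_span \<Longrightarrow> supp y = {} \<longleftrightarrow> y = 0"
proof
  assume "y \<in> torus_span" "supp y = {}"
  then show "y = 0"
    by (subst torus_expand) simp_all
qed (simp add: supp_def)

lemma torus_mult_closed [intro, simp]:
  assumes "y \<in> torus_span" "z \<in> torus_span"
  shows "y * z \<in> torus_span"
proof -
  have *: "X f * z \<in> torus_span" if "f \<in> Z" for f
    using assms(2) unfolding torus_span_def
  proof (induction z rule: span_induct_alt)
    case (step c x y)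
    then obtain e where e: "e \<in> Z" "x = X e" by auto
    then have "X f * x \<in> span (X ` Z)"
      using that by (auto simp: X_mult span_scale_iff intro: span_base)
    then show ?case
      using step by (auto simp: distrib_left sc_mult(2)[symmetric] intro!: span_add span_scale)
  qed (auto simp: span_zero)
  show ?thesis
    using assms(1)[unfolded torus_span_def]
  proof (induction y rule: span_induct_alt)
    case (step c x y)
    then show ?case
      using * by (auto simp: distrib_right sc_mult(1)[symmetric])
  qed auto
qed

lemma torus_one [simp]: "1 \<in> torus_span"
  using torus_closed(7)[of 0] by simp

lemma torus_power [simp]: "y \<in> torus_span \<Longrightarrow> y ^ k \<in> torus_span"
  by (induction k) auto

lemma cf_X_mult:
  assumes "y \<in> torus_span" "f \<in> Z"
  shows "cf (X f * y) e = single (Lam f (e - f)) 1 * cf y (e - f)"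
  using assms(1)
proof (induction y rule: torus_induct)
  case (step c g y)
  have "cf (X f * X g) e = single (Lam f (e - f)) 1 * cf (X g) (e - f)"
    using step assms by (auto simp: X_mult cf_vp cf_X bil_linear)
  then show ?case
    using step assms
    by (simp add: distrib_left sc_mult(2)[symmetric] cf_add cf_scale algebra_simps)
qed simp

lemma cf_mult_X:
  assumes "y \<in> torus_span" "f \<in> Z"
  shows "cf (y * X f) e = single (Lam (e - f) f) 1 * cf y (e - f)"
  using assms(1)
proof (induction y rule: torus_induct)
  case (step c g y)
  have "cf (X g * X f) e = single (Lam (e - f) f) 1 * cf (X g) (e - f)"
    using step assms by (auto simp: X_mult cf_vp cf_X bil_linear)
  then show ?case
    using step assms
    by (simp add: distrib_right sc_mult(1)[symmetric] cf_add cf_scale algebra_simps)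
qed simp

lemma single_unit_mult_eq_0 [simp]: "single (k::int) (1::int) * (p::laurent) = 0 \<longleftrightarrow> p = 0"
  by (metis frag_of_nonzero mult_eq_0_iff)

text \<open>Projection onto the monomials whose exponent satisfies \<open>Q\<close>. For a level set
  of a grading this is a homogeneous component; for a line it is the part of \<open>y\<close>
  supported on that line.\<close>

definition pr :: "(ivec \<Rightarrow> bool) \<Rightarrow> 'f \<Rightarrow> 'f" where
  "pr Q y = (\<Sum>e | e \<in> supp y \<and> Q e. sc (cf y e) (X e))"

lemma pr_torus [simp]: "y \<in> torus_span \<Longrightarrow> pr Q y \<in> torus_span"
  unfolding pr_def using supp_subset by (auto intro!: torus_sum torus_closed)

lemma cf_pr: "y \<in> torus_span \<Longrightarrow> cf (pr Q y) e = (if Q e then cf y e else 0)"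
proof -
  assume y: "y \<in> torus_span"
  have "represents (pr Q y) (\<lambda>e. if Q e then cf y e else 0)"
    using y supp_subset[OF y] finite_supp[OF y]
    by (intro represents_intro[where S = "{e \<in> supp y. Q e}"]) (auto simp: pr_def supp_def)
  then show ?thesis
    by (simp add: cf_eq)
qed

lemma pr_add: "y \<in> torus_span \<Longrightarrow> z \<in> torus_span \<Longrightarrow> pr Q (y + z) = pr Q y + pr Q z"
  by (rule torus_eqI) (simp_all add: cf_pr cf_add)

lemma pr_scale: "y \<in> torus_span \<Longrightarrow> pr Q (sc p y) = sc p (pr Q y)"
  by (rule torus_eqI) (simp_all add: cf_pr cf_scale)

lemma pr_zero [simp]: "pr Q 0 = 0"
  by (rule torus_eqI) (simp_all add: cf_pr)

lemma pr_id: "y \<in> torus_span \<Longrightarrow> (\<And>e. e \<in> supp y \<Longrightarrow> Q e) \<Longrightarrow> pr Q y = y"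
  by (rule torus_eqI) (auto simp: cf_pr supp_def)

lemma pr_none: "y \<in> torus_span \<Longrightarrow> (\<And>e. e \<in> supp y \<Longrightarrow> \<not> Q e) \<Longrightarrow> pr Q y = 0"
  by (rule torus_eqI) (auto simp: cf_pr supp_def)

lemma supp_pr: "y \<in> torus_span \<Longrightarrow> supp (pr Q y) = {e \<in> supp y. Q e}"
  by (auto simp: supp_def cf_pr)

lemma supp_add: "y \<in> torus_span \<Longrightarrow> z \<in> torus_span \<Longrightarrow> supp (y + z) \<subseteq> supp y \<union> supp z"
  by (auto simp: supp_def cf_add)

lemma supp_diff: "y \<in> torus_span \<Longrightarrow> z \<in> torus_span \<Longrightarrow> supp (y - z) \<subseteq> supp y \<union> supp z"
  by (auto simp: supp_def cf_diff)

lemma supp_scale: "y \<in> torus_span \<Longrightarrow> supp (sc p y) \<subseteq> supp y"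
  by (auto simp: supp_def cf_scale)

lemma supp_X: "f \<in> Z \<Longrightarrow> supp (X f) = {f}"
  by (auto simp: supp_def cf_X)

lemma supp_mult_X: "y \<in> torus_span \<Longrightarrow> f \<in> Z \<Longrightarrow> supp (y * X f) = (\<lambda>e. e + f) ` supp y"
  by (auto simp: supp_def cf_mult_X image_iff) (metis diff_add_cancel)+

end

section \<open>The one-step upper bounds\<close>

locale qseed = based_frame \<kappa> m L X
  for \<kappa> :: "laurent \<Rightarrow> 'f::division_ring" and m L X +
  fixes n :: nat and B :: "nat \<Rightarrow> nat \<Rightarrow> int" and d :: "nat \<Rightarrow> int"
  assumes seed: "quantum_seed m n B d L"
begin

abbreviation I :: "nat set" where "I \<equiv> {1..n}"

text \<open>\<open>X'\<^sub>k = Y k\<close> is the sum of the monomials with exponents \<open>p k = e'\<^sub>k\<close> and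
  \<open>q k = e'\<^sub>k - b\<^sub>k\<close>; the grading \<open>w k = \<Lambda>(-, e\<^sub>k)\<close> vanishes on \<open>b\<^sub>j\<close> for \<open>j \<noteq> k\<close>.\<close>

definition b :: "nat \<Rightarrow> ivec" where "b j = column m B j"
definition p :: "nat \<Rightarrow> ivec" where "p k = exch_vec m B k"
definition q :: "nat \<Rightarrow> ivec" where "q k = - unit_vec k + pos_vec (- b k)"
definition Y :: "nat \<Rightarrow> 'f" where "Y k = X (p k) + X (q k)"
definition w :: "nat \<Rightarrow> ivec \<Rightarrow> int" where "w k e = Lam e (unit_vec k)"

lemma I_le_m: "k \<in> I \<Longrightarrow> k \<in> {1..m}"
  using seed by (auto simp: quantum_seed_def)

lemma d_pos: "k \<in> I \<Longrightarrow> d k > 0"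
  using seed by (auto simp: quantum_seed_def)

lemma b_in_Z [simp]: "b j \<in> Z"
  by (simp add: b_def)

lemma p_in_Z [simp]: "k \<in> I \<Longrightarrow> p k \<in> Z"
  and q_in_Z [simp]: "k \<in> I \<Longrightarrow> q k \<in> Z"
  using I_le_m[of k] by (simp_all add: p_def q_def exch_vec_def)

lemma lookup_b: "lookup (b j) i = (if i \<in> {1..m} then B i j else 0)"
  by (simp add: b_def lookup_column)

lemma lookup_p: "lookup (p k) i = (if i \<in> {1..m} then pos (B i k) else 0) - (if i = k then 1 else 0)"
  by (simp add: p_def lookup_exch_vec)

lemma lookup_q: "lookup (q k) i = (if i \<in> {1..m} then pos (- B i k) else 0) - (if i = k then 1 else 0)"
  by (simp add: q_def lookup_add lookup_minus lookup_single lookup_b when_def)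

lemma q_eq: "q k = p k - b k"
  by (rule poly_mapping_eqI) (auto simp: lookup_p lookup_q lookup_b lookup_minus)

lemma Lam_b: "j \<in> I \<Longrightarrow> Lam (b j) f = d j * lookup f j"
proof -
  assume j: "j \<in> I"
  have "Lam (b j) f = (\<Sum>i=1..m. lookup f i * Lam (b j) (unit_vec i))"
    by (rule bil_expand_right)
  also have "\<dots> = (\<Sum>i=1..m. if i = j then d j * lookup f j else 0)"
    using seed j by (intro sum.cong) (auto simp: quantum_seed_def b_def)
  also have "\<dots> = d j * lookup f j"
    using I_le_m[OF j] by simp
  finally show ?thesis .
qed

lemma w_b: "j \<in> I \<Longrightarrow> w k (b j) = (if j = k then d k else 0)"
  by (simp add: w_def Lam_b lookup_single)

lemma w_linear: "w k (e + f) = w k e + w k f" "w k (e - f) = w k e - w k f"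
  "w k (- e) = - w k e" "w k (frag_cmul c e) = c * w k e" "w k 0 = 0"
  by (simp_all add: w_def bil_linear)

text \<open>Compatibility evaluates Lambda(b_i, b_j) through either argument, and skew-symmetry
  compares the two values.\<close>

lemma skew_symmetrizable: "i \<in> I \<Longrightarrow> j \<in> I \<Longrightarrow> d i * B i j = - (d j * B j i)"
  using Lam_skew[of "b i" "b j"] I_le_m[of i] I_le_m[of j] by (simp add: Lam_b lookup_b)

lemma B_diag: "k \<in> I \<Longrightarrow> B k k = 0"
  using skew_symmetrizable[of k k] d_pos[of k] by simp

lemma B_sign:
  assumes "i \<in> I" "j \<in> I"
  shows "B i j > 0 \<longleftrightarrow> B j i < 0" "B i j = 0 \<longleftrightarrow> B j i = 0"
proof -
  have "d i * B i j > 0 \<longleftrightarrow> d j * B j i < 0"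
    using skew_symmetrizable[OF assms] by linarith
  then show "B i j > 0 \<longleftrightarrow> B j i < 0"
    using d_pos[OF assms(1)] d_pos[OF assms(2)] by (simp add: zero_less_mult_iff mult_less_0_iff)
  show "B i j = 0 \<longleftrightarrow> B j i = 0"
    using skew_symmetrizable[OF assms] d_pos[OF assms(1)] d_pos[OF assms(2)] by auto
qed

lemma lookup_p_self: "k \<in> I \<Longrightarrow> lookup (p k) k = - 1"
  and lookup_q_self: "k \<in> I \<Longrightarrow> lookup (q k) k = - 1"
  by (simp_all add: lookup_p lookup_q B_diag)

lemma lookup_p_nonneg: "i \<noteq> k \<Longrightarrow> 0 \<le> lookup (p k) i"
  and lookup_q_nonneg: "i \<noteq> k \<Longrightarrow> 0 \<le> lookup (q k) i"
  by (simp_all add: lookup_p lookup_q)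

lemma Y_torus [simp]: "k \<in> I \<Longrightarrow> Y k \<in> torus_span"
  by (simp add: Y_def)

lemma Lam_q: "k \<in> I \<Longrightarrow> Lam (q k) f = Lam (p k) f - d k * lookup f k"
  by (simp add: q_eq bil_linear Lam_b)

text \<open>The two exponents of X'_k differ by b_k, and Lambda(b_k, e) vanishes when e has no k-th
  coordinate. Both terms therefore pass X^e at the same power of v.\<close>

lemma Y_mult_X:
  assumes "k \<in> I" "e \<in> Z" "lookup e k = 0"
  shows "Y k * X e = vp (2 * Lam (p k) e) * (X e * Y k)"
  using assms X_commute[of "p k" e] X_commute[of "q k" e]
  by (simp add: Y_def distrib_left distrib_right Lam_q)

lemma X_mult_Y:
  assumes "k \<in> I" "e \<in> Z" "lookup e k = 0"
  shows "X e * Y k = vp (- (2 * Lam (p k) e)) * (Y k * X e)"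
  by (simp add: Y_mult_X[OF assms])

lemma cf_mult_Y:
  assumes "y \<in> torus_span" "k \<in> I"
  shows "cf (y * Y k) e = single (Lam (e - p k) (p k)) 1 * cf y (e - p k) +
    single (Lam (e - q k) (q k)) 1 * cf y (e - q k)"
  using assms by (simp add: Y_def distrib_left cf_add cf_mult_X)

text \<open>Taken as a linear span of products in a fixed order, so that induction over the spanning
  set reaches every element; that this span is a ring is \<open>S_mult\<close>.\<close>

definition S :: "nat \<Rightarrow> 'f set" where
  "S j = span {X e * Y j ^ r | e r. e \<in> Z \<and> 0 \<le> lookup e j}"

lemma S_induct [consumes 1, case_names zero step]:
  assumes "y \<in> S j" "P 0"
    and "\<And>c e r z. e \<in> Z \<Longrightarrow> 0 \<le> lookup e j \<Longrightarrow> z \<in> S j \<Longrightarrow> P z \<Longrightarrow> P (sc c (X e * Y j ^ r) + z)"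
  shows "P y"
proof -
  have "y \<in> S j \<and> P y"
    using assms(1)[unfolded S_def]
  proof (induction y rule: span_induct_alt)
    case base
    then show ?case
      by (simp add: assms(2) S_def span_zero)
  next
    case (step c x y)
    moreover have "sc c x + y \<in> S j"
      using step unfolding S_def by (auto intro!: span_add span_scale intro: span_base)
    ultimately show ?case
      using assms(3) by blast
  qed
  then show ?thesis ..
qed

lemma S_gen: "e \<in> Z \<Longrightarrow> 0 \<le> lookup e j \<Longrightarrow> X e * Y j ^ r \<in> S j"
  unfolding S_def by (rule span_base) blast

lemma S_X: "e \<in> Z \<Longrightarrow> 0 \<le> lookup e j \<Longrightarrow> X e \<in> S j"
  using S_gen[of e j 0] by simp

lemma S_Y_self: "Y j \<in> S j"
  using S_gen[of 0 j 1] by simp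

lemma S_closed:
  "0 \<in> S j"
  "y \<in> S j \<Longrightarrow> z \<in> S j \<Longrightarrow> y + z \<in> S j"
  "y \<in> S j \<Longrightarrow> z \<in> S j \<Longrightarrow> y - z \<in> S j"
  "y \<in> S j \<Longrightarrow> - y \<in> S j"
  "y \<in> S j \<Longrightarrow> sc c y \<in> S j"
  by (simp_all only: S_def span_zero span_add span_diff span_neg span_scale)

lemma S_vp: "vp c * y \<in> S j \<longleftrightarrow> y \<in> S j"
  by (simp only: S_def span_scale_iff)

lemma S_torus: "j \<in> I \<Longrightarrow> y \<in> S j \<Longrightarrow> y \<in> torus_span"
  by (rotate_tac, induction rule: S_induct) auto

lemma S_X_mult:
  assumes "y \<in> S j" "f \<in> Z" "0 \<le> lookup f j"
  shows "X f * y \<in> S j"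
  using assms(1)
proof (induction rule: S_induct)
  case (step c e r z)
  have "X f * (X e * Y j ^ r) = vp (Lam f e) * (X (f + e) * Y j ^ r)"
    using step assms by (simp add: X_mult flip: mult.assoc)
  then have "X f * (X e * Y j ^ r) \<in> S j"
    using step assms by (auto simp: S_vp lookup_add intro!: S_gen)
  then show ?case
    using step by (auto simp: distrib_left sc_mult(2)[symmetric] intro!: S_closed)
qed (simp add: S_closed)

text \<open>If \<open>e\<close> has no j-th coordinate, \<open>Y j\<close> moves past X^e up to a
  power of v. Otherwise it is expanded into its two terms: each lowers the j-th exponent by one,
  which the positive exponent in \<open>e\<close> can afford.\<close>

lemma S_Y_mult:
  assumes "y \<in> S j" "j \<in> I"
  shows "Y j * y \<in> S j"
  using assms(1)
proof (induction rule: S_induct)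
  case (step c e r z)
  have "Y j * (X e * Y j ^ r) \<in> S j"
  proof (cases "lookup e j = 0")
    case True
    then have "Y j * (X e * Y j ^ r) = vp (2 * Lam (p j) e) * (X e * Y j ^ Suc r)"
      using step assms Y_mult_X[of j e] by (simp flip: mult.assoc)
    then show ?thesis
      using step by (simp only: S_vp S_gen)
  next
    case False
    then have "Y j * (X e * Y j ^ r) =
        vp (Lam (p j) e) * (X (p j + e) * Y j ^ r) + vp (Lam (q j) e) * (X (q j + e) * Y j ^ r)"
      using step assms by (simp add: Y_def[of j] distrib_right X_mult flip: mult.assoc)
    also have "\<dots> \<in> S j"
      using step assms False
      by (intro S_closed(2) S_vp[THEN iffD2] S_gen)
        (auto simp: lookup_add lookup_p_self lookup_q_self)
    finally show ?thesis .
  qed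
  then show ?case
    using step by (auto simp: distrib_left sc_mult(2)[symmetric] intro!: S_closed)
qed (simp add: S_closed)

lemma S_mult:
  assumes "y \<in> S j" "z \<in> S j" "j \<in> I"
  shows "y * z \<in> S j"
  using assms(1)
proof (induction rule: S_induct)
  case (step c e r y)
  have "Y j ^ r * z \<in> S j"
    by (induction r) (use assms in \<open>simp_all add: S_Y_mult mult.assoc\<close>)
  then have "X e * Y j ^ r * z \<in> S j"
    using step by (simp add: S_X_mult mult.assoc)
  then show ?case
    using step by (auto simp: distrib_right sc_mult(1)[symmetric] intro!: S_closed)
qed (simp add: S_closed)

lemma S_power: "y \<in> S j \<Longrightarrow> j \<in> I \<Longrightarrow> y ^ r \<in> S j"
  using S_X[of 0 j] by (induction r) (simp_all add: S_mult)

lemma S_Y: "k \<in> I \<Longrightarrow> Y k \<in> S j"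
  by (cases "k = j")
    (auto simp: S_Y_self Y_def[of k] lookup_p_nonneg lookup_q_nonneg intro!: S_closed S_X)

text \<open>The binomial expansion without its coefficients: \<open>i\<close> counts the factors
  that contribute \<open>q j = p j - b j\<close> instead of \<open>p j\<close>.\<close>

lemma supp_gen:
  assumes "j \<in> I" "e \<in> Z" "f \<in> supp (X e * Y j ^ r)"
  shows "\<exists>i\<in>{0..int r}. f = e + frag_cmul (int r) (p j) - frag_cmul i (b j)"
  using assms(3)
proof (induction r arbitrary: f)
  case 0
  then show ?case using assms by (simp add: supp_X)
next
  case (Suc r)
  let ?y = "X e * Y j ^ r"
  have y: "?y \<in> torus_span" "?y * X (p j) \<in> torus_span" "?y * X (q j) \<in> torus_span"
    using assms by auto
  have "X e * Y j ^ Suc r = ?y * X (p j) + ?y * X (q j)"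
    by (simp add: Y_def[of j, symmetric] power_Suc2 mult.assoc del: power_Suc flip: distrib_left)
  then have "f \<in> supp (?y * X (p j)) \<union> supp (?y * X (q j))"
    using Suc.prems supp_add[OF y(2,3)] by auto
  then obtain g where g: "g \<in> supp ?y" "f = g + p j \<or> f = g + q j"
    using y assms by (auto simp: supp_mult_X)
  then obtain i where i: "i \<in> {0..int r}" "g = e + frag_cmul (int r) (p j) - frag_cmul i (b j)"
    using Suc.IH by blast
  have "f = e + frag_cmul (int (Suc r)) (p j) - frag_cmul i (b j) \<or>
     f = e + frag_cmul (int (Suc r)) (p j) - frag_cmul (i + 1) (b j)"
    using g(2) unfolding i(2) q_eq by (auto simp: frag_cmul_distrib algebra_simps)
  then show ?case
    using i(1) by (elim disjE) (auto intro: bexI[of _ i] bexI[of _ "i + 1"])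
qed

lemma shift_invariant:
  assumes "\<And>e. Q (e + b j) = Q e"
  shows "Q (e + frag_cmul i (b j)) = Q e"
proof (induction i arbitrary: e rule: int_induct[where k = 0])
  case (step1 i)
  then show ?case
    using assms[of "e + frag_cmul i (b j)"] by (simp add: frag_cmul_distrib algebra_simps)
next
  case (step2 i)
  then show ?case
    using assms[of "e + frag_cmul (i - 1) (b j)"]
    by (simp add: frag_cmul_diff_distrib algebra_simps)
qed simp

text \<open>Each spanning product is supported on a single line in direction \<open>b j\<close>, so
  a predicate invariant under \<open>b j\<close> keeps it or kills it as a whole.\<close>

lemma S_pr:
  assumes "j \<in> I" "y \<in> S j" and Q: "\<And>e. Q (e + b j) = Q e"
  shows "pr Q y \<in> S j"
  using assms(2)
proof (induction rule: S_induct)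
  case (step c e r z)
  let ?g = "X e * Y j ^ r"
  have g: "?g \<in> torus_span" and z: "z \<in> torus_span"
    using step assms S_torus by auto
  have "Q f = Q (e + frag_cmul (int r) (p j))" if f: "f \<in> supp ?g" for f
  proof -
    obtain i where "f = (e + frag_cmul (int r) (p j)) + frag_cmul (- i) (b j)"
      using supp_gen[OF assms(1) step(1) f] by auto
    then show ?thesis
      using shift_invariant[of Q j] Q by metis
  qed
  then have "pr Q ?g = ?g \<or> pr Q ?g = 0"
    using pr_id[OF g] pr_none[OF g] by metis
  then have "pr Q ?g \<in> S j"
    using S_gen step S_closed(1) by metis
  then show ?case
    using g z step by (simp add: pr_add pr_scale S_closed)
qed (simp add: S_closed)

text \<open>The two monomials of \<open>X'\<^sub>k\<close> lie in different degrees of the grading \<open>w k\<close>, which leaves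
  \<open>b\<^sub>j\<close> in degree \<open>0\<close>, and one of them is invertible in \<open>S j\<close>: so \<open>X'\<^sub>k\<close> cancels in \<open>S j\<close>.\<close>

lemma S_cancel_Y:
  assumes jk: "j \<in> I" "k \<in> I" "j \<noteq> k" and y: "y \<in> torus_span" and Yy: "Y k * y \<in> S j"
  shows "y \<in> S j"
proof -
  have wpq: "w k (p k) - w k (q k) > 0"
    using jk by (simp add: q_eq w_linear w_b d_pos)
  \<comment> \<open>\<open>u\<close> is the term of X'_k free of X_j, so that both X^u and its
    inverse lie in \<open>S j\<close>. The sign \<open>\<sigma>\<close> orients the grading so that
    \<open>u\<close> is the higher of the two terms.\<close>
  obtain u u' \<sigma> where u: "u \<in> Z" "u' \<in> Z" "lookup u j = 0" "\<sigma> * w k u > \<sigma> * w k u'" "Y k = X u + X u'"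
  proof (cases "B j k \<le> 0")
    case True
    show ?thesis
      by (rule that[of "p k" "q k" 1]) (use True jk wpq in \<open>auto simp: lookup_p Y_def\<close>)
  next
    case False
    show ?thesis
      by (rule that[of "q k" "p k" "- 1"]) (use False jk wpq in \<open>auto simp: lookup_q Y_def\<close>)
  qed
  define \<phi> where "\<phi> e = \<sigma> * w k e" for e
  have \<phi>: "\<phi> (e + f) = \<phi> e + \<phi> f" "\<phi> (e - f) = \<phi> e - \<phi> f" for e f
    by (simp_all add: \<phi>_def w_linear algebra_simps)
  have \<phi>b: "\<phi> (b j) = 0"
    using jk by (simp add: \<phi>_def w_b)
  show ?thesis
    using y Yy
  proof (induction "card (supp y)" arbitrary: y rule: less_induct)
    case less
    show ?case
    proof (cases "y = 0")
      case True
      then show ?thesis by (simp add: S_closed)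
    next
      case False
      define i0 where "i0 = Max (\<phi> ` supp y)"
      define y0 where "y0 = pr (\<lambda>e. \<phi> e = i0) y"
      have fin: "finite (supp y)" and ne: "supp y \<noteq> {}"
        using less False by (auto simp: supp_empty)
      have i0: "i0 \<in> \<phi> ` supp y" and le: "\<phi> e \<le> i0" if "e \<in> supp y" for e
        using fin ne that by (auto simp: i0_def)
      have y0 [simp]: "y0 \<in> torus_span"
        using less by (simp add: y0_def)
      \<comment> \<open>In the top degree of the product only X^u times the top component of
        \<open>y\<close> contributes. Inverting X^u puts that component into \<open>S j\<close>, and
        subtracting it shrinks the support.\<close>
      have "pr (\<lambda>e. \<phi> e = i0 + \<phi> u) (Y k * y) = X u * y0"
      proof (rule torus_eqI)
        fix e
        have "cf y (e - u') = 0" if "\<phi> e = i0 + \<phi> u"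
          using le[of "e - u'"] u(4) that by (force simp: \<phi> \<phi>_def[symmetric] supp_def)
        then show "cf (pr (\<lambda>e. \<phi> e = i0 + \<phi> u) (Y k * y)) e = cf (X u * y0) e"
          using less jk u(1,2)
          by (auto simp: cf_pr y0_def cf_X_mult u(5) distrib_right cf_add \<phi>)
      qed (use less jk u in auto)
      moreover have "pr (\<lambda>e. \<phi> e = i0 + \<phi> u) (Y k * y) \<in> S j"
        by (rule S_pr) (use less jk \<phi> \<phi>b in auto)
      ultimately have "X (- u) * (X u * y0) \<in> S j"
        using S_X_mult[of "X u * y0" j "- u"] u by auto
      then have y0S: "y0 \<in> S j"
        using u X_inverse[of u] by (simp flip: mult.assoc)
      have supp_eq: "supp (y - y0) = {e \<in> supp y. \<phi> e \<noteq> i0}"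
        using less by (auto simp: supp_def cf_diff y0_def cf_pr)
      have "card (supp (y - y0)) < card (supp y)"
        unfolding supp_eq using i0 ne fin by (intro psubset_card_mono) auto
      moreover have "Y k * (y - y0) \<in> S j"
        using less jk y0S by (auto simp: right_diff_distrib intro!: S_closed S_mult S_Y)
      ultimately have "y - y0 \<in> S j"
        using less by auto
      then show ?thesis
        using S_closed(2)[OF _ y0S] by force
    qed
  qed
qed

lemma S_cancel_Y_power:
  assumes "j \<in> I" "k \<in> I" "j \<noteq> k" "y \<in> torus_span" "Y k ^ N * y \<in> S j"
  shows "y \<in> S j"
  using assms(5)
proof (induction N)
  case (Suc N)
  then show ?case
    using S_cancel_Y[OF assms(1-3), of "Y k ^ N * y"] assms by (simp add: mult.assoc)
qed simp

text \<open>Since \<open>b j\<close> has no j-th coordinate, the j-th exponent is constant on each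
  spanning product. A product of degree -r starts from a nonnegative exponent, hence contains at
  least r factors \<open>Y j\<close>.\<close>

lemma S_degree_part:
  assumes "j \<in> I" "y \<in> S j"
  shows "\<exists>t\<in>torus_span. pr (\<lambda>e. lookup e j = - int r) y = t * Y j ^ r"
  using assms(2)
proof (induction rule: S_induct)
  case zero
  then show ?case by (intro bexI[of _ 0]) auto
next
  case (step c e r' z)
  let ?g = "X e * Y j ^ r'" and ?pr = "pr (\<lambda>e. lookup e j = - int r)"
  have g: "?g \<in> torus_span" and z: "z \<in> torus_span"
    using step assms S_torus by auto
  have deg: "lookup f j = lookup e j - int r'" if "f \<in> supp ?g" for f
    using supp_gen[OF assms(1) step(1) that] assms(1)
    by (auto simp: lookup_add lookup_minus lookup_p_self lookup_b B_diag)
  have "\<exists>t\<in>torus_span. ?pr ?g = t * Y j ^ r"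
  proof (cases "lookup e j - int r' = - int r")
    case True
    then have "?pr ?g = ?g"
      using deg g by (intro pr_id) auto
    moreover have "r' = nat (lookup e j) + r"
      using True step by linarith
    ultimately have "?pr ?g = (X e * Y j ^ nat (lookup e j)) * Y j ^ r"
      by (simp add: power_add mult.assoc)
    then show ?thesis
      using assms step by auto
  next
    case False
    then have "?pr ?g = 0"
      using deg g by (intro pr_none) auto
    then show ?thesis
      by (intro bexI[of _ 0]) auto
  qed
  then obtain t where t: "t \<in> torus_span" "?pr ?g = t * Y j ^ r" by blast
  obtain t' where t': "t' \<in> torus_span" "?pr z = t' * Y j ^ r"
    using step by blast
  have "?pr (sc c ?g + z) = (sc c t + t') * Y j ^ r"
    using g z by (simp add: pr_add pr_scale t t' distrib_right flip: sc_mult)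
  then show ?case
    using t t' by blast
qed

text \<open>The highest degree of \<open>y\<close> is shifted by \<open>p j\<close> and the lowest
  by \<open>q j\<close>. At either end the other term of \<open>Y j\<close> has nothing to cancel
  with, and the two shifts differ by the degree \<open>d j\<close> of \<open>b j\<close>.\<close>

lemma width_mult_Y:
  assumes "j \<in> I" "y \<in> torus_span" "\<exists>e\<in>supp y. \<exists>f\<in>supp y. w j e - w j f \<ge> N"
  shows "\<exists>e\<in>supp (y * Y j). \<exists>f\<in>supp (y * Y j). w j e - w j f \<ge> N + d j"
proof -
  have fin: "finite (w j ` supp y)" and ne: "w j ` supp y \<noteq> {}"
    using assms by auto
  obtain e where e: "e \<in> supp y" "w j e = Max (w j ` supp y)"
    using Max_in[OF fin ne] by auto
  obtain f where f: "f \<in> supp y" "w j f = Min (w j ` supp y)"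
    using Min_in[OF fin ne] by auto
  have max: "w j g \<le> w j e" and min: "w j f \<le> w j g" if "g \<in> supp y" for g
    using that fin e f by auto
  have dj: "d j > 0" "w j (b j) = d j"
    using assms by (auto simp: d_pos w_b)
  have "e + b j \<notin> supp y" "f - b j \<notin> supp y"
    using max[of "e + b j"] min[of "f - b j"] dj by (auto simp: w_linear)
  then have "e + p j \<in> supp (y * Y j)" "f + q j \<in> supp (y * Y j)"
    using e f assms by (auto simp: supp_def cf_mult_Y q_eq algebra_simps)
  moreover have "w j (e + p j) - w j (f + q j) \<ge> N + d j"
    using assms(3) max min dj by (force simp: w_linear q_eq)
  ultimately show ?thesis by blast
qed

lemma width_mult_Y_power:
  assumes "j \<in> I" "y \<in> torus_span" "y \<noteq> 0"
  shows "\<exists>e\<in>supp (y * Y j ^ r). \<exists>f\<in>supp (y * Y j ^ r). w j e - w j f \<ge> int r * d j"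
proof (induction r)
  case 0
  then show ?case
    using assms supp_empty[of y] by force
next
  case (Suc r)
  then show ?case
    using width_mult_Y[of j "y * Y j ^ r" "int r * d j"] assms
    by (simp add: power_Suc2 mult.assoc algebra_simps del: power_Suc)
qed

text \<open>Restrict \<open>y\<close> to the \<open>b j\<close>-line through \<open>e\<close>, where
  the j-th exponent is constant. If it is -r, the restriction is divisible by the r-th power of
  \<open>Y j\<close>, so it spreads over at least r steps of \<open>b j\<close>. As \<open>e\<close>
  is the topmost point of the line, these steps lead downwards from it.\<close>

lemma S_line_width:
  assumes j: "j \<in> I" and y: "y \<in> S j" and e: "e \<in> supp y"
    and top: "\<And>s. s > 0 \<Longrightarrow> e + frag_cmul s (b j) \<notin> supp y"
  shows "\<exists>t\<ge>pos (- lookup e j). e - frag_cmul t (b j) \<in> supp y"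
proof (cases "lookup e j \<ge> 0")
  case True
  then show ?thesis
    using e by (intro exI[of _ 0]) auto
next
  case False
  define r where "r = nat (- lookup e j)"
  have r: "lookup e j = - int r"
    using False by (simp add: r_def)
  \<comment> \<open>Membership in the line through \<open>e\<close>; it is invariant under
    \<open>b j\<close>, so \<open>S_pr\<close> keeps the restriction inside
    \<open>S j\<close>.\<close>
  define Q where "Q f \<longleftrightarrow> (\<exists>s. f = e + frag_cmul s (b j))" for f
  have Q: "Q (f + b j) = Q f" for f
  proof -
    have "f + b j = e + frag_cmul s (b j) \<longleftrightarrow> f = e + frag_cmul (s - 1) (b j)" for s
      by (auto simp: frag_cmul_diff_distrib algebra_simps)
    then show ?thesis
      unfolding Q_def by (metis add_diff_cancel_right')
  qed
  define z where "z = pr Q y"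
  have yT: "y \<in> torus_span"
    using S_torus j y by auto
  have zS: "z \<in> S j" and zT: "z \<in> torus_span"
    using S_pr[OF j y, of Q] Q yT by (auto simp: z_def)
  have suppz: "supp z = {f \<in> supp y. Q f}"
    using yT by (simp add: z_def supp_pr)
  have "Q e"
    unfolding Q_def by (rule exI[of _ 0]) simp
  then have "z \<noteq> 0"
    using e suppz supp_empty[OF zT] by auto
  have "pr (\<lambda>e. lookup e j = - int r) z = z"
    using zT r by (rule_tac pr_id) (auto simp: suppz Q_def lookup_add lookup_b B_diag[OF j])
  then obtain t where t: "t \<in> torus_span" "z = t * Y j ^ r"
    using S_degree_part[OF j zS, of r] by auto
  with \<open>z \<noteq> 0\<close> have "t \<noteq> 0" by auto
  then obtain g h where gh: "g \<in> supp z" "h \<in> supp z" "w j g - w j h \<ge> int r * d j"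
    using width_mult_Y_power[OF j t(1), of r] t(2) by auto
  then obtain s1 s2 where s: "g = e + frag_cmul s1 (b j)" "h = e + frag_cmul s2 (b j)"
    by (auto simp: suppz Q_def)
  have "s1 \<le> 0"
    using top[of s1] gh(1) s by (force simp: suppz)
  have "(s1 - s2) * d j \<ge> int r * d j"
    using gh(3) j by (simp add: s w_linear w_b algebra_simps)
  then have "s1 - s2 \<ge> int r"
    using d_pos[OF j] by simp
  moreover have "e - frag_cmul (- s2) (b j) \<in> supp y"
    using gh(2) s by (auto simp: suppz simp flip: minus_frag_cmul)
  ultimately show ?thesis
    using \<open>s1 \<le> 0\<close> r by (intro exI[of _ "- s2"]) auto
qed

section \<open>The upper bound of a seed\<close>

definition U :: "'f set" where
  "U = (\<Inter>j\<in>I. S j)"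

lemma n_pos: "1 \<in> I"
  using seed by (auto simp: quantum_seed_def)

lemma U_S: "y \<in> U \<Longrightarrow> j \<in> I \<Longrightarrow> y \<in> S j"
  by (simp add: U_def)

lemma U_torus: "y \<in> U \<Longrightarrow> y \<in> torus_span"
  using S_torus[of 1] U_S n_pos by blast

lemma U_closed:
  "0 \<in> U"
  "y \<in> U \<Longrightarrow> z \<in> U \<Longrightarrow> y + z \<in> U"
  "y \<in> U \<Longrightarrow> z \<in> U \<Longrightarrow> y - z \<in> U"
  "y \<in> U \<Longrightarrow> - y \<in> U"
  "y \<in> U \<Longrightarrow> sc c y \<in> U"
  "y \<in> U \<Longrightarrow> z \<in> U \<Longrightarrow> y * z \<in> U"
  "k \<in> I \<Longrightarrow> Y k \<in> U"
  by (auto simp: U_def intro: S_closed S_mult S_Y)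

lemma U_X: "e \<in> Z \<Longrightarrow> (\<And>j. j \<in> I \<Longrightarrow> 0 \<le> lookup e j) \<Longrightarrow> X e \<in> U"
  by (auto simp: U_def intro: S_X)

end

section \<open>Mutation\<close>

context central_scalars
begin

section \<open>Commutation up to a power of v\<close>

definition q_commute :: "int \<Rightarrow> 'f \<Rightarrow> 'f \<Rightarrow> bool" where
  "q_commute s x y \<longleftrightarrow> x * y = vp s * (y * x)"

lemma q_commute_one [simp]: "q_commute 0 1 y" "q_commute 0 x 1"
  by (simp_all add: q_commute_def)

lemma q_commute_swap: "q_commute s x y \<Longrightarrow> q_commute (- s) y x"
  by (simp add: q_commute_def)

lemma q_commute_mult_left:
  assumes "q_commute s x y" "q_commute s' x' y"
  shows "q_commute (s + s') (x * x') y"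
proof -
  have "x * x' * y = x * (vp s' * (y * x'))"
    using assms by (simp add: q_commute_def mult.assoc)
  also have "\<dots> = vp s' * ((x * y) * x')"
    by (simp add: vp_left_commute mult.assoc)
  also have "\<dots> = vp (s + s') * (y * (x * x'))"
    using assms by (simp add: q_commute_def vp_vp vp_left_commute mult.assoc add.commute)
  finally show ?thesis by (simp add: q_commute_def)
qed

lemma q_commute_mult_right:
  "q_commute s x y \<Longrightarrow> q_commute s' x y' \<Longrightarrow> q_commute (s + s') x (y * y')"
  using q_commute_mult_left[of "- s" y x "- s'" y'] q_commute_swap[of "- s - s'" "y * y'" x]
  by (simp add: q_commute_swap add.commute)

lemma q_commute_power: "q_commute s x y \<Longrightarrow> q_commute (int k * s) (x ^ k) y"
  by (induction k) (simp_all add: distrib_right q_commute_mult_left)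

lemma q_commute_inverse:
  assumes "q_commute s x y" "x \<noteq> 0"
  shows "q_commute (- s) (inverse x) y"
proof -
  have "y * inverse x = inverse x * (x * y) * inverse x"
    using assms(2) by (simp flip: mult.assoc)
  also have "\<dots> = vp s * (inverse x * y * (x * inverse x))"
    using assms(1) by (simp add: q_commute_def vp_left_commute mult.assoc)
  finally have "y * inverse x = vp s * (inverse x * y)"
    by (simp only: right_inverse[OF assms(2)] mult_1_right)
  then show ?thesis
    by (simp add: q_commute_def)
qed

lemma q_commute_powi:
  assumes "q_commute s x y" "x \<noteq> 0"
  shows "q_commute (k * s) (x powi k) y"
proof (cases "k \<ge> 0")
  case True
  then show ?thesis
    using q_commute_power[OF assms(1), of "nat k"] by (simp add: power_int_def)
next
  case False
  then show ?thesis
    using q_commute_power[OF q_commute_inverse[OF assms], of "nat (- k)"]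
    by (simp add: power_int_def)
qed

lemma q_commute_powi_right:
  "q_commute s x y \<Longrightarrow> y \<noteq> 0 \<Longrightarrow> q_commute (k * s) x (y powi k)"
  using q_commute_powi[of "- s" y x k] q_commute_swap[of "- (k * s)" "y powi k" x]
  by (simp add: q_commute_swap)

lemma q_commute_vp: "q_commute 0 x (vp s)" "q_commute 0 (vp s) x"
  by (simp_all add: q_commute_def vp_central)

section \<open>Based monomials in a family of commuting-up-to-v elements\<close>

abbreviation bmon :: "nat \<Rightarrow> (nat \<Rightarrow> nat \<Rightarrow> int) \<Rightarrow> (nat \<Rightarrow> 'f) \<Rightarrow> ivec \<Rightarrow> 'f" where
  "bmon m L x \<equiv> based_monomial m (vp 1) L x"

lemma bmon_0 [simp]: "bmon 0 L x e = 1"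
  by (simp add: based_monomial_def)

lemma bmon_Suc:
  "bmon (Suc m) L x e = vp (- ((\<Sum>i=1..m. L i (Suc m) * lookup e i) * lookup e (Suc m))) *
     (bmon m L x e * x (Suc m) powi lookup e (Suc m))"
proof -
  define a where "a = (\<Sum>j=1..m. \<Sum>i=1..<j. L i j * lookup e i * lookup e j)"
  define c where "c = (\<Sum>i=1..m. L i (Suc m) * lookup e i) * lookup e (Suc m)"
  have "(\<Sum>j=1..Suc m. \<Sum>i=1..<j. L i j * lookup e i * lookup e j) = a + c"
    by (simp add: a_def c_def sum_distrib_right atLeastLessThanSuc_atLeastAtMost)
  moreover have "[1..<Suc (Suc m)] = [1..<Suc m] @ [Suc m]"
    by simp
  moreover have "vp (- (a + c)) = vp (- c) * vp (- a)"
    by (simp flip: vp_add add: algebra_simps)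
  ultimately show ?thesis
    unfolding based_monomial_def vp_powi a_def[symmetric] c_def[symmetric]
    by (simp only: map_append prod_list.append mult.assoc) simp
qed

lemma q_commute_bmon:
  assumes "\<And>i. i \<in> {1..m} \<Longrightarrow> x i \<noteq> 0 \<and> q_commute (s i) y (x i)"
  shows "q_commute (\<Sum>i=1..m. lookup e i * s i) y (bmon m L x e)"
  using assms
proof (induction m)
  case (Suc m)
  have "q_commute (0 + ((\<Sum>i=1..m. lookup e i * s i) + lookup e (Suc m) * s (Suc m))) y
      (bmon (Suc m) L x e)"
    unfolding bmon_Suc using Suc.prems
    by (intro q_commute_mult_right q_commute_vp Suc.IH q_commute_powi_right) auto
  then show ?case
    by simp
qed simp

lemma bil_Suc:
  assumes "L (Suc m) (Suc m) = 0"
  shows "bil (Suc m) L e f = bil m L e f + (\<Sum>i=1..m. L i (Suc m) * lookup e i) * lookup f (Suc m)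
     + lookup e (Suc m) * (\<Sum>j=1..m. L (Suc m) j * lookup f j)"
  using assms by (simp add: bil_def sum.distrib sum_distrib_left sum_distrib_right mult_ac)

text \<open>Any nonzero elements that commute as a skew-symmetric matrix prescribes give normalized
  monomials obeying the quantum torus law. The proof removes the last variable: the normalization is
  quadratic in the exponent, and its cross terms combine with the cost of reordering into the
  bilinear form.\<close>

lemma bmon_mult:
  assumes "\<And>i. i \<in> {1..m} \<Longrightarrow> x i \<noteq> 0"
    and "\<And>i j. i \<in> {1..m} \<Longrightarrow> j \<in> {1..m} \<Longrightarrow> q_commute (2 * L i j) (x i) (x j)"
    and "\<And>i j. i \<in> {1..m} \<Longrightarrow> j \<in> {1..m} \<Longrightarrow> L i j = - L j i"
  shows "bmon m L x e * bmon m L x f = vp (bil m L e f) * bmon m L x (e + f)"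
  using assms
proof (induction m)
  case 0
  show ?case by (simp add: bil_def)
next
  case (Suc m)
  define a where "a = lookup e (Suc m)"
  define c where "c = lookup f (Suc m)"
  define z where "z = x (Suc m)"
  define s where "s g = (\<Sum>i=1..m. L i (Suc m) * lookup g i)" for g
  define M where "M = bmon m L x"
  have z: "z \<noteq> 0"
    using Suc.prems(1) by (simp add: z_def)
  have skew: "(\<Sum>i=1..m. L (Suc m) i * lookup f i) = - s f"
    unfolding s_def sum_negf[symmetric]
  proof (rule sum.cong)
    fix i assume "i \<in> {1..m}"
    then show "L (Suc m) i * lookup f i = - (L i (Suc m) * lookup f i)"
      using Suc.prems(3)[of "Suc m" i] by simp
  qed simp
  have "q_commute (\<Sum>i=1..m. lookup f i * (2 * L (Suc m) i)) z (M f)"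
    unfolding M_def z_def using Suc.prems(1,2) by (intro q_commute_bmon) auto
  also have "(\<Sum>i=1..m. lookup f i * (2 * L (Suc m) i)) = - 2 * s f"
  proof -
    have "(\<Sum>i=1..m. lookup f i * (2 * L (Suc m) i)) = 2 * (\<Sum>i=1..m. L (Suc m) i * lookup f i)"
      unfolding sum_distrib_left by (simp add: mult_ac)
    then show ?thesis
      using skew by simp
  qed
  finally have "q_commute (a * (- 2 * s f)) (z powi a) (M f)"
    using z by (rule q_commute_powi)
  \<comment> \<open>The only reordering in the product: the last variable of the first monomial has
    to pass the remaining variables of the second.\<close>
  then have comm: "z powi a * M f = vp (- (2 * a * s f)) * (M f * z powi a)"
    by (simp add: q_commute_def mult_ac)
  have IH: "M e * M f = vp (bil m L e f) * M (e + f)"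
    unfolding M_def by (rule Suc.IH) (rule Suc.prems; simp)+
  have "L (Suc m) (Suc m) = 0"
    using Suc.prems(3)[of "Suc m" "Suc m"] by simp
  then have bil: "bil (Suc m) L e f = bil m L e f + s e * c - a * s f"
    using skew by (simp add: bil_Suc s_def a_def c_def)
  have "bmon (Suc m) L x e * bmon (Suc m) L x f =
      vp (- (s e * a)) * (M e * z powi a) * (vp (- (s f * c)) * (M f * z powi c))"
    by (simp add: bmon_Suc s_def a_def c_def z_def M_def)
  also have "\<dots> = vp (- (s e * a) - s f * c) * (M e * (z powi a * M f) * z powi c)"
    by (simp add: vp_left_commute mult.assoc vp_vp)
  also have "\<dots> = vp (- (s e * a) - s f * c) * (vp (- (2 * a * s f)) * (M e * M f * (z powi a * z powi c)))"
    unfolding comm by (simp add: mult.assoc vp_left_commute)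
  also have "\<dots> = vp (- (s e * a) - s f * c + - (2 * a * s f) + bil m L e f) * (M (e + f) * z powi (a + c))"
    unfolding IH using z by (simp add: vp_vp mult.assoc power_int_add algebra_simps)
  also have "- (s e * a) - s f * c + - (2 * a * s f) + bil m L e f =
      bil (Suc m) L e f - (s e + s f) * (a + c)"
    unfolding bil by (simp add: algebra_simps)
  also have "vp (bil (Suc m) L e f - (s e + s f) * (a + c)) * (M (e + f) * z powi (a + c)) =
      vp (bil (Suc m) L e f) * bmon (Suc m) L x (e + f)"
  proof -
    have "bmon (Suc m) L x (e + f) = vp (- (s (e + f) * (a + c))) * (M (e + f) * z powi (a + c))"
      by (simp only: bmon_Suc s_def M_def z_def a_def c_def lookup_add)
    moreover have "s (e + f) = s e + s f"
      by (simp add: s_def lookup_add distrib_left sum.distrib)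
    ultimately show ?thesis
      by (simp add: vp_vp)
  qed
  finally show ?case .
qed

lemma bmon_unit: "bmon m L x (unit_vec i) = (if i \<in> {1..m} then x i else 1)"
proof (induction m)
  case (Suc m)
  have "(\<Sum>j=1..m. L j (Suc m) * lookup (unit_vec i) j) * lookup (unit_vec i) (Suc m) = 0"
    by (auto simp: lookup_single when_def intro!: sum.neutral)
  then show ?case
    using Suc by (auto simp: bmon_Suc lookup_single when_def)
qed simp

end

locale qseed_mutation = qseed \<kappa> m L X n B d
  for \<kappa> :: "laurent \<Rightarrow> 'f::division_ring" and m L X n B d +
  fixes k :: nat
  assumes k: "k \<in> {1..n}"
begin

section \<open>The mutated seed as a seed in its own right\<close>

definition B' :: "nat \<Rightarrow> nat \<Rightarrow> int" where "B' = mutate_matrix B k"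
definition L' :: "nat \<Rightarrow> nat \<Rightarrow> int" where "L' = mutate_gram m B L k"
definition x' :: "nat \<Rightarrow> 'f" where "x' i = (if i = k then Y k else X (unit_vec i))"
definition X' :: "ivec \<Rightarrow> 'f" where "X' = based_monomial m (vp 1) L' x'"

text \<open>\<open>T\<close> sends \<open>e\<^sub>k\<close> to \<open>e'\<^sub>k\<close> and fixes the other unit vectors, so that \<open>\<Lambda>'\<close> is the
  pullback of \<open>\<Lambda>\<close> along \<open>T\<close>; \<open>R\<close> deletes the coordinate \<open>k\<close>.\<close>

definition T :: "ivec \<Rightarrow> ivec" where
  "T e = e + frag_cmul (lookup e k) (p k - unit_vec k)"

definition R :: "ivec \<Rightarrow> ivec" where
  "R e = e - frag_cmul (lookup e k) (unit_vec k)"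

lemma k_in_m [simp]: "k \<in> {1..m}"
  using I_le_m k by blast

lemma uk_Z [simp]: "unit_vec k \<in> Z"
  using zlattice_simps(2) k_in_m by blast

lemma T_in_Z [simp]: "e \<in> Z \<Longrightarrow> T e \<in> Z"
  using k by (simp add: T_def)

lemma R_in_Z [simp]: "e \<in> Z \<Longrightarrow> R e \<in> Z"
  by (simp add: R_def)

lemma R_k [simp]: "lookup (R e) k = 0"
  by (simp add: R_def lookup_minus)

lemma R_lookup: "i \<noteq> k \<Longrightarrow> lookup (R e) i = lookup e i"
  by (simp add: R_def lookup_minus lookup_single)

lemma R_add_uk: "R (e + frag_cmul c (unit_vec k)) = R e"
  by (simp add: R_def lookup_add frag_cmul_distrib)

lemma R_split: "e = R e + frag_cmul (lookup e k) (unit_vec k)"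
  by (simp add: R_def)

lemma T_R: "T e = R e + frag_cmul (lookup e k) (p k)"
  by (rule poly_mapping_eqI) (simp add: T_def R_def lookup_add lookup_minus algebra_simps)

lemma T_linear: "T (e + f) = T e + T f" "T (- e) = - T e" "T (e - f) = T e - T f" "T 0 = 0"
  by (rule poly_mapping_eqI; simp add: T_def lookup_add lookup_minus algebra_simps)+

lemma T_id: "lookup e k = 0 \<Longrightarrow> T e = e"
  by (simp add: T_def)

lemma T_uk: "T (unit_vec k) = p k"
  by (simp add: T_def)

lemma L'_unit: "i \<in> {1..m} \<Longrightarrow> j \<in> {1..m} \<Longrightarrow> L' i j = Lam (T (unit_vec i)) (T (unit_vec j))"
  using Lam_skew[of "p k" "unit_vec i"]
  by (auto simp: L'_def mutate_gram_def T_uk T_id lookup_single p_def bil_unit_unit)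

lemma bil_L':
  assumes "e \<in> Z" "f \<in> Z"
  shows "bil m L' e f = Lam (T e) (T f)"
  using assms(1)
proof (induction e rule: zlattice_induct)
  case (unit i)
  then have i: "i \<in> {1..m}"
    using assms(1) by (auto simp: zlattice_def)
  show ?case
    using assms(2)
  proof (induction f rule: zlattice_induct)
    case (unit j)
    then have "j \<in> {1..m}"
      using assms(2) by (auto simp: zlattice_def)
    then show ?case
      using i by (simp add: bil_unit_unit L'_unit)
  qed (simp_all add: bil_linear T_linear)
qed (simp_all add: bil_linear T_linear)

lemma L'_skew: "i \<in> {1..m} \<Longrightarrow> j \<in> {1..m} \<Longrightarrow> L' i j = - L' j i"
  using Lam_skew[of "T (unit_vec i)" "T (unit_vec j)"] by (simp only: L'_unit)

text \<open>\<open>p k\<close> has higher \<open>w k\<close>-degree than \<open>q k\<close>, so the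
  extreme monomial arises only by choosing \<open>p k\<close> in every factor and its coefficient is
  a single power of v.\<close>

lemma cf_Y_lead:
  assumes "e \<in> Z"
  shows "\<exists>N. cf (X e * Y k ^ r) (e + frag_cmul (int r) (p k)) = single N 1"
proof (induction r)
  case 0
  show ?case
    using assms by (auto simp: cf_X intro!: exI[of _ 0])
next
  case (Suc r)
  let ?y = "X e * Y k ^ r" and ?e = "e + frag_cmul (int (Suc r)) (p k)"
  have "?e - q k \<notin> supp ?y"
  proof
    assume "?e - q k \<in> supp ?y"
    then obtain i where i: "i \<ge> 0" "?e - q k = e + frag_cmul (int r) (p k) - frag_cmul i (b k)"
      using supp_gen[OF k assms] by fastforce
    from arg_cong[OF i(2), of "w k"] have "(i + 1) * d k = 0"
      using k by (simp add: w_linear q_eq w_b algebra_simps)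
    then show False
      using i(1) d_pos[OF k] by auto
  qed
  then have *: "cf ?y (?e - q k) = 0"
    by (simp add: supp_def)
  have **: "?e - p k = e + frag_cmul (int r) (p k)"
    by (simp add: frag_cmul_distrib)
  obtain N where "cf ?y (e + frag_cmul (int r) (p k)) = single N 1"
    using Suc.IH by blast
  moreover have "X e * Y k ^ Suc r = ?y * Y k"
    by (simp add: power_Suc2 mult.assoc del: power_Suc)
  moreover have "cf (?y * Y k) ?e = single (Lam (?e - p k) (p k)) 1 * cf ?y (?e - p k) +
      single (Lam (?e - q k) (q k)) 1 * cf ?y (?e - q k)"
    using assms k by (intro cf_mult_Y) auto
  ultimately have "cf (X e * Y k ^ Suc r) ?e = single (Lam (?e - p k) (p k)) 1 * single N 1"
    by (simp only: * ** mult_zero_right add_0_right)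
  then show ?case
    by (intro exI[of _ "Lam (?e - p k) (p k) + N"]) (simp only: mult_single mult_1_right)
qed

lemma Y_nonzero [simp]: "Y k \<noteq> 0"
proof
  assume "Y k = 0"
  then have "cf (X 0 * Y k ^ 1) e = 0" for e by simp
  then show False
    using cf_Y_lead[of 0 1] by (metis frag_of_nonzero zlattice_simps(1))
qed

lemma x'_nonzero: "i \<in> {1..m} \<Longrightarrow> x' i \<noteq> 0"
  by (simp add: x'_def)

lemma x'_commute: "i \<in> {1..m} \<Longrightarrow> j \<in> {1..m} \<Longrightarrow> q_commute (2 * L' i j) (x' i) (x' j)"
  using Y_mult_X[OF k, of "unit_vec j"] X_mult_Y[OF k, of "unit_vec i"] X_commute[of "unit_vec i" "unit_vec j"]
    Lam_skew[of "p k" "unit_vec i"]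
  by (auto simp: q_commute_def x'_def L'_unit T_uk T_id lookup_single)

lemma X'_mult: "X' e * X' f = vp (bil m L' e f) * X' (e + f)"
  unfolding X'_def using x'_nonzero x'_commute L'_skew by (rule bmon_mult)

lemma X'_unit: "i \<in> {1..m} \<Longrightarrow> X' (unit_vec i) = x' i"
  by (simp add: X'_def bmon_unit)

lemma X'_zero: "X' 0 = 1"
proof -
  have "bmon i L' x' 0 = 1" for i
    by (induction i) (simp_all add: bmon_Suc)
  then show ?thesis
    by (simp add: X'_def)
qed

lemma X'_uminus: "X' (- e) = inverse (X' e)"
proof -
  have "bil m L' e (- e) = 0"
  proof -
    have "bil m L' e e = - bil m L' e e"
      by (rule bil_skew) (use L'_skew in blast)
    then show ?thesis
      by (simp add: bil_linear)
  qed
  then have "X' e * X' (- e) = 1"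
    using X'_mult[of e "- e"] by (simp add: X'_zero)
  then show ?thesis
    by (simp add: inverse_unique)
qed

lemma X'_eq_X:
  assumes "e \<in> Z" "lookup e k = 0"
  shows "X' e = X e"
proof -
  have "keys e \<subseteq> {1..m} - {k}"
    using assms by (auto simp: zlattice_def in_keys_iff)
  then have "e \<in> Z \<and> lookup e k = 0 \<and> X' e = X e"
  proof (induction rule: frag_induction)
    case (one i)
    then have i: "i \<in> {1..m}" "i \<noteq> k" by auto
    have "single i 1 \<in> Z"
      using zlattice_simps(2)[OF i(1)] .
    then show ?case
      using i X'_unit[OF i(1)] by (simp add: x'_def lookup_single)
  next
    case (diff a c)
    have "X' (- c) = X (- c)"
      using diff by (simp add: X'_uminus X_uminus)
    moreover have "bil m L' a (- c) = Lam a (- c)"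
      using diff by (simp add: bil_L' T_id)
    ultimately have "vp (Lam a (- c)) * X' (a + - c) = vp (Lam a (- c)) * X (a + - c)"
      using X'_mult[of a "- c"] X_mult[of a "- c"] diff by simp
    then have "X' (a + - c) = X (a + - c)"
      by simp
    then show ?case
      using diff by (simp add: lookup_minus)
  qed (simp add: X'_zero)
  then show ?thesis by blast
qed

lemma X'_uk_power: "X' (frag_cmul (int r) (unit_vec k)) = Y k ^ r"
proof (induction r)
  case (Suc r)
  have "frag_cmul (int (Suc r)) (unit_vec k) = unit_vec k + frag_cmul (int r) (unit_vec k)"
    by (simp add: frag_cmul_distrib)
  moreover have "bil m L' (unit_vec k) (frag_cmul (int r) (unit_vec k)) = 0"
    using bil_L'[of "unit_vec k" "unit_vec k"] by (simp add: bil_linear)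
  ultimately show ?case
    using X'_mult[of "unit_vec k" "frag_cmul (int r) (unit_vec k)"] Suc X'_unit[OF k_in_m]
    by (simp add: x'_def)
qed (simp add: X'_zero)

text \<open>New monomials with nonnegative k-th exponent lie in the old torus. Negative powers of
  X'_k are what later proofs clear by multiplication.\<close>

lemma X'_split:
  assumes "e \<in> Z" "lookup e k = int r"
  shows "X' e = vp (- (int r * Lam (R e) (p k))) * (X (R e) * Y k ^ r)"
proof -
  have "bil m L' (R e) (frag_cmul (int r) (unit_vec k)) = int r * Lam (R e) (p k)"
    using assms bil_L'[of "R e" "unit_vec k"] by (simp add: bil_linear T_id T_uk)
  then have "X (R e) * Y k ^ r = vp (int r * Lam (R e) (p k)) * X' (R e + frag_cmul (int r) (unit_vec k))"
    using X'_mult[of "R e" "frag_cmul (int r) (unit_vec k)"] X'_eq_X[of "R e"] assms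
    by (simp add: X'_uk_power)
  then show ?thesis
    using R_split[of e] assms(2) by simp
qed

text \<open>A relation is multiplied by a power of X'_k so that it becomes one in the old torus;
  there a leading exponent of maximal \<open>w k\<close>-degree survives.\<close>

lemma X'_indep:
  assumes "finite A" "A \<subseteq> Z" "(\<Sum>e\<in>A. sc (c e) (X' e)) = 0" "e \<in> A"
  shows "c e = 0"
proof (rule ccontr)
  assume ne: "c e \<noteq> 0"
  define A' where "A' = {e \<in> A. c e \<noteq> 0}"
  have A': "finite A'" "A' \<subseteq> Z" "e \<in> A'"
    using assms ne by (auto simp: A'_def)
  \<comment> \<open>Large enough to make every k-th exponent in the relation nonnegative.\<close>
  define N where "N = nat (Max ((\<lambda>e. - lookup e k) ` A'))"
  have N: "lookup f k + int N \<ge> 0" if "f \<in> A'" for f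
  proof -
    have "- lookup f k \<le> Max ((\<lambda>e. - lookup e k) ` A')"
      using A' that by simp
    then show ?thesis by (simp add: N_def)
  qed
  define r where "r f = nat (lookup f k + int N)" for f
  define \<pi> where "\<pi> f = R f + frag_cmul (int (r f)) (p k)" for f
  define G where "G f = X (R f) * Y k ^ r f" for f
  have G: "G f \<in> torus_span" if "f \<in> A'" for f
    using that A' k by (auto simp: G_def)
  have "\<exists>l. X' (frag_cmul (int N) (unit_vec k)) * X' f = vp l * G f" if f: "f \<in> A'" for f
  proof -
    have "f + frag_cmul (int N) (unit_vec k) \<in> Z"
      using f A' by auto
    then have "X' (f + frag_cmul (int N) (unit_vec k)) = vp (- (int (r f) * Lam (R f) (p k))) * G f"
      using N[OF f] X'_split[of "f + frag_cmul (int N) (unit_vec k)" "r f"]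
      by (simp add: G_def r_def R_add_uk lookup_add)
    then show ?thesis
      using X'_mult[of "frag_cmul (int N) (unit_vec k)" f]
      by (simp add: add.commute flip: mult.assoc vp_add) blast
  qed
  then obtain l where l: "\<And>f. f \<in> A' \<Longrightarrow> X' (frag_cmul (int N) (unit_vec k)) * X' f = vp (l f) * G f"
    by metis
  have "(\<Sum>f\<in>A'. sc (c f) (X' f)) = (\<Sum>f\<in>A. sc (c f) (X' f))"
    using assms(1) by (intro sum.mono_neutral_left) (auto simp: A'_def)
  then have "(\<Sum>f\<in>A'. sc (c f) (X' f)) = 0"
    by (simp only: assms(3))
  then have "(\<Sum>f\<in>A'. X' (frag_cmul (int N) (unit_vec k)) * sc (c f) (X' f)) = 0"
    by (simp flip: sum_distrib_left)
  then have zero: "(\<Sum>f\<in>A'. sc (c f) (vp (l f) * G f)) = 0"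
    by (simp add: l flip: sc_mult(2))
  obtain e0 where e0: "e0 \<in> A'" "\<And>f. f \<in> A' \<Longrightarrow> w k (\<pi> f) \<le> w k (\<pi> e0)"
  proof -
    have fin: "finite ((\<lambda>f. w k (\<pi> f)) ` A')" and ne: "(\<lambda>f. w k (\<pi> f)) ` A' \<noteq> {}"
      using A' by auto
    from Max_in[OF fin ne] obtain g where "g \<in> A'" "w k (\<pi> g) = Max ((\<lambda>f. w k (\<pi> f)) ` A')"
      by auto
    then show ?thesis
      using that Max_ge[OF fin] by auto
  qed
  have other: "cf (G f) (\<pi> e0) = 0" if f: "f \<in> A'" "f \<noteq> e0" for f
  proof (rule ccontr)
    assume "cf (G f) (\<pi> e0) \<noteq> 0"
    moreover have "R f \<in> Z"
      using f A' by auto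
    ultimately obtain i where i: "i \<ge> 0" "\<pi> e0 = \<pi> f - frag_cmul i (b k)"
      using supp_gen[OF k, of "R f" "\<pi> e0" "r f"] by (auto simp: G_def supp_def \<pi>_def)
    \<comment> \<open>Maximality of \<open>e0\<close> leaves only \<open>i = 0\<close>, that is,
      equal leading exponents. Since \<open>p k\<close> has k-th entry -1, the k-th coordinate then
      recovers the original exponent, so \<open>\<pi>\<close> separates the terms.\<close>
    have "w k (\<pi> e0) = w k (\<pi> f) - i * d k"
      using i(2) k by (simp add: w_linear w_b)
    then have "i * d k \<le> 0"
      using e0(2)[OF f(1)] by simp
    then have "i = 0"
      using i(1) d_pos[OF k] by (simp add: mult_le_0_iff)
    then have eq: "\<pi> e0 = \<pi> f"
      using i by simp
    have \<pi>k: "lookup (\<pi> g) k = - (lookup g k + int N)" if "g \<in> A'" for g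
      using that k N[OF that] by (simp add: \<pi>_def lookup_add lookup_p_self r_def)
    then have "lookup e0 k = lookup f k"
      using \<pi>k[OF e0(1)] \<pi>k[OF f(1)] eq by simp
    moreover from this have "R e0 = R f"
      using eq by (simp add: \<pi>_def r_def)
    ultimately show False
      using f(2) R_split by metis
  qed
  have "0 = cf (\<Sum>f\<in>A'. sc (c f) (vp (l f) * G f)) (\<pi> e0)"
    by (simp add: zero)
  also have "\<dots> = (\<Sum>f\<in>A'. c f * (single (l f) 1 * cf (G f) (\<pi> e0)))"
    using G by (subst cf_sum) (auto simp: cf_scale cf_vp)
  also have "\<dots> = (\<Sum>f\<in>A'. if f = e0 then c e0 * (single (l e0) 1 * cf (G e0) (\<pi> e0)) else 0)"
    by (rule sum.cong) (auto simp: other)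
  also have "\<dots> = c e0 * (single (l e0) 1 * cf (G e0) (\<pi> e0))"
    using A' e0 by simp
  finally have "c e0 * (single (l e0) 1 * cf (G e0) (\<pi> e0)) = 0" ..
  moreover have "R e0 \<in> Z"
    using e0 A' by auto
  then have "cf (G e0) (\<pi> e0) \<noteq> 0"
    using cf_Y_lead[of "R e0" "r e0"] unfolding G_def \<pi>_def by auto
  ultimately show False
    using e0 by (auto simp: A'_def)
qed

text \<open>Through \<open>T\<close> the mutated columns become an integral change of basis of the
  old ones, so compatibility of the mutated seed can be computed with the old form.\<close>

lemma T_column: "j \<in> I \<Longrightarrow> T (column m B' j) = (if j = k then - b k else b j + frag_cmul (pos (- B k j)) (b k))"
proof (rule poly_mapping_eqI)
  fix i
  assume j: "j \<in> I"
  \<comment> \<open>The matrix mutation rule, corrected by the multiple of \<open>p k\<close> that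
    \<open>T\<close> adds to a column whose k-th entry is \<open>- B k j\<close>.\<close>
  have "pos u * pos v - pos (- u) * pos (- v) - v * pos u = pos (- v) * u" for u v :: int
    by (auto simp: max_def)
  from this[of "B i k" "B k j"]
  show "lookup (T (column m B' j)) i =
      lookup (if j = k then - b k else b j + frag_cmul (pos (- B k j)) (b k)) i"
    using j k_in_m k B_diag[OF k]
    by (auto simp: T_def B'_def mutate_matrix_def lookup_add lookup_minus lookup_column lookup_b
        lookup_p lookup_single algebra_simps)
qed

lemma quantum_seed': "quantum_seed m n B' d L'"
  unfolding quantum_seed_def
proof (intro conjI ballI)
  fix i j
  assume i: "i \<in> {1..m}" and j: "j \<in> I"
  have ui: "unit_vec i \<in> Z"
    using i zlattice_simps(2) by blast
  \<comment> \<open>Used at \<open>i = k\<close>: there \<open>T\<close> turns the unit vector into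
    \<open>p k\<close>, and the contributions of \<open>b j\<close> and of the multiple of
    \<open>b k\<close> must cancel.\<close>
  have "d j * pos (B j k) = d k * pos (- B k j)"
    using skew_symmetrizable[OF j k] B_sign[OF j k] by (auto simp: max_def)
  then show "bil m L' (column m B' j) (unit_vec i) = (if i = j then d j else 0)"
    using i j k ui I_le_m[OF j]
    by (cases "i = k"; cases "j = k")
      (auto simp: bil_L' T_column bil_linear Lam_b T_uk T_id lookup_single lookup_p B_diag[OF k])
next
  fix i j
  assume "i \<in> {1..m}" "j \<in> {1..m}"
  then show "L' i j = - L' j i"
    by (rule L'_skew)
qed (use seed in \<open>auto simp: quantum_seed_def\<close>)

sublocale s': qseed \<kappa> m L' X' n B' d
proof unfold_locales
  show "\<forall>i\<in>{1..m}. \<forall>j\<in>{1..m}. L' i j = - L' j i"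
    using L'_skew by blast
qed (rule X'_zero X'_mult X'_indep quantum_seed'; assumption?)+

section \<open>The one-step rings of the mutated seed compared with the old ones\<close>

lemma s'_p: "s'.p j = - unit_vec j + pos_vec (column m B' j)"
  and s'_q: "s'.q j = - unit_vec j + pos_vec (- column m B' j)"
  by (simp_all add: s'.p_def s'.q_def s'.b_def exch_vec_def)

text \<open>Mutation at k is an involution on the variable. After multiplication by X'_k both sides
  become sums of the same two old monomials, and X'_k is nonzero in a division ring.\<close>

lemma s'_Y_self: "s'.Y k = X (unit_vec k)"
proof -
  have *: "Y k * X' (- unit_vec k + g) = vp (Lam (p k) g) * X g" if "g \<in> Z" "lookup g k = 0" for g
  proof -
    have "- unit_vec k + g \<in> Z"
      using that by simp
    then have "bil m L' (unit_vec k) (- unit_vec k + g) = Lam (p k) g"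
      using that by (simp add: bil_L' T_linear T_uk T_id bil_linear)
    then show ?thesis
      using X'_mult[of "unit_vec k" "- unit_vec k + g"] X'_unit[OF k_in_m] X'_eq_X[OF that]
      by (simp add: x'_def)
  qed
  have g: "column m B' k = - b k"
    by (rule poly_mapping_eqI) (auto simp: lookup_column lookup_b B'_def mutate_matrix_def)
  have pq: "pos_vec (b k) = p k + unit_vec k" "pos_vec (- b k) = q k + unit_vec k"
    by (simp_all add: p_def q_def exch_vec_def b_def)
  have pq_k: "lookup (p k + unit_vec k) k = 0" "lookup (q k + unit_vec k) k = 0"
    using k by (simp_all add: lookup_add lookup_p_self lookup_q_self)
  have pqZ: "p k + unit_vec k \<in> Z" "q k + unit_vec k \<in> Z"
    using k by auto
  \<comment> \<open>This value makes the power of v at the second monomial match the one obtained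
    from X'_k X_k.\<close>
  have "Lam (p k) (q k) = - d k"
    using k Lam_skew[of "p k" "b k"] by (simp add: q_eq bil_linear Lam_b lookup_p_self)
  then have "Lam (p k) (q k + unit_vec k) = Lam (q k) (unit_vec k)"
    using k by (simp add: bil_linear Lam_q)
  then have "Y k * s'.Y k = vp (Lam (p k) (unit_vec k)) * X (p k + unit_vec k) +
      vp (Lam (q k) (unit_vec k)) * X (q k + unit_vec k)"
    using *[OF pqZ(1) pq_k(1)] *[OF pqZ(2) pq_k(2)]
    by (simp add: s'.Y_def s'_p s'_q g pq distrib_left bil_linear)
  also have "\<dots> = Y k * X (unit_vec k)"
    using k by (simp add: Y_def distrib_right X_mult)
  finally show ?thesis
    using mult_left_cancel Y_nonzero by blast
qed

text \<open>If \<open>u\<close> is the exponent of \<open>X'\<^sub>k\<close> not involving \<open>X\<^sub>j\<close>, then modulo \<open>S j\<close> only its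
  power survives in \<open>X\<^sub>j\<inverse> (X'\<^sub>k)\<^sup>c\<close>.\<close>

lemma Y_power_mod_S:
  assumes j: "j \<in> I" and u: "Y k = X u + X u'" "u \<in> Z" "u' \<in> Z"
    and "lookup u j = 0" "lookup u' j \<ge> 1" and e: "e \<in> Z" "lookup e j = - 1"
  shows "X e * Y k ^ c - vp (int c * Lam e u) * X (e + frag_cmul (int c) u) \<in> S j"
proof (induction c)
  case (Suc c)
  let ?f = "e + frag_cmul (int c) u"
  define s where "s = X e * Y k ^ c - vp (int c * Lam e u) * X ?f"
  have "X e * Y k ^ Suc c = (s + vp (int c * Lam e u) * X ?f) * Y k"
    by (simp add: s_def power_Suc2 mult.assoc del: power_Suc)
  also have "\<dots> = s * Y k + vp (int c * Lam e u) * (X ?f * X u + X ?f * X u')"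
    by (simp add: u(1) distrib_right distrib_left mult.assoc add_ac)
  also have "X ?f * X u = vp (Lam e u) * X (e + frag_cmul (int (Suc c)) u)"
    using e u by (simp add: X_mult bil_linear frag_cmul_distrib add_ac)
  finally have "X e * Y k ^ Suc c - vp (int (Suc c) * Lam e u) * X (e + frag_cmul (int (Suc c)) u) =
      s * Y k + vp (int c * Lam e u) * (X ?f * X u')"
    by (simp add: distrib_left vp_vp algebra_simps)
  \<comment> \<open>The factor X^u' raises the j-th exponent from -1 to a nonnegative value.\<close>
  moreover have "X ?f * X u' \<in> S j"
    using assms by (auto simp: X_mult S_vp lookup_add intro!: S_X)
  ultimately show ?case
    using Suc j S_mult[of s j "Y k"] S_Y[OF k] by (simp only: S_closed(2) S_vp flip: s_def)
qed (simp add: S_closed)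

text \<open>The sum is, up to a power of v, a monomial without X_j times \<open>Y j\<close>; such a
  monomial pairs to zero with \<open>b j\<close>, so both terms carry the same power of v.\<close>

lemma X_add_X_S:
  assumes j: "j \<in> I" and f: "f \<in> Z" "lookup f j = - 1"
  shows "X f + X (f - b j) \<in> S j"
proof -
  define g where "g = f - p j"
  have g: "g \<in> Z" "lookup g j = 0" "f = g + p j" "f - b j = g + q j"
    using assms by (auto simp: g_def lookup_minus lookup_p_self q_eq)
  have "Lam g (q j) = Lam g (p j)"
    using j g Lam_skew[of g "b j"] by (simp add: q_eq bil_linear Lam_b)
  then have "X f + X (f - b j) = vp (- Lam g (p j)) * (X g * Y j)"
    using g j by (simp only: g(3,4)) (simp add: X_add Y_def distrib_left)
  then show ?thesis
    using S_gen[of g j 1] g by (simp add: S_vp)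
qed

text \<open>The two new monomials need not lie in \<open>S j\<close> separately. Modulo
  \<open>S j\<close> a power of X'_k may be replaced by that of its term free of X_j, after which
  the two exponents differ by \<open>b j\<close> and \<open>X_add_X_S\<close> applies. The sign of
  \<open>B k j\<close> decides which monomial contains X'_k and which term of X'_k is kept.\<close>

lemma s'_Y_S:
  assumes j: "j \<in> I" "j \<noteq> k"
  shows "s'.Y j \<in> S j"
proof -
  define f1 where "f1 = s'.p j"
  define f2 where "f2 = s'.q j"
  have Z: "f1 \<in> Z" "f2 \<in> Z"
    using j by (auto simp: f1_def f2_def)
  have fj: "lookup f1 j = - 1" "lookup f2 j = - 1"
    using j by (simp_all add: f1_def f2_def s'.lookup_p_self s'.lookup_q_self)
  have fk: "lookup f1 k = pos (- B k j)" "lookup f2 k = pos (B k j)"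
  proof -
    have "B' k j = - B k j"
      by (simp add: B'_def mutate_matrix_def)
    then show "lookup f1 k = pos (- B k j)" "lookup f2 k = pos (B k j)"
      using j k_in_m by (auto simp: f1_def f2_def s'.lookup_p s'.lookup_q)
  qed
  have Tf: "T f2 = T f1 - b j - frag_cmul (pos (- B k j)) (b k)"
    using j T_column[OF j(1)] by (simp add: f1_def f2_def s'.q_eq s'.b_def T_linear diff_diff_eq)
  have Y: "s'.Y j = X' f1 + X' f2"
    by (simp add: s'.Y_def f1_def f2_def)
  show ?thesis
  proof (cases "B k j = 0")
    case True
    then have "s'.Y j = X f1 + X (f1 - b j)"
      using Z fk Tf by (simp add: Y X'_eq_X T_id)
    then show ?thesis
      using X_add_X_S[OF j(1) Z(1) fj(1)] by simp
  next
    case False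
    \<comment> \<open>The last condition on \<open>u\<close> lets the normalization in
      \<open>X'_split\<close> cancel the power of v produced by
      \<open>Y_power_mod_S\<close>.\<close>
    have red: "X' f - X (R f + frag_cmul (int c) u) \<in> S j"
      if f: "f \<in> Z" "lookup f j = - 1" "lookup f k = int c"
        and u: "Y k = X u + X u'" "u \<in> Z" "u' \<in> Z" "lookup u j = 0" "lookup u' j \<ge> 1"
          "Lam (R f) u = Lam (R f) (p k)" for f u u' c
    proof -
      have "X (R f) * Y k ^ c - vp (int c * Lam (R f) u) * X (R f + frag_cmul (int c) u) \<in> S j"
        using f u j by (intro Y_power_mod_S[where u' = u']) (auto simp: R_lookup)
      then have "vp (- (int c * Lam (R f) u)) *
          (X (R f) * Y k ^ c - vp (int c * Lam (R f) u) * X (R f + frag_cmul (int c) u)) \<in> S j"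
        by (simp only: S_vp)
      then show ?thesis
        using f u by (simp add: X'_split right_diff_distrib)
    qed
    show ?thesis
    proof (cases "B k j > 0")
      case True
      define c where "c = nat (B k j)"
      have c: "lookup f2 k = int c" "lookup f1 k = 0"
        using True fk by (auto simp: c_def)
      have "B j k < 0"
        using True B_sign[OF k j(1)] by simp
      then have "X' f2 - X (R f2 + frag_cmul (int c) (p k)) \<in> S j"
        using j k I_le_m[OF j(1)]
        by (intro red[where u' = "q k"] Z fj c) (auto simp: lookup_p lookup_q Y_def)
      moreover have "R f2 + frag_cmul (int c) (p k) = f1 - b j"
        using T_R[of f2] Tf c True by (simp add: T_id)
      moreover have "s'.Y j = (X' f2 - X (f1 - b j)) + (X f1 + X (f1 - b j))"
        using c Z by (simp add: Y X'_eq_X)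
      ultimately show ?thesis
        using X_add_X_S[OF j(1) Z(1) fj(1)] by (simp only: S_closed(2))
    next
      case B: False
      define c where "c = nat (- B k j)"
      have c: "lookup f1 k = int c" "lookup f2 k = 0"
        using B fk by (auto simp: c_def)
      have Rq: "Lam (R f1) (q k) = Lam (R f1) (p k)"
        using k Lam_skew[of "R f1" "b k"] by (simp add: q_eq bil_linear Lam_b)
      have "B j k > 0"
        using B False B_sign[OF k j(1)] B_sign[OF j(1) k] by linarith
      then have "X' f1 - X (R f1 + frag_cmul (int c) (q k)) \<in> S j"
        using j k I_le_m[OF j(1)] Rq
        by (intro red[where u' = "p k"] Z fj c) (auto simp: lookup_p lookup_q Y_def)
      \<comment> \<open>Here the kept term is \<open>q k = p k - b k\<close>, which accounts for the
        multiple of \<open>b k\<close> in \<open>Tf\<close>.\<close>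
      moreover have "R f1 + frag_cmul (int c) (q k) = f2 + b j"
      proof -
        have "f2 = R f1 + frag_cmul (int c) (p k) - b j - frag_cmul (int c) (b k)"
          using T_R[of f1] Tf c B by (simp add: T_id c_def max_def)
        moreover have "frag_cmul (int c) (q k) = frag_cmul (int c) (p k) - frag_cmul (int c) (b k)"
          by (rule poly_mapping_eqI) (simp add: q_eq lookup_minus algebra_simps)
        ultimately show ?thesis
          by simp
      qed
      moreover have "s'.Y j = (X' f1 - X (f2 + b j)) + (X (f2 + b j) + X (f2 + b j - b j))"
        using c Z by (simp add: Y X'_eq_X)
      moreover have "X (f2 + b j) + X (f2 + b j - b j) \<in> S j"
        using X_add_X_S[OF j(1), of "f2 + b j"] Z fj j
        by (simp add: lookup_add lookup_b B_diag[OF j(1)])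
      ultimately show ?thesis
        by (simp only: S_closed(2))
    qed
  qed
qed

text \<open>X_k and X'_k exchange roles, so each new spanning product is a product of elements of
  the old ring.\<close>

lemma s'_S_self: "y \<in> s'.S k \<Longrightarrow> y \<in> S k"
proof (induction rule: s'.S_induct)
  case (step c e r z)
  have "X (R e) * Y k ^ nat (lookup e k) * X (unit_vec k) ^ r \<in> S k"
    using step k by (intro S_mult S_gen S_power S_X) (auto simp: lookup_single)
  moreover have "X' e * s'.Y k ^ r = vp (- (int (nat (lookup e k)) * Lam (R e) (p k))) *
      (X (R e) * Y k ^ nat (lookup e k) * X (unit_vec k) ^ r)"
    using step X'_split[of e "nat (lookup e k)"] by (simp add: s'_Y_self mult.assoc)
  ultimately show ?case
    using step by (simp add: S_closed S_vp)
qed (simp add: S_closed)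

text \<open>Negative powers of X'_k are the only obstruction. The claim is made for all large
  exponents so that the terms of a sum admit a common one.\<close>

lemma s'_S_clear_denominator:
  assumes j: "j \<in> I" "j \<noteq> k" and y: "y \<in> s'.S j"
  shows "\<exists>N. \<forall>M\<ge>N. Y k ^ M * y \<in> S j"
  using y
proof (induction rule: s'.S_induct)
  case (step c e r z)
  obtain N where N: "\<And>M. M \<ge> N \<Longrightarrow> Y k ^ M * z \<in> S j"
    using step by blast
  have "Y k ^ M * (X' e * s'.Y j ^ r) \<in> S j" if M: "M \<ge> nat (- lookup e k)" for M
  proof -
    let ?f = "frag_cmul (int M) (unit_vec k) + e"
    have Re: "R ?f = R e"
      using R_add_uk[of e "int M"] by (simp add: add.commute)
    have "?f \<in> Z"
      using step by simp
    moreover have "lookup ?f k = int (nat (lookup e k + int M))"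
      using M by (simp add: lookup_add)
    ultimately have "X' ?f = vp (- (int (nat (lookup e k + int M)) * Lam (R e) (p k))) *
        (X (R e) * Y k ^ nat (lookup e k + int M))"
      using X'_split[of ?f] by (simp only: Re)
    moreover have "X (R e) * Y k ^ nat (lookup e k + int M) \<in> S j"
      using step j k by (intro S_mult S_X S_power S_Y) (auto simp: R_lookup)
    ultimately have "X' ?f \<in> S j"
      by (simp only: S_vp)
    then have "X' ?f * s'.Y j ^ r \<in> S j"
      using j by (intro S_mult S_power s'_Y_S)
    moreover have "Y k ^ M * (X' e * s'.Y j ^ r) =
        vp (bil m L' (frag_cmul (int M) (unit_vec k)) e) * (X' ?f * s'.Y j ^ r)"
      using X'_mult[of "frag_cmul (int M) (unit_vec k)" e]
      by (simp add: X'_uk_power flip: mult.assoc)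
    ultimately show ?thesis
      by (simp only: S_vp)
  qed
  then have "\<forall>M\<ge>max N (nat (- lookup e k)). Y k ^ M * (sc c (X' e * s'.Y j ^ r) + z) \<in> S j"
    using N by (auto simp: distrib_left sc_mult(2)[symmetric] intro!: S_closed)
  then show ?case by blast
qed (auto simp: S_closed)

lemma U_mutation: "s'.U \<subseteq> U"
proof
  fix y assume y: "y \<in> s'.U"
  \<comment> \<open>This index comes first because it also places \<open>y\<close> in the old torus,
    where cancellation of X'_k takes place.\<close>
  have k_S: "y \<in> S k"
    using s'.U_S[OF y k] s'_S_self by blast
  have "y \<in> S j" if j: "j \<in> I" "j \<noteq> k" for j
    using s'_S_clear_denominator[OF j s'.U_S[OF y j(1)]] S_cancel_Y_power[OF j(1) k j(2)]
      S_torus[OF k k_S] by blast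
  then show "y \<in> U"
    using k_S unfolding U_def by blast
qed

end

section \<open>Expansions of ordered products\<close>

lemma diff_diff_eq_imp: "a - x - y = a - z \<Longrightarrow> x + y = z" for a :: "'b::ab_group_add"
  by (metis diff_diff_eq diff_left_imp_eq)

context qseed
begin

section \<open>Combinations of columns and parallelepipeds of exponents\<close>

definition comb :: "(nat \<Rightarrow> int) \<Rightarrow> ivec" where
  "comb c = (\<Sum>j\<in>I. frag_cmul (c j) (b j))"

lemma comb_in_Z [simp]: "comb c \<in> Z"
  by (auto simp: comb_def)

lemma lookup_comb: "lookup (comb c) i = (if i \<in> {1..m} then \<Sum>j\<in>I. c j * B i j else 0)"
  by (auto simp: comb_def lookup_sum lookup_b intro!: sum.cong sum.neutral)

lemma w_sum: "w k (sum f A) = (\<Sum>x\<in>A. w k (f x))"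
  by (induction A rule: infinite_finite_induct) (simp_all add: w_linear)

lemma w_comb: "k \<in> I \<Longrightarrow> w k (comb c) = c k * d k"
proof -
  assume k: "k \<in> I"
  have "w k (comb c) = (\<Sum>j\<in>I. if j = k then c k * d k else 0)"
    unfolding comb_def w_sum by (rule sum.cong) (auto simp: w_linear w_b)
  then show ?thesis
    using k by simp
qed

lemma comb_add: "comb (\<lambda>k. c k + c' k) = comb c + comb c'"
  and comb_diff: "comb (\<lambda>k. c k - c' k) = comb c - comb c'"
  by (simp_all add: comb_def frag_cmul_distrib frag_cmul_diff_distrib sum.distrib sum_subtractf)

lemma comb_zero: "(\<And>k. k \<in> I \<Longrightarrow> c k = 0) \<Longrightarrow> comb c = 0"
  by (simp add: comb_def)

lemma comb_cong: "(\<And>k. k \<in> I \<Longrightarrow> c k = c' k) \<Longrightarrow> comb c = comb c'"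
  by (simp add: comb_def)

text \<open>The degree \<open>w k\<close> of a combination is \<open>c k * d k\<close>, so
  compatibility forces the columns to be independent.\<close>

lemma comb_inject:
  assumes "comb c = comb c'" "k \<in> I"
  shows "c k = c' k"
  using arg_cong[OF assms(1), of "w k"] d_pos[OF assms(2)] assms(2) by (simp add: w_comb)

lemma comb_update:
  assumes "k \<in> I"
  shows "comb (c(k := c k + s)) = comb c + frag_cmul s (b k)"
proof -
  have "c(k := c k + s) = (\<lambda>j. c j + (if j = k then s else 0))"
    by auto
  moreover have "comb (\<lambda>j. if j = k then s else 0) = (\<Sum>j\<in>I. if j = k then frag_cmul s (b k) else 0)"
    unfolding comb_def by (rule sum.cong) auto
  ultimately show ?thesis
    using assms by (simp add: comb_add)
qed

definition below :: "ivec \<Rightarrow> (nat \<Rightarrow> int) \<Rightarrow> ivec set" where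
  "below \<pi> r = {\<pi> - comb c | c. \<forall>k\<in>I. 0 \<le> c k \<and> c k \<le> r k}"

lemma belowI: "(\<And>k. k \<in> I \<Longrightarrow> 0 \<le> c k \<and> c k \<le> r k) \<Longrightarrow> \<pi> - comb c \<in> below \<pi> r"
  unfolding below_def by blast

text \<open>\<open>l\<close> is the leading term of \<open>y\<close>, including its power of \<open>v\<close>.\<close>

definition leads :: "'f \<Rightarrow> 'f \<Rightarrow> ivec \<Rightarrow> (nat \<Rightarrow> int) \<Rightarrow> bool" where
  "leads y l \<pi> r \<longleftrightarrow> y \<in> torus_span \<and> \<pi> \<in> Z \<and> supp y \<subseteq> below \<pi> r \<and>
     (\<exists>N. l = vp N * X \<pi> \<and> cf y \<pi> = single N 1)"

lemma leads_X: "e \<in> Z \<Longrightarrow> leads (X e) (X e) e (\<lambda>_. 0)"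
  using belowI[of "\<lambda>_. 0" "\<lambda>_. 0" e] comb_zero[of "\<lambda>_. 0"]
  by (auto simp: leads_def supp_X cf_X intro!: exI[of _ 0])

text \<open>One factor \<open>Y k\<close> enlarges the box by one step in direction
  \<open>b k\<close>. The choice \<open>q k\<close> could reach the new leading exponent only from
  \<open>\<pi> + b k\<close>, which lies outside the old box.\<close>

lemma leads_Y:
  assumes "leads y l \<pi> r" and k: "k \<in> I"
  shows "leads (y * Y k) (l * X (p k)) (\<pi> + p k) (r(k := r k + 1))"
proof -
  from assms(1) obtain N where y: "y \<in> torus_span" "\<pi> \<in> Z" "supp y \<subseteq> below \<pi> r"
      and N: "l = vp N * X \<pi>" "cf y \<pi> = single N 1"
    unfolding leads_def by blast
  have "\<pi> + b k \<notin> supp y"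
  proof
    assume "\<pi> + b k \<in> supp y"
    then obtain c where c: "\<pi> + b k = \<pi> - comb c" "\<forall>k\<in>I. 0 \<le> c k"
      using y(3) unfolding below_def by blast
    have "(c k + 1) * d k = 0"
      using arg_cong[OF c(1), of "w k"] k by (simp add: w_linear w_comb w_b algebra_simps)
    then show False
      using c(2) k d_pos[OF k] by fastforce
  qed
  then have "cf y (\<pi> + p k - q k) = 0"
    by (simp add: q_eq supp_def)
  then have cf: "cf (y * Y k) (\<pi> + p k) = single (Lam \<pi> (p k) + N) 1"
    using y k N by (simp add: cf_mult_Y mult_single)
  have l: "l * X (p k) = vp (Lam \<pi> (p k) + N) * X (\<pi> + p k)"
    using y k N by (simp add: X_mult mult.assoc vp_vp add.commute)
  have supp: "supp (y * Y k) \<subseteq> below (\<pi> + p k) (r(k := r k + 1))"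
  proof
    fix e assume "e \<in> supp (y * Y k)"
    then have "e - p k \<in> supp y \<or> e - q k \<in> supp y"
      using y k by (auto simp: supp_def cf_mult_Y)
    then show "e \<in> below (\<pi> + p k) (r(k := r k + 1))"
    proof
      assume "e - p k \<in> supp y"
      then obtain c where c: "e - p k = \<pi> - comb c" "\<forall>k\<in>I. 0 \<le> c k \<and> c k \<le> r k"
        using y(3) unfolding below_def by blast
      have "e = (\<pi> + p k) - comb c"
        using c(1) by (simp add: algebra_simps)
      then show ?thesis
        using c(2) by (force intro!: belowI)
    next
      assume "e - q k \<in> supp y"
      then obtain c where c: "e - q k = \<pi> - comb c" "\<forall>k\<in>I. 0 \<le> c k \<and> c k \<le> r k"
        using y(3) unfolding below_def by blast
      have "e = (\<pi> + p k) - comb (c(k := c k + 1))"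
        unfolding comb_update[OF k] using c(1) by (simp add: q_eq algebra_simps)
      moreover have "\<dots> \<in> below (\<pi> + p k) (r(k := r k + 1))"
        using c(2) by (intro belowI) force
      ultimately show ?thesis by simp
    qed
  qed
  show ?thesis
    unfolding leads_def using y k cf l supp by auto
qed

lemma leads_Y_power:
  assumes "leads y l \<pi> r" "k \<in> I"
  shows "leads (y * Y k ^ a) (l * X (p k) ^ a) (\<pi> + frag_cmul (int a) (p k)) (r(k := r k + int a))"
proof (induction a)
  case 0
  then show ?case using assms by simp
next
  case (Suc a)
  have "leads (y * Y k ^ a * Y k) (l * X (p k) ^ a * X (p k)) (\<pi> + frag_cmul (int a) (p k) + p k)
      ((r(k := r k + int a))(k := (r(k := r k + int a)) k + 1))"
    using leads_Y[OF Suc assms(2)] .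
  moreover have "(r(k := r k + int a))(k := (r(k := r k + int a)) k + 1) = r(k := r k + int (Suc a))"
    by auto
  ultimately have "leads (y * Y k ^ a * Y k) (l * X (p k) ^ a * X (p k))
      (\<pi> + frag_cmul (int a) (p k) + p k) (r(k := r k + int (Suc a)))"
    by (simp only:)
  moreover have "\<pi> + frag_cmul (int (Suc a)) (p k) = \<pi> + frag_cmul (int a) (p k) + p k"
    by (simp add: frag_cmul_distrib add_ac)
  ultimately show ?case
    by (simp only: power_Suc2 mult.assoc)
qed

lemma leads_prod_list:
  assumes "leads y l \<pi> r" "distinct ks" "set ks \<subseteq> I"
  shows "leads (y * prod_list (map (\<lambda>k. Y k ^ a k) ks)) (l * prod_list (map (\<lambda>k. X (p k) ^ a k) ks))
    (\<pi> + (\<Sum>k\<in>set ks. frag_cmul (int (a k)) (p k))) (\<lambda>k. if k \<in> set ks then r k + int (a k) else r k)"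
  using assms
proof (induction ks arbitrary: y l \<pi> r)
  case (Cons k ks)
  have *: "leads (y * Y k ^ a k) (l * X (p k) ^ a k) (\<pi> + frag_cmul (int (a k)) (p k)) (r(k := r k + int (a k)))"
    using Cons.prems by (intro leads_Y_power) auto
  have "(\<lambda>j. if j \<in> set ks then (r(k := r k + int (a k))) j + int (a j) else (r(k := r k + int (a k))) j) =
    (\<lambda>j. if j \<in> set (k # ks) then r j + int (a j) else r j)"
    using Cons.prems by auto
  then show ?case
    using Cons.IH[OF *] Cons.prems by (simp add: mult.assoc add.assoc)
qed simp

section \<open>Leading exponents of the standard monomials\<close>

definition nonneg_part :: "ivec \<Rightarrow> ivec" where
  "nonneg_part a = (\<Sum>i=n+1..m. single i (lookup a i)) + (\<Sum>j=1..n. single j (pos (lookup a j)))"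

definition lead_exp :: "ivec \<Rightarrow> ivec" where
  "lead_exp a = nonneg_part a + (\<Sum>k\<in>I. frag_cmul (pos (- lookup a k)) (p k))"

lemma lookup_nonneg_part:
  assumes "a \<in> Z"
  shows "lookup (nonneg_part a) i = (if i \<in> I then pos (lookup a i) else lookup a i)"
proof -
  have "lookup (nonneg_part a) i = (\<Sum>j=n+1..m. if j = i then lookup a i else 0) +
      (\<Sum>j=1..n. if j = i then pos (lookup a i) else 0)"
    unfolding nonneg_part_def lookup_add lookup_sum
    by (intro arg_cong2[where f = "(+)"] sum.cong) (auto simp: lookup_single when_def)
  also have "\<dots> = (if i \<in> I then pos (lookup a i) else lookup a i)"
    using assms by (auto simp: zlattice_iff)
  finally show ?thesis .
qed

lemma nonneg_part_in_Z: "a \<in> Z \<Longrightarrow> nonneg_part a \<in> Z"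
  using I_le_m unfolding zlattice_iff by (subst (asm) zlattice_iff[symmetric]) (auto simp: lookup_nonneg_part zlattice_iff)

lemma lead_exp_in_Z: "a \<in> Z \<Longrightarrow> lead_exp a \<in> Z"
  unfolding lead_exp_def by (intro zlattice_add nonneg_part_in_Z zlattice_sum zlattice_cmul p_in_Z)

text \<open>The entries -1 of \<open>p k\<close> restore the negative coordinates of
  \<open>a\<close>. What is left is \<open>a\<close> plus a correction that is triangular in
  topological order.\<close>

lemma lookup_lead_exp:
  assumes "a \<in> Z" "i \<in> {1..m}"
  shows "lookup (lead_exp a) i = lookup a i + (\<Sum>k\<in>I. pos (- lookup a k) * pos (B i k))"
proof -
  have "(\<Sum>k\<in>I. pos (- lookup a k) * lookup (p k) i) =
      (\<Sum>k\<in>I. pos (- lookup a k) * pos (B i k) - (if k = i then pos (- lookup a i) else 0))"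
    using assms(2) by (intro sum.cong) (auto simp: lookup_p algebra_simps)
  also have "\<dots> = (\<Sum>k\<in>I. pos (- lookup a k) * pos (B i k)) - (if i \<in> I then pos (- lookup a i) else 0)"
    by (simp add: sum_subtractf)
  finally show ?thesis
    using assms by (auto simp: lead_exp_def lookup_add lookup_sum lookup_nonneg_part max_def)
qed

end

section \<open>The span of the standard monomials\<close>

text \<open>Elimination sees only membership in U, the enclosing box and the leading coefficient 1.
  The order of the factors in E_a is thereby separated from the topological order
  \<open>ks\<close>.\<close>

locale standard_monomials = qseed \<kappa> m L X n B d
  for \<kappa> :: "laurent \<Rightarrow> 'f::division_ring" and m L X n B d +
  fixes ks :: "nat list" and E :: "ivec \<Rightarrow> 'f"
  assumes ks: "distinct ks" "set ks = {1..n}"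
    and ks_sorted: "\<And>M N. M < N \<Longrightarrow> N < n \<Longrightarrow> B (ks ! M) (ks ! N) \<le> 0"
    and E_U: "a \<in> zlattice m \<Longrightarrow> E a \<in> U"
    and E_supp: "a \<in> zlattice m \<Longrightarrow> supp (E a) \<subseteq> below (lead_exp a) (\<lambda>k. pos (- lookup a k))"
    and E_lead: "a \<in> zlattice m \<Longrightarrow> cf (E a) (lead_exp a) = 1"
begin

abbreviation neg_part :: "ivec \<Rightarrow> nat \<Rightarrow> int" where
  "neg_part a \<equiv> \<lambda>k. pos (- lookup a k)"

lemma length_ks: "length ks = n"
  using distinct_card[OF ks(1)] ks(2) by simp

lemma ks_nth: "N < n \<Longrightarrow> ks ! N \<in> I"
  using ks(2) length_ks nth_mem by metis

lemma ks_index: "k \<in> I \<Longrightarrow> \<exists>N<n. k = ks ! N"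
  using ks(2) length_ks by (metis in_set_conv_nth)

lemma ks_inject: "M < n \<Longrightarrow> N < n \<Longrightarrow> ks ! M = ks ! N \<longleftrightarrow> M = N"
  using ks(1) length_ks nth_eq_iff_index_eq by metis

lemma ball_ks: "(\<forall>k\<in>I. P k) \<longleftrightarrow> (\<forall>N<n. P (ks ! N))"
  using ks_nth ks_index by metis

lemma pos_B_ks: "N \<le> M \<Longrightarrow> M < n \<Longrightarrow> pos (B (ks ! N) (ks ! M)) = 0"
  using ks_sorted[of N M] B_diag[OF ks_nth, of N] by (cases "N = M") auto

lemma B_ks_nonneg: "M < N \<Longrightarrow> N < n \<Longrightarrow> B (ks ! N) (ks ! M) \<ge> 0"
  using ks_sorted[of M N] B_sign(1)[OF ks_nth ks_nth, of N M] B_sign(1)[OF ks_nth ks_nth, of M N]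
    B_sign(2)[OF ks_nth ks_nth, of M N] by fastforce

text \<open>Lexicographic comparison of the degrees \<open>w k\<close>, the topologically last one first.\<close>

definition lt :: "ivec \<Rightarrow> ivec \<Rightarrow> bool" where
  "lt e f \<longleftrightarrow> (\<exists>N<n. w (ks ! N) e < w (ks ! N) f \<and> (\<forall>M. N < M \<and> M < n \<longrightarrow> w (ks ! M) e = w (ks ! M) f))"

lemma lt_irrefl [simp]: "\<not> lt e e"
  by (simp add: lt_def)

lemma lt_trans: "lt e f \<Longrightarrow> lt f g \<Longrightarrow> lt e g"
proof -
  assume "lt e f" "lt f g"
  then obtain N N' where N: "N < n" "w (ks ! N) e < w (ks ! N) f"
      "\<And>M. N < M \<Longrightarrow> M < n \<Longrightarrow> w (ks ! M) e = w (ks ! M) f"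
    and N': "N' < n" "w (ks ! N') f < w (ks ! N') g"
      "\<And>M. N' < M \<Longrightarrow> M < n \<Longrightarrow> w (ks ! M) f = w (ks ! M) g"
    unfolding lt_def by blast
  show ?thesis
    unfolding lt_def
  proof (intro exI[of _ "max N N'"] conjI allI impI)
    show "w (ks ! max N N') e < w (ks ! max N N') g"
      using N N' by (cases N N' rule: linorder_cases) (auto simp: max_def)
  qed (use N N' in auto)
qed

lemma lt_comb:
  assumes "\<And>k. k \<in> I \<Longrightarrow> c k \<ge> 0" "comb c \<noteq> 0"
  shows "lt (f - comb c) f"
proof -
  define A where "A = {N. N < n \<and> c (ks ! N) \<noteq> 0}"
  have "A \<noteq> {}"
    using assms(2) comb_zero[of c] ks_index unfolding A_def by fast
  moreover have fin: "finite A"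
    by (simp add: A_def)
  ultimately have "Max A \<in> A"
    by (rule Max_in[rotated])
  then have N: "Max A < n" "c (ks ! Max A) > 0"
    using assms(1)[OF ks_nth, of "Max A"] by (auto simp: A_def)
  have "c (ks ! M) = 0" if "Max A < M" "M < n" for M
  proof (rule ccontr)
    assume "c (ks ! M) \<noteq> 0"
    then have "M \<in> A"
      using that by (simp add: A_def)
    then show False
      using Max_ge[OF fin, of M] that by linarith
  qed
  then show ?thesis
    unfolding lt_def using N ks_nth d_pos
    by (intro exI[of _ "Max A"]) (auto simp: w_linear w_comb)
qed

lemma lead_exp_inject:
  assumes "a \<in> Z" "a' \<in> Z" "lead_exp a = lead_exp a'"
  shows "a = a'"
proof -
  have eq: "lookup a i + (\<Sum>k\<in>I. neg_part a k * pos (B i k)) =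
      lookup a' i + (\<Sum>k\<in>I. neg_part a' k * pos (B i k))" if "i \<in> {1..m}" for i
    using lookup_lead_exp[OF assms(1) that] lookup_lead_exp[OF assms(2) that] assms(3) by simp
  have "N < n \<Longrightarrow> lookup a (ks ! N) = lookup a' (ks ! N)" for N
  proof (induction N rule: less_induct)
    case (less N)
    have "(\<Sum>k\<in>I. neg_part a k * pos (B (ks ! N) k)) = (\<Sum>k\<in>I. neg_part a' k * pos (B (ks ! N) k))"
    proof (rule sum.cong)
      fix k assume "k \<in> I"
      then obtain M where M: "M < n" "k = ks ! M"
        using ks_index by blast
      then show "neg_part a k * pos (B (ks ! N) k) = neg_part a' k * pos (B (ks ! N) k)"
        using less pos_B_ks[of N M] by (cases "M < N") auto
    qed simp
    then show ?case
      using eq[OF I_le_m[OF ks_nth[OF less(2)]]] by simp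
  qed
  then have I: "lookup a k = lookup a' k" if "k \<in> I" for k
    using that ks_index by blast
  then have "(\<Sum>k\<in>I. neg_part a k * pos (B i k)) = (\<Sum>k\<in>I. neg_part a' k * pos (B i k))" for i
    by simp
  then have "lookup a i = lookup a' i" if "i \<in> {1..m}" for i
    using eq[OF that] by simp
  then show ?thesis
    using assms unfolding zlattice_iff by (intro poly_mapping_eqI) metis
qed

lemma lead_exp_surj:
  assumes "g \<in> Z"
  shows "\<exists>a\<in>Z. lead_exp a = g"
proof -
  have "N \<le> n \<Longrightarrow> \<exists>h. \<forall>M<N. lookup g (ks ! M) = h (ks ! M) + (\<Sum>j\<in>I. pos (- h j) * pos (B (ks ! M) j))" for N
  proof (induction N)
    case (Suc N)
    then obtain h where h: "\<And>M. M < N \<Longrightarrow> lookup g (ks ! M) = h (ks ! M) + (\<Sum>j\<in>I. pos (- h j) * pos (B (ks ! M) j))"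
      by auto
    define k where "k = ks ! N"
    \<comment> \<open>The equation at \<open>k\<close> is solved for its new value. The change does
      not disturb the equations already solved, because \<open>k\<close> contributes to the
      corrections of later vertices only.\<close>
    define h' where "h' = h(k := lookup g k - (\<Sum>j\<in>I. pos (- h j) * pos (B k j)))"
    have sum: "(\<Sum>j\<in>I. pos (- h' j) * pos (B (ks ! M) j)) = (\<Sum>j\<in>I. pos (- h j) * pos (B (ks ! M) j))"
      if "M \<le> N" for M
      using pos_B_ks[of M N] that Suc.prems by (intro sum.cong) (auto simp: h'_def k_def)
    have "lookup g (ks ! M) = h' (ks ! M) + (\<Sum>j\<in>I. pos (- h' j) * pos (B (ks ! M) j))" if "M < Suc N" for M
      using sum[of M] h[of M] ks_inject[of M N] that Suc.prems
      by (cases "M = N") (auto simp: h'_def k_def)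
    then show ?case by blast
  qed simp
  from this[OF order.refl] obtain h where h: "\<And>k. k \<in> I \<Longrightarrow> lookup g k = h k + (\<Sum>j\<in>I. pos (- h j) * pos (B k j))"
    using ks_index by metis
  define u where "u i = (if i \<in> I then h i else lookup g i - (\<Sum>j\<in>I. pos (- h j) * pos (B i j)))" for i
  define a where "a = (\<Sum>i=1..m. single i (u i))"
  have a: "lookup a i = (if i \<in> {1..m} then u i else 0)" for i
  proof -
    have "lookup a i = (\<Sum>j=1..m. if j = i then u i else 0)"
      unfolding a_def lookup_sum by (rule sum.cong) (auto simp: lookup_single when_def)
    then show ?thesis by simp
  qed
  have aZ: "a \<in> Z"
    by (simp add: zlattice_iff a)
  have "lookup a k = h k" if "k \<in> I" for k
    using that I_le_m[OF that] by (simp add: a u_def)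
  then have "lookup (lead_exp a) i = lookup g i" for i
    using h lookup_lead_exp[OF aZ, of i] lead_exp_in_Z[OF aZ] assms
    by (cases "i \<in> {1..m}") (auto simp: zlattice_iff a u_def)
  then show ?thesis
    using aZ poly_mapping_eqI by blast
qed

text \<open>The vertex walk: start at a maximal exponent of \<open>y \<in> U\<close> and descend along the exchange
  directions in topological order.  In each direction the divisibility condition of \<open>S k\<close>
  guarantees a long enough step.\<close>

lemma vertex_walk:
  assumes y: "y \<in> U" and a: "a \<in> Z" and mem: "lead_exp a \<in> supp y"
    and max: "\<And>e. e \<in> supp y \<Longrightarrow> \<not> lt (lead_exp a) e"
  shows "\<exists>t. (\<forall>k\<in>I. neg_part a k \<le> t k) \<and> lead_exp a - comb t \<in> supp y"
proof -
  let ?\<pi> = "lead_exp a"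
  have "N \<le> n \<Longrightarrow> \<exists>t. (\<forall>M<N. neg_part a (ks ! M) \<le> t (ks ! M)) \<and>
      (\<forall>M. N \<le> M \<and> M < n \<longrightarrow> t (ks ! M) = 0) \<and> ?\<pi> - comb t \<in> supp y" for N
  proof (induction N)
    case 0
    then show ?case
      using mem comb_zero[of "\<lambda>_. 0"] by (intro exI[of _ "\<lambda>_. 0"]) simp
  next
    case (Suc N)
    then obtain t where t: "\<And>M. M < N \<Longrightarrow> neg_part a (ks ! M) \<le> t (ks ! M)"
        "\<And>M. N \<le> M \<Longrightarrow> M < n \<Longrightarrow> t (ks ! M) = 0" "?\<pi> - comb t \<in> supp y"
      by auto
    define k where "k = ks ! N"
    define e where "e = ?\<pi> - comb t"
    have N: "N < n" and k: "k \<in> I" and tk: "t k = 0"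
      using Suc.prems ks_nth t(2) by (auto simp: k_def)
    \<comment> \<open>From position \<open>N\<close> on, \<open>t\<close> is still zero. A higher
      exponent on this line would therefore exceed the leading exponent in degree \<open>w k\<close>
      and agree with it in all later degrees, contradicting maximality.\<close>
    have "e + frag_cmul s (b k) \<notin> supp y" if "s > 0" for s
    proof
      assume *: "e + frag_cmul s (b k) \<in> supp y"
      have "lt ?\<pi> (e + frag_cmul s (b k))"
        unfolding lt_def
      proof (intro exI[of _ N] conjI allI impI)
        show "w (ks ! N) ?\<pi> < w (ks ! N) (e + frag_cmul s (b k))"
          using that tk d_pos[OF k] k by (simp add: e_def w_linear w_comb w_b flip: k_def)
        show "w (ks ! M) ?\<pi> = w (ks ! M) (e + frag_cmul s (b k))" if "N < M \<and> M < n" for M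
          using that t(2)[of M] k ks_nth[of M] ks_inject[of M N] N
          by (simp add: e_def w_linear w_comb w_b k_def)
      qed (rule N)
      with * show False
        using max by blast
    qed
    then obtain t0 where t0: "t0 \<ge> pos (- lookup e k)" "e - frag_cmul t0 (b k) \<in> supp y"
      using S_line_width[OF k U_S[OF y k], of e] t(3) unfolding e_def by blast
    \<comment> \<open>Row \<open>k\<close> has nonnegative entries in the columns already walked,
      and these steps were long enough. So the k-th coordinate of \<open>e\<close> has dropped to at
      most that of \<open>a\<close>, and the width forced at \<open>e\<close> is at least the one
      wanted.\<close>
    have "(\<Sum>j\<in>I. neg_part a j * pos (B k j)) \<le> (\<Sum>j\<in>I. t j * B k j)"
    proof (rule sum_mono)
      fix j assume "j \<in> I"
      then obtain M where M: "M < n" "j = ks ! M"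
        using ks_index by blast
      show "neg_part a j * pos (B k j) \<le> t j * B k j"
      proof (cases "M < N")
        case True
        then show ?thesis
          using B_ks_nonneg[of M N] t(1)[of M] M N by (auto simp: k_def intro!: mult_right_mono)
      next
        case False
        then show ?thesis
          using pos_B_ks[of N M] t(2)[of M] M by (simp add: k_def)
      qed
    qed
    then have "lookup e k \<le> lookup a k"
      using I_le_m[OF k] a by (simp add: e_def lookup_minus lookup_comb lookup_lead_exp)
    then have le: "neg_part a k \<le> t0"
      using t0(1) by (auto simp: max_def split: if_splits)
    have "comb (t(k := t0)) = comb t + frag_cmul t0 (b k)"
      using comb_update[OF k, of t t0] tk by simp
    then have "?\<pi> - comb (t(k := t0)) \<in> supp y"
      using t0(2) by (simp add: e_def diff_diff_eq)
    moreover have "neg_part a (ks ! M) \<le> (t(k := t0)) (ks ! M)" if "M < Suc N" for M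
      using that t(1)[of M] le by (cases "M = N") (auto simp: k_def)
    moreover have "(t(k := t0)) (ks ! M) = 0" if "Suc N \<le> M" "M < n" for M
      using that t(2)[of M] ks_inject[of M N] N by (simp add: k_def)
    ultimately show ?case
      by blast
  qed
  from this[OF order.refl] show ?thesis
    unfolding ball_ks by blast
qed

text \<open>Order convexity: with two points that differ by a nonnegative combination of columns,
  the whole parallelepiped between them is contained.\<close>

definition comb_convex :: "ivec set \<Rightarrow> bool" where
  "comb_convex A \<longleftrightarrow> (\<forall>e\<in>A. \<forall>t c. e - comb t \<in> A \<longrightarrow> (\<forall>k\<in>I. 0 \<le> c k \<and> c k \<le> t k) \<longrightarrow> e - comb c \<in> A)"

text \<open>\<open>D\<close> loses its \<open>lt\<close>-maximal exponent at each step while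
  \<open>A\<close> stays fixed. The box of the subtracted E_a lies in \<open>A\<close>, and its
  points other than the top are below the maximum, hence in the \<open>lt\<close>-closed set
  \<open>D\<close>. The conclusion also records the far corner of each box used, which is what
  triangularity needs.\<close>

lemma span_of_support:
  assumes A: "comb_convex A" "A \<subseteq> Z" and fin: "finite D" and "D \<subseteq> A"
    and "\<And>e f. e \<in> D \<Longrightarrow> f \<in> A \<Longrightarrow> lt f e \<Longrightarrow> f \<in> D" and "y \<in> U" "supp y \<subseteq> D"
  shows "y \<in> span (E ` {a \<in> Z. lead_exp a \<in> D \<and> lead_exp a - comb (neg_part a) \<in> A})"
  using fin assms(4-)
proof (induction D arbitrary: y rule: finite_psubset_induct)
  case (psubset D)
  have yT: "y \<in> torus_span"
    using psubset.prems U_torus by blast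
  show ?case
  proof (cases "D = {}")
    case True
    then show ?thesis
      using psubset.prems supp_empty[OF yT] by (simp add: span_zero)
  next
    case False
    obtain e where e: "e \<in> D" "\<And>f. f \<in> D \<Longrightarrow> \<not> lt e f"
    proof -
      have "asymp_on D lt" "transp_on D lt"
        using lt_trans by (auto intro!: asymp_onI transp_onI) (use lt_irrefl lt_trans in blast)
      then show ?thesis
        using Finite_Set.bex_max_element[OF psubset.hyps(1) _ _ False, of lt] that lt_irrefl by metis
    qed
    let ?D = "D - {e}"
    have down: "f \<in> ?D" if "g \<in> ?D" "f \<in> A" "lt f g" for f g
      using that psubset.prems(2) e(2) by blast
    have IH: "z \<in> span (E ` {a \<in> Z. lead_exp a \<in> D \<and> lead_exp a - comb (neg_part a) \<in> A})"
      if "z \<in> U" "supp z \<subseteq> ?D" for z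
    proof -
      have "z \<in> span (E ` {a \<in> Z. lead_exp a \<in> ?D \<and> lead_exp a - comb (neg_part a) \<in> A})"
      proof (rule psubset.IH)
        show "?D \<subset> D" "?D \<subseteq> A"
          using e(1) psubset.prems(1) by auto
        show "f \<in> ?D" if "g \<in> ?D" "f \<in> A" "lt f g" for f g
          using down that by blast
      qed (rule that)+
      then show ?thesis
        by (rule rev_subsetD) (intro span_mono, auto)
    qed
    show ?thesis
    proof (cases "e \<in> supp y")
      case False
      then show ?thesis
        using IH[of y] psubset.prems by blast
    next
      case True
      have "e \<in> Z"
        using True supp_subset[OF yT] by blast
      then obtain a where a: "a \<in> Z" "lead_exp a = e"
        using lead_exp_surj by blast
      then obtain t where t: "\<forall>k\<in>I. neg_part a k \<le> t k" "e - comb t \<in> supp y"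
        using vertex_walk[of y a] True psubset.prems(3,4) e(2) by blast
      \<comment> \<open>The end of the vertex walk lies in \<open>A\<close> at or beyond the far
        corner of the box, so convexity puts the whole box into \<open>A\<close>.\<close>
      have inA: "e - comb c \<in> A" if "\<forall>k\<in>I. 0 \<le> c k \<and> c k \<le> neg_part a k" for c
        using A(1) t that e(1) psubset.prems(1,4) unfolding comb_convex_def
        by (meson order_trans subset_iff)
      have Ea: "E a \<in> torus_span" "E a \<in> U"
        using E_U[OF a(1)] U_torus by auto
      have "supp (E a) \<subseteq> D"
      proof
        fix f assume "f \<in> supp (E a)"
        then obtain c where c: "f = e - comb c" "\<forall>k\<in>I. 0 \<le> c k \<and> c k \<le> neg_part a k"
          using E_supp[OF a(1)] a(2) unfolding below_def by blast
        show "f \<in> D"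
        proof (cases "comb c = 0")
          case True
          then show ?thesis
            using e(1) c by simp
        next
          case False
          then show ?thesis
            using inA[OF c(2)] c lt_comb[of c e] psubset.prems(2)[OF e(1)] by blast
        qed
      qed
      moreover define z where "z = y - sc (cf y e) (E a)"
      have "cf z e = 0"
        using E_lead[OF a(1)] a(2) Ea yT by (simp add: z_def cf_diff cf_scale)
      moreover have "supp z \<subseteq> supp y \<union> supp (E a)"
        using supp_diff[OF yT, of "sc (cf y e) (E a)"] supp_scale[OF Ea(1)] Ea(1)
        unfolding z_def by blast
      ultimately have "supp z \<subseteq> ?D"
        using psubset.prems(4) by (auto simp: supp_def)
      moreover have "z \<in> U"
        using psubset.prems(3) Ea by (auto simp: z_def intro!: U_closed)
      ultimately have "z \<in> span (E ` {a \<in> Z. lead_exp a \<in> D \<and> lead_exp a - comb (neg_part a) \<in> A})"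
        using IH by blast
      moreover have "E a \<in> E ` {a \<in> Z. lead_exp a \<in> D \<and> lead_exp a - comb (neg_part a) \<in> A}"
        using a e(1) inA[of "neg_part a"] by auto
      ultimately have "z + sc (cf y e) (E a) \<in>
          span (E ` {a \<in> Z. lead_exp a \<in> D \<and> lead_exp a - comb (neg_part a) \<in> A})"
        by (intro span_add span_scale) (auto intro: span_base)
      then show ?thesis
        by (simp add: z_def)
    qed
  qed
qed

lemma finite_combs: "finite {comb c | c. \<forall>k\<in>I. \<bar>c k\<bar> \<le> W}"
proof (rule finite_subset)
  show "{comb c | c. \<forall>k\<in>I. \<bar>c k\<bar> \<le> W} \<subseteq> comb ` (PiE I (\<lambda>_. {- W..W}))"
  proof
    fix e assume "e \<in> {comb c | c. \<forall>k\<in>I. \<bar>c k\<bar> \<le> W}"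
    then obtain c where c: "e = comb c" "\<forall>k\<in>I. \<bar>c k\<bar> \<le> W" by blast
    have "e = comb (restrict c I)"
      unfolding c(1) by (rule comb_cong) simp
    moreover have "restrict c I \<in> PiE I (\<lambda>_. {- W..W})"
      using c(2) by (simp only: restrict_PiE_iff) (simp add: abs_le_iff minus_le_iff)
    ultimately show "e \<in> comb ` (PiE I (\<lambda>_. {- W..W}))" by blast
  qed
qed (auto intro!: finite_PiE)

lemma U_subset_span: "U \<subseteq> span (E ` Z)"
proof
  fix y assume y: "y \<in> U"
  then have yT: "y \<in> torus_span" by (rule U_torus)
  define W where "W = (\<Sum>s\<in>supp y. \<Sum>k\<in>I. \<bar>w k s\<bar>)"
  \<comment> \<open>All exponents congruent to the support modulo the columns, with degrees bounded
    by \<open>W\<close>. The bounds are on linear functions, hence convex, and independence of the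
    columns makes the set finite.\<close>
  define A where "A = {s + comb c | s c. s \<in> supp y \<and> (\<forall>k\<in>I. \<bar>w k (s + comb c)\<bar> \<le> W)}"
  have W: "\<bar>w k s\<bar> \<le> W" if "s \<in> supp y" "k \<in> I" for s k
  proof -
    have "\<bar>w k s\<bar> \<le> (\<Sum>k\<in>I. \<bar>w k s\<bar>)"
      using that by (intro member_le_sum) auto
    also have "\<dots> \<le> W"
      unfolding W_def using that yT by (intro member_le_sum) (auto intro: sum_nonneg)
    finally show ?thesis .
  qed
  have "A \<subseteq> (\<lambda>(s, e). s + e) ` (supp y \<times> {comb c | c. \<forall>k\<in>I. \<bar>c k\<bar> \<le> 2 * W})"
  proof
    fix e assume "e \<in> A"
    then obtain s c where e: "e = s + comb c" "s \<in> supp y" "\<forall>k\<in>I. \<bar>w k (s + comb c)\<bar> \<le> W"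
      unfolding A_def by blast
    have "\<bar>c k\<bar> \<le> 2 * W" if "k \<in> I" for k
    proof -
      \<comment> \<open>\<open>d k\<close> is at least 1, and \<open>c k * d k\<close> is a
        difference of two degrees bounded by \<open>W\<close>; hence the factor 2.\<close>
      have "\<bar>c k\<bar> * 1 \<le> \<bar>c k\<bar> * d k"
        using d_pos[OF that] by (intro mult_left_mono) auto
      also have "\<dots> = \<bar>c k * d k\<bar>"
        using d_pos[OF that] by (simp add: abs_mult)
      also have "\<dots> \<le> 2 * W"
        using e(3) W[OF e(2) that] that by (fastforce simp: w_linear w_comb)
      finally show ?thesis by simp
    qed
    then show "e \<in> (\<lambda>(s, e). s + e) ` (supp y \<times> {comb c | c. \<forall>k\<in>I. \<bar>c k\<bar> \<le> 2 * W})"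
      using e by force
  qed
  then have fin: "finite A"
    by (rule finite_subset) (use yT finite_combs in \<open>auto intro!: finite_imageI finite_cartesian_product\<close>)
  have "comb_convex A"
    unfolding comb_convex_def
  proof (intro ballI allI impI)
    fix e t c
    assume e: "e \<in> A" and et: "e - comb t \<in> A" and c: "\<forall>k\<in>I. 0 \<le> c k \<and> c k \<le> t k"
    obtain s c0 where s: "e = s + comb c0" "s \<in> supp y"
      using e unfolding A_def by blast
    have bound: "\<forall>k\<in>I. \<bar>w k f\<bar> \<le> W" if "f \<in> A" for f
      using that unfolding A_def by blast
    have "\<bar>w k (e - comb c)\<bar> \<le> W" if k: "k \<in> I" for k
    proof -
      have "0 \<le> c k * d k" "c k * d k \<le> t k * d k"
        using c k d_pos[OF k] by (auto intro!: mult_right_mono)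
      then show ?thesis
        using bound[OF e] bound[OF et] k by (fastforce simp: w_linear w_comb)
    qed
    moreover have "e - comb c = s + comb (\<lambda>k. c0 k - c k)"
      by (simp add: s comb_diff)
    ultimately show "e - comb c \<in> A"
      using s(2) unfolding A_def by fastforce
  qed
  moreover have "A \<subseteq> Z"
    using supp_subset[OF yT] by (auto simp: A_def)
  moreover have "supp y \<subseteq> A"
  proof
    fix s assume "s \<in> supp y"
    then show "s \<in> A"
      using W comb_zero[of "\<lambda>_. 0"] unfolding A_def by force
  qed
  ultimately have "y \<in> span (E ` {a \<in> Z. lead_exp a \<in> A \<and> lead_exp a - comb (neg_part a) \<in> A})"
    using fin y by (intro span_of_support) auto
  then show "y \<in> span (E ` Z)"
    by (rule rev_subsetD) (intro span_mono, auto)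
qed

lemma U_eq_span: "U = span (E ` Z)"
proof
  show "span (E ` Z) \<subseteq> U"
    by (rule span_minimal) (auto intro!: E_U subspaceI U_closed)
qed (rule U_subset_span)

text \<open>\<open>A\<close> is the box of E_a, and \<open>D\<close> that box without its top
  vertex. An index a' that is used has both its leading exponent and its far corner in this box. If
  \<open>c\<close> is the nonzero offset of the tops, then c plus the side lengths for a' is bounded
  by those for a, so the total of the latter strictly drops.\<close>

lemma triangular:
  assumes a: "a \<in> Z" and y: "y \<in> U" "supp y \<subseteq> below (lead_exp a) (neg_part a)" "lead_exp a \<notin> supp y"
  shows "y \<in> span (E ` {a' \<in> Z. prec n a' a})"
proof -
  let ?A = "below (lead_exp a) (neg_part a)"
  have "finite ((\<lambda>e. lead_exp a - e) ` {comb c | c. \<forall>k\<in>I. \<bar>c k\<bar> \<le> (\<Sum>k\<in>I. neg_part a k)})"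
    by (intro finite_imageI finite_combs)
  moreover have "?A \<subseteq> (\<lambda>e. lead_exp a - e) ` {comb c | c. \<forall>k\<in>I. \<bar>c k\<bar> \<le> (\<Sum>k\<in>I. neg_part a k)}"
  proof
    fix e assume "e \<in> ?A"
    then obtain c where c: "e = lead_exp a - comb c" "\<forall>k\<in>I. 0 \<le> c k \<and> c k \<le> neg_part a k"
      unfolding below_def by blast
    have "\<bar>c k\<bar> \<le> (\<Sum>k\<in>I. neg_part a k)" if "k \<in> I" for k
      using c(2) that member_le_sum[of k I "neg_part a"] by force
    then show "e \<in> (\<lambda>e. lead_exp a - e) ` {comb c | c. \<forall>k\<in>I. \<bar>c k\<bar> \<le> (\<Sum>k\<in>I. neg_part a k)}"
      using c(1) by blast
  qed
  ultimately have fin: "finite (?A - {lead_exp a})"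
    using finite_subset by blast
  have AZ: "?A \<subseteq> Z"
    using lead_exp_in_Z[OF a] by (auto simp: below_def)
  have convex: "comb_convex ?A"
    unfolding comb_convex_def
  proof (intro ballI allI impI)
    fix e t c
    assume "e \<in> ?A" and "e - comb t \<in> ?A" and c: "\<forall>k\<in>I. 0 \<le> c k \<and> c k \<le> t k"
    then obtain c1 c2 where c1: "e = lead_exp a - comb c1" "\<forall>k\<in>I. 0 \<le> c1 k \<and> c1 k \<le> neg_part a k"
      and c2: "e - comb t = lead_exp a - comb c2" "\<forall>k\<in>I. 0 \<le> c2 k \<and> c2 k \<le> neg_part a k"
      unfolding below_def by blast
    have "comb (\<lambda>k. c1 k + t k) = comb c2"
      using c2(1) unfolding c1(1) comb_add by (rule diff_diff_eq_imp)
    then have sum: "c1 k + t k = c2 k" if "k \<in> I" for k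
      using comb_inject that by metis
    have "e - comb c = lead_exp a - comb (\<lambda>k. c1 k + c k)"
      by (simp add: c1(1) comb_add algebra_simps)
    also have "\<dots> \<in> ?A"
    proof (rule belowI)
      fix k assume k: "k \<in> I"
      have "0 \<le> c k" "c k \<le> t k" "0 \<le> c1 k" "c2 k \<le> neg_part a k"
        using k c c1(2) c2(2) by blast+
      then show "0 \<le> c1 k + c k \<and> c1 k + c k \<le> neg_part a k"
        using sum[OF k] by linarith
    qed
    finally show "e - comb c \<in> ?A" .
  qed
  have "f \<in> ?A - {lead_exp a}" if ef: "e \<in> ?A - {lead_exp a}" "f \<in> ?A" "lt f e" for e f
  proof -
    obtain c where c: "e = lead_exp a - comb c" "\<forall>k\<in>I. 0 \<le> c k"
      using ef(1) unfolding below_def by blast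
    then have "comb c \<noteq> 0"
      using ef(1) by auto
    then have "lt e (lead_exp a)"
      using lt_comb[of c] c by blast
    then show ?thesis
      using ef lt_trans lt_irrefl by blast
  qed
  then have "y \<in> span (E ` {a' \<in> Z. lead_exp a' \<in> ?A - {lead_exp a} \<and> lead_exp a' - comb (neg_part a') \<in> ?A})"
    using y by (intro span_of_support[OF convex AZ fin]) auto
  moreover have "prec n a' a" if a': "lead_exp a' \<in> ?A - {lead_exp a}" "lead_exp a' - comb (neg_part a') \<in> ?A" for a'
  proof -
    obtain c where c: "lead_exp a' = lead_exp a - comb c" "\<forall>k\<in>I. 0 \<le> c k"
      using a'(1) unfolding below_def by blast
    obtain c2 where c2: "lead_exp a' - comb (neg_part a') = lead_exp a - comb c2" "\<forall>k\<in>I. c2 k \<le> neg_part a k"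
      using a'(2) unfolding below_def by blast
    have "comb (\<lambda>k. c k + neg_part a' k) = comb c2"
      using c2(1) unfolding c(1) comb_add by (rule diff_diff_eq_imp)
    then have sum: "c k + neg_part a' k = c2 k" if "k \<in> I" for k
      using comb_inject that by metis
    have "comb c \<noteq> 0"
      using c(1) a'(1) by auto
    then obtain k where "k \<in> I" "c k \<noteq> 0"
      using comb_zero by blast
    have le: "neg_part a' k \<le> neg_part a k - c k" "0 \<le> c k" if "k \<in> I" for k
    proof -
      have "0 \<le> c k" "c2 k \<le> neg_part a k"
        using that c(2) c2(2) by blast+
      then show "neg_part a' k \<le> neg_part a k - c k" "0 \<le> c k"
        using sum[OF that] by linarith+
    qed
    have "(\<Sum>k\<in>I. neg_part a' k) < (\<Sum>k\<in>I. neg_part a k)"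
    proof (rule sum_strict_mono_ex1)
      show "\<forall>k\<in>I. neg_part a' k \<le> neg_part a k"
      proof
        fix k assume "k \<in> I"
        then show "neg_part a' k \<le> neg_part a k"
          using le[of k] by linarith
      qed
      show "\<exists>k\<in>I. neg_part a' k < neg_part a k"
        using le[OF \<open>k \<in> I\<close>] \<open>c k \<noteq> 0\<close> by (intro bexI[OF _ \<open>k \<in> I\<close>]) linarith
    qed simp
    then show ?thesis
      by (simp add: prec_def neg_total_def)
  qed
  then have "{a' \<in> Z. lead_exp a' \<in> ?A - {lead_exp a} \<and> lead_exp a' - comb (neg_part a') \<in> ?A} \<subseteq>
      {a' \<in> Z. prec n a' a}"
    by blast
  ultimately show ?thesis
    using span_mono[OF image_mono] by blast
qed

text \<open>An \<open>lt\<close>-maximal leading exponent among the nonzero terms occurs in one of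
  them only: leading exponents are distinct, and every other point of a box lies below its
  top.\<close>

lemma E_independent:
  assumes A: "finite A" "A \<subseteq> Z" "(\<Sum>a\<in>A. sc (c a) (E a)) = 0" and "a0 \<in> A"
  shows "c a0 = 0"
proof (rule ccontr)
  assume "c a0 \<noteq> 0"
  define A' where "A' = {a \<in> A. c a \<noteq> 0}"
  have A': "finite A'" "A' \<subseteq> Z" "A' \<noteq> {}"
    using assms \<open>c a0 \<noteq> 0\<close> by (auto simp: A'_def)
  obtain a where a: "a \<in> A'" "\<And>a'. a' \<in> A' \<Longrightarrow> \<not> lt (lead_exp a) (lead_exp a')"
  proof -
    have "asymp_on (lead_exp ` A') lt" "transp_on (lead_exp ` A') lt"
      using lt_trans by (auto intro!: asymp_onI transp_onI) (use lt_irrefl lt_trans in blast)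
    then obtain e where "e \<in> lead_exp ` A'" "\<forall>f\<in>lead_exp ` A'. f \<noteq> e \<longrightarrow> \<not> lt e f"
      using Finite_Set.bex_max_element[OF finite_imageI[OF A'(1)], of lead_exp lt] A'(3) by auto
    then obtain a where "a \<in> A'" "e = lead_exp a" "\<forall>f\<in>lead_exp ` A'. f \<noteq> e \<longrightarrow> \<not> lt e f"
      by blast
    then show ?thesis
      using that[of a] lt_irrefl by force
  qed
  have ET: "E a' \<in> torus_span" if "a' \<in> A'" for a'
    using that A' E_U U_torus by blast
  have other: "cf (E a') (lead_exp a) = 0" if a': "a' \<in> A'" "a' \<noteq> a" for a'
  proof (rule ccontr)
    assume "cf (E a') (lead_exp a) \<noteq> 0"
    then obtain u where u: "lead_exp a = lead_exp a' - comb u" "\<forall>k\<in>I. 0 \<le> u k"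
      using E_supp[of a'] a' A' unfolding below_def supp_def by blast
    have "comb u \<noteq> 0"
      using u(1) lead_exp_inject[of a a'] a' a(1) A'(2) by auto
    then show False
      using lt_comb[of u "lead_exp a'"] u a(2)[OF a'(1)] by simp
  qed
  have "(\<Sum>a\<in>A'. sc (c a) (E a)) = (\<Sum>a\<in>A. sc (c a) (E a))"
    using A(1) by (intro sum.mono_neutral_left) (auto simp: A'_def)
  then have "0 = cf (\<Sum>a\<in>A'. sc (c a) (E a)) (lead_exp a)"
    by (simp add: A(3))
  also have "\<dots> = (\<Sum>a'\<in>A'. c a' * cf (E a') (lead_exp a))"
    using ET by (subst cf_sum) (auto simp: cf_scale)
  also have "\<dots> = (\<Sum>a'\<in>A'. if a' = a then c a else 0)"
    using E_lead a(1) A'(2) other by (intro sum.cong) auto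
  also have "\<dots> = c a"
    using A' a by simp
  finally show False
    using a by (simp add: A'_def)
qed

end

section \<open>Bar-invariant bases from triangular ones\<close>

lemma lookup_bar_laurent [simp]: "lookup (bar_laurent f) k = lookup f (- k)"
  unfolding bar_laurent_def by (simp add: map_key.rep_eq inj_on_def)

lemma bar_laurent_simps [simp]:
  "bar_laurent 1 = 1" "bar_laurent 0 = 0" "bar_laurent (- f) = - bar_laurent f"
  "bar_laurent (single k 1) = single (- k) 1" "bar_laurent (bar_laurent f) = f"
  by (rule poly_mapping_eqI; auto simp: lookup_single lookup_one when_def)+

lemma bar_laurent_add: "bar_laurent (f + g) = bar_laurent f + bar_laurent g"
  by (rule poly_mapping_eqI) (simp add: lookup_add)

lemma v_poly_iff: "f \<in> v_poly \<longleftrightarrow> (\<forall>k\<le>0. lookup f k = 0)"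
  by (auto simp: v_poly_def in_keys_iff subset_iff) (meson not_less zero_less_iff_neq_zero int_one_le_iff_zero_less)

lemma v_poly_closed:
  "0 \<in> v_poly" "f \<in> v_poly \<Longrightarrow> g \<in> v_poly \<Longrightarrow> f + g \<in> v_poly"
  "f \<in> v_poly \<Longrightarrow> - f \<in> v_poly"
  by (auto simp: v_poly_iff lookup_add)

lemma v_poly_mult: "f \<in> v_poly \<Longrightarrow> g \<in> v_poly \<Longrightarrow> f * g \<in> v_poly"
  using keys_mult[of f g] unfolding v_poly_def by fastforce

lemma v_poly_bar_invariant: "f \<in> v_poly \<Longrightarrow> bar_laurent f = f \<Longrightarrow> f = 0"
proof (rule poly_mapping_eqI)
  fix k
  assume f: "f \<in> v_poly" "bar_laurent f = f"
  have "lookup f k = lookup f (- k)"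
    using f(2) by (metis lookup_bar_laurent)
  then show "lookup f k = lookup 0 k"
    using f(1) by (cases "k \<le> 0") (auto simp: v_poly_iff)
qed

text \<open>\<open>g\<close> is the part of positive degree. The constant term of \<open>f\<close>
  equals its own negative, hence vanishes over the integers.\<close>

lemma bar_antisymmetric_split:
  assumes "bar_laurent f = - f"
  obtains g where "g \<in> v_poly" "f = g - bar_laurent g"
proof
  define g where "g = Poly_Mapping.mapp (\<lambda>k c. if k \<ge> 1 then c else 0) f"
  have g: "lookup g k = (if k \<ge> 1 then lookup f k else 0)" for k
    by (auto simp: g_def lookup_mapp when_def in_keys_iff)
  show "g \<in> v_poly"
    by (simp add: v_poly_iff g)
  show "f = g - bar_laurent g"
  proof (rule poly_mapping_eqI)
    fix k
    have "lookup f (- k) = - lookup f k"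
      using arg_cong[OF assms, of "\<lambda>h. lookup h k"] by simp
    then show "lookup f k = lookup (g - bar_laurent g) k"
      by (cases k "0::int" rule: linorder_cases) (auto simp: g lookup_minus)
  qed
qed

locale laurent_module = module scl
  for scl :: "laurent \<Rightarrow> 'f::ab_group_add \<Rightarrow> 'f" (infixr \<open>*l\<close> 75)
begin

text \<open>Independence of the indexed family rather than of its image, so that injectivity is a
  consequence.\<close>

definition family_independent :: "'i set \<Rightarrow> ('i \<Rightarrow> 'f) \<Rightarrow> bool" where
  "family_independent I b \<longleftrightarrow>
     (\<forall>S c. finite S \<longrightarrow> S \<subseteq> I \<longrightarrow> (\<Sum>i\<in>S. c i *l b i) = 0 \<longrightarrow> (\<forall>i\<in>S. c i = 0))"

lemma family_independentD:
  "family_independent I b \<Longrightarrow> finite S \<Longrightarrow> S \<subseteq> I \<Longrightarrow> (\<Sum>i\<in>S. c i *l b i) = 0 \<Longrightarrow> i \<in> S \<Longrightarrow> c i = 0"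
  unfolding family_independent_def by blast

lemma family_independent_inj:
  assumes "family_independent I b"
  shows "inj_on b I"
proof (rule inj_onI, rule ccontr)
  fix i j assume ij: "i \<in> I" "j \<in> I" "b i = b j" "i \<noteq> j"
  have "(\<Sum>k\<in>{i, j}. (if k = i then 1 else - 1) *l b k) = 0"
    using ij by simp
  then have "(if i = i then 1 else - 1) = (0::laurent)"
    by (rule family_independentD[OF assms(1), rotated 2]) (use ij in auto)
  then show False
    by simp
qed

lemma family_independent_basis:
  assumes "family_independent I b"
  shows "inj_on b I \<and> \<not> dependent (b ` I)"
proof
  show inj: "inj_on b I"
    using assms by (rule family_independent_inj)
  show "\<not> dependent (b ` I)"
    unfolding dependent_explicit
  proof clarify
    fix T u v
    assume T: "finite T" "T \<subseteq> b ` I" "(\<Sum>v\<in>T. u v *l v) = 0" "v \<in> T" "u v \<noteq> 0"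
    then obtain S where S: "S \<subseteq> I" "T = b ` S"
      by (auto simp: subset_image_iff)
    have injS: "inj_on b S"
      using inj S(1) by (rule inj_on_subset)
    have "finite S" "(\<Sum>i\<in>S. u (b i) *l b i) = 0"
      using T S injS by (auto simp: finite_image_iff sum.reindex)
    then show False
      using family_independentD[OF assms(1) _ S(1), of "\<lambda>i. u (b i)"] T(4,5) S(2) by auto
  qed
qed

text \<open>With coefficients extended by zero, two combinations can be written over a common index
  set.\<close>

lemma combinations_eq:
  assumes "0 \<in> P"
  shows "x \<in> combinations (*l) P I b \<longleftrightarrow>
    (\<exists>S c. finite S \<and> S \<subseteq> I \<and> (\<forall>i. c i \<in> P) \<and> (\<forall>i. i \<notin> S \<longrightarrow> c i = 0) \<and> x = (\<Sum>i\<in>S. c i *l b i))"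
proof
  assume "x \<in> combinations (*l) P I b"
  then obtain S c where "x = (\<Sum>i\<in>S. c i *l b i)" "finite S" "S \<subseteq> I" "\<forall>i\<in>S. c i \<in> P"
    unfolding combinations_def by blast
  then show "\<exists>S c. finite S \<and> S \<subseteq> I \<and> (\<forall>i. c i \<in> P) \<and> (\<forall>i. i \<notin> S \<longrightarrow> c i = 0) \<and> x = (\<Sum>i\<in>S. c i *l b i)"
    using assms by (intro exI[of _ S] exI[of _ "\<lambda>i. if i \<in> S then c i else 0"]) auto
qed (auto simp: combinations_def)

lemma combinations_zero: "0 \<in> combinations (*l) P I b"
  unfolding combinations_def by (rule CollectI, rule exI[of _ "{}"]) auto

lemma combinations_base: "i \<in> I \<Longrightarrow> c \<in> P \<Longrightarrow> c *l b i \<in> combinations (*l) P I b"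
  unfolding combinations_def by (rule CollectI, rule exI[of _ "{i}"], rule exI[of _ "\<lambda>_. c"]) auto

lemma combinations_add:
  assumes P: "0 \<in> P" "\<And>c c'. c \<in> P \<Longrightarrow> c' \<in> P \<Longrightarrow> c + c' \<in> P"
    and x: "x \<in> combinations (*l) P I b" and y: "y \<in> combinations (*l) P I b"
  shows "x + y \<in> combinations (*l) P I b"
proof -
  obtain S c where S: "finite S" "S \<subseteq> I" "\<And>i. c i \<in> P" "\<And>i. i \<notin> S \<Longrightarrow> c i = 0" "x = (\<Sum>i\<in>S. c i *l b i)"
    using x unfolding combinations_eq[OF P(1)] by blast
  obtain S' c' where S': "finite S'" "S' \<subseteq> I" "\<And>i. c' i \<in> P" "\<And>i. i \<notin> S' \<Longrightarrow> c' i = 0" "y = (\<Sum>i\<in>S'. c' i *l b i)"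
    using y unfolding combinations_eq[OF P(1)] by blast
  have "x = (\<Sum>i\<in>S \<union> S'. c i *l b i)"
    unfolding S(5) using S(1,4) S'(1) by (intro sum.mono_neutral_left) auto
  moreover have "y = (\<Sum>i\<in>S \<union> S'. c' i *l b i)"
    unfolding S'(5) using S'(1,4) S(1) by (intro sum.mono_neutral_left) auto
  ultimately have "x + y = (\<Sum>i\<in>S \<union> S'. (c i + c' i) *l b i)"
    by (simp add: scale_left_distrib sum.distrib)
  then show ?thesis
    using S(1-3) S'(1-3) P(2) unfolding combinations_def
    by (intro CollectI exI[of _ "S \<union> S'"] exI[of _ "\<lambda>i. c i + c' i"]) auto
qed

lemma combinations_sum:
  assumes "0 \<in> P" "\<And>c c'. c \<in> P \<Longrightarrow> c' \<in> P \<Longrightarrow> c + c' \<in> P"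
    and "\<And>s. s \<in> S \<Longrightarrow> f s \<in> combinations (*l) P I b"
  shows "sum f S \<in> combinations (*l) P I b"
  using assms(3)
  by (induction S rule: infinite_finite_induct) (auto simp: combinations_zero intro!: combinations_add assms(1,2))

lemma combinations_scale:
  assumes "\<And>c. c \<in> P \<Longrightarrow> a * c \<in> P'" "x \<in> combinations (*l) P I b"
  shows "a *l x \<in> combinations (*l) P' I b"
proof -
  obtain S c where "x = (\<Sum>i\<in>S. c i *l b i)" "finite S" "S \<subseteq> I" "\<forall>i\<in>S. c i \<in> P"
    using assms(2) unfolding combinations_def by blast
  then show ?thesis
    using assms(1) unfolding combinations_def
    by (intro CollectI exI[of _ S] exI[of _ "\<lambda>i. a * c i"]) (auto simp: scale_sum_right)
qed

lemma combinations_mono: "P \<subseteq> P' \<Longrightarrow> I \<subseteq> I' \<Longrightarrow> combinations (*l) P I b \<subseteq> combinations (*l) P' I' b"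
  unfolding combinations_def by blast

lemma combinations_span: "combinations (*l) P I b \<subseteq> span (b ` I)"
  unfolding combinations_def by (auto intro!: span_sum span_scale intro: span_base)

lemma combinations_UNIV: "combinations (*l) UNIV I b = span (b ` I)"
proof
  show "combinations (*l) UNIV I b \<subseteq> span (b ` I)"
    by (rule combinations_span)
  have "b i \<in> combinations (*l) UNIV I b" if "i \<in> I" for i
    using combinations_base[OF that, of 1 UNIV] by simp
  then show "span (b ` I) \<subseteq> combinations (*l) UNIV I b"
    by (intro span_minimal subspaceI)
      (auto intro: combinations_zero combinations_add combinations_scale)
qed

end

text \<open>The setting of Lusztig's lemma with a numerical rank. Infinitely many indices may have
  smaller rank, but each element of a span involves finitely many, so induction on rank
  suffices.\<close>

locale bar_triangular_family = laurent_module scl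
  for scl :: "laurent \<Rightarrow> 'f::ab_group_add \<Rightarrow> 'f" (infixr \<open>*l\<close> 75) +
  fixes I :: "'i set" and E :: "'i \<Rightarrow> 'f" and rk :: "'i \<Rightarrow> nat" and br :: "'f \<Rightarrow> 'f"
  assumes independent: "family_independent I E"
    and br_add: "x \<in> span (E ` I) \<Longrightarrow> y \<in> span (E ` I) \<Longrightarrow> br (x + y) = br x + br y"
    and br_scale: "x \<in> span (E ` I) \<Longrightarrow> br (c *l x) = bar_laurent c *l br x"
    and br_br: "x \<in> span (E ` I) \<Longrightarrow> br (br x) = x"
    and br_triangular: "i \<in> I \<Longrightarrow> br (E i) - E i \<in> span (E ` {j \<in> I. rk j < rk i})"
begin

section \<open>Lusztig's lemma\<close>

abbreviation M :: "'f set" where "M \<equiv> span (E ` I)"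

abbreviation lower :: "nat \<Rightarrow> 'f set" where "lower r \<equiv> span (E ` {j \<in> I. rk j < r})"

lemma lower_mono: "r \<le> s \<Longrightarrow> lower r \<subseteq> lower s"
  by (intro span_mono image_mono) auto

lemma lower_M: "lower r \<subseteq> M"
  by (intro span_mono image_mono) auto

lemma E_M: "i \<in> I \<Longrightarrow> E i \<in> M"
  by (intro span_base) auto

lemma lower_diff_M:
  assumes "x - E i \<in> lower r" "i \<in> I"
  shows "x \<in> M"
proof -
  have "(x - E i) + E i \<in> M"
    using assms lower_M E_M by (intro span_add) auto
  then show ?thesis by simp
qed

lemma top_coefficient:
  assumes S: "finite S" "S \<subseteq> I" and x: "x \<in> lower r" and zero: "(\<Sum>j\<in>S. c j *l E j) + x = 0"
    and i: "i \<in> S" "r \<le> rk i"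
  shows "c i = 0"
proof -
  obtain T u where T: "finite T" "T \<subseteq> {j \<in> I. rk j < r}" "\<And>j. j \<notin> T \<Longrightarrow> u j = 0" "x = (\<Sum>j\<in>T. u j *l E j)"
    using x unfolding combinations_UNIV[symmetric] combinations_eq[OF UNIV_I] by blast
  define c' where "c' j = (if j \<in> S then c j else 0)" for j
  have "(\<Sum>j\<in>S \<union> T. c' j *l E j) = (\<Sum>j\<in>S. c j *l E j)"
    using S T by (intro sum.mono_neutral_cong_right) (auto simp: c'_def)
  moreover have "(\<Sum>j\<in>S \<union> T. u j *l E j) = x"
    unfolding T(4) using S T by (intro sum.mono_neutral_right) auto
  ultimately have "(\<Sum>j\<in>S \<union> T. (c' j + u j) *l E j) = 0"
    using zero by (simp add: scale_left_distrib sum.distrib)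
  then have "c' i + u i = 0"
    by (rule family_independentD[OF independent, rotated 2]) (use S T i in auto)
  moreover have "u i = 0"
    using T i(2) by (intro T(3)) auto
  ultimately show ?thesis
    using i by (simp add: c'_def)
qed

lemma unitriangular_independent:
  assumes J: "J \<subseteq> I" and C: "\<And>j. j \<in> J \<Longrightarrow> C j - E j \<in> lower (rk j)"
  shows "family_independent J C"
  unfolding family_independent_def
proof (intro allI impI ballI, rule ccontr)
  fix S c i
  assume S: "finite S" "S \<subseteq> J" "(\<Sum>i\<in>S. c i *l C i) = 0" and i: "i \<in> S" "c i \<noteq> 0"
  define S' where "S' = {j \<in> S. c j \<noteq> 0}"
  define r where "r = Max (rk ` S')"
  have S': "finite S'" "S' \<subseteq> J" "S' \<noteq> {}"
    using S i by (auto simp: S'_def)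
  have "r \<in> rk ` S'"
    unfolding r_def using S' by (intro Max_in) auto
  then obtain j where j: "j \<in> S'" "r = rk j" by blast
  have le: "rk k \<le> r" if "k \<in> S'" for k
    using that S' by (simp add: r_def)
  have "(\<Sum>k\<in>S'. c k *l C k) = (\<Sum>k\<in>S. c k *l C k)"
    using S(1) by (intro sum.mono_neutral_left) (auto simp: S'_def)
  then have "(\<Sum>k\<in>S'. c k *l E k) + (\<Sum>k\<in>S'. c k *l (C k - E k)) = 0"
    using S(3) by (simp add: scale_right_diff_distrib sum_subtractf)
  moreover have "(\<Sum>k\<in>S'. c k *l (C k - E k)) \<in> lower r"
    using C S' lower_mono[OF le] by (intro span_sum span_scale) blast
  ultimately have "c j = 0"
    using S' J j by (intro top_coefficient[of S' _ r c j]) auto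
  then show False
    using j by (simp add: S'_def)
qed

lemma E_in_span_unitriangular:
  assumes C: "\<And>j. j \<in> I \<Longrightarrow> rk j < r \<Longrightarrow> C j - E j \<in> lower (rk j)"
  shows "i \<in> I \<Longrightarrow> rk i < r \<Longrightarrow> E i \<in> span (C ` {j \<in> I. rk j < r})"
proof (induction "rk i" arbitrary: i rule: less_induct)
  case less
  have "lower (rk i) \<subseteq> span (C ` {j \<in> I. rk j < r})"
    using less by (intro span_minimal) auto
  then have "C i - E i \<in> span (C ` {j \<in> I. rk j < r})"
    using C less by blast
  moreover have "C i \<in> span (C ` {j \<in> I. rk j < r})"
    using less by (intro span_base) auto
  ultimately have "C i - (C i - E i) \<in> span (C ` {j \<in> I. rk j < r})"
    by (rule span_diff[rotated])
  then show ?case by simp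
qed

lemma br_zero: "br 0 = 0"
  using br_add[of 0 0] span_zero by simp

lemma br_sum: "(\<And>j. j \<in> S \<Longrightarrow> f j \<in> M) \<Longrightarrow> br (\<Sum>j\<in>S. f j) = (\<Sum>j\<in>S. br (f j))"
  by (induction S rule: infinite_finite_induct) (auto simp: br_zero br_add span_sum)

lemma br_diff: "x \<in> M \<Longrightarrow> y \<in> M \<Longrightarrow> br (x - y) = br x - br y"
  using br_add[of "x - y" y] by (simp add: span_diff algebra_simps)

lemma br_E_M: "i \<in> I \<Longrightarrow> br (E i) \<in> M"
  using lower_diff_M[OF br_triangular] by blast

text \<open>The defect of \<open>E i\<close> is expanded in the invariant elements of smaller rank.
  Applying the involution twice makes its coefficients antisymmetric, so each is g minus its bar
  conjugate, and adding the sum of the g C_j removes the defect.\<close>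

lemma exists_bar_invariant:
  "i \<in> I \<Longrightarrow> \<exists>C. br C = C \<and> C - E i \<in> combinations (*l) v_poly {j \<in> I. rk j < rk i} E"
proof (induction "rk i" arbitrary: i rule: less_induct)
  case less
  let ?J = "{j \<in> I. rk j < rk i}"
  have "\<forall>j\<in>?J. \<exists>C. br C = C \<and> C - E j \<in> combinations (*l) v_poly {k \<in> I. rk k < rk j} E"
    using less by blast
  from bchoice[OF this] obtain C where "\<forall>j\<in>?J. br (C j) = C j \<and>
      C j - E j \<in> combinations (*l) v_poly {k \<in> I. rk k < rk j} E" ..
  then have C: "br (C j) = C j" "C j - E j \<in> combinations (*l) v_poly {k \<in> I. rk k < rk j} E"
    if "j \<in> ?J" for j
    using that by blast+
  have Clow: "C j - E j \<in> lower (rk j)" if "j \<in> ?J" for j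
    using C(2)[OF that] by (rule subsetD[OF combinations_span])
  have CM: "C j \<in> M" if "j \<in> ?J" for j
    using lower_diff_M[OF Clow[OF that]] that by blast
  have indep: "family_independent ?J C"
    by (rule unitriangular_independent) (use Clow in auto)
  have "lower (rk i) \<subseteq> span (C ` ?J)"
    by (rule span_minimal) (use E_in_span_unitriangular[of "rk i" C] Clow in auto)
  then have "br (E i) - E i \<in> combinations (*l) UNIV ?J C"
    using br_triangular[OF less.prems] unfolding combinations_UNIV by (rule subsetD)
  then obtain S f where S: "finite S" "S \<subseteq> ?J" and f: "br (E i) - E i = (\<Sum>j\<in>S. f j *l C j)"
    unfolding combinations_def by blast
  have SM: "C j \<in> M" "br (C j) = C j" if "j \<in> S" for j
    using that S CM C by auto
  have "br (br (E i) - E i) = (\<Sum>j\<in>S. bar_laurent (f j) *l C j)"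
    unfolding f by (subst br_sum) (auto simp: SM span_scale br_scale intro!: sum.cong)
  moreover have "br (br (E i) - E i) = - (br (E i) - E i)"
    using less.prems by (simp add: br_diff br_br br_E_M E_M)
  ultimately have "(\<Sum>j\<in>S. bar_laurent (f j) *l C j) = - (\<Sum>j\<in>S. f j *l C j)"
    unfolding f by simp
  then have "(\<Sum>j\<in>S. (f j + bar_laurent (f j)) *l C j) = 0"
    by (simp add: scale_left_distrib sum.distrib)
  then have "f j + bar_laurent (f j) = 0" if "j \<in> S" for j
    using family_independentD[OF indep S, of "\<lambda>j. f j + bar_laurent (f j)"] that by blast
  then have "\<forall>j\<in>S. \<exists>g. g \<in> v_poly \<and> f j = g - bar_laurent g"
    using bar_antisymmetric_split by (metis add.commute eq_neg_iff_add_eq_0)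
  from bchoice[OF this] obtain g where g: "\<And>j. j \<in> S \<Longrightarrow> g j \<in> v_poly"
      "\<And>j. j \<in> S \<Longrightarrow> f j = g j - bar_laurent (g j)"
    by blast
  let ?C = "E i + (\<Sum>j\<in>S. g j *l C j)"
  have "br ?C = br (E i) + (\<Sum>j\<in>S. bar_laurent (g j) *l C j)"
    using less.prems by (simp add: br_add br_sum br_scale E_M SM span_sum span_scale)
  also have "\<dots> = E i + (\<Sum>j\<in>S. f j *l C j) + (\<Sum>j\<in>S. bar_laurent (g j) *l C j)"
    using f by (simp add: algebra_simps)
  also have "\<dots> = ?C"
    using g by (simp add: scale_left_diff_distrib sum_subtractf)
  finally have "br ?C = ?C" .
  moreover have "g j *l C j \<in> combinations (*l) v_poly ?J E" if "j \<in> S" for j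
  proof -
    have j: "j \<in> ?J" "{k \<in> I. rk k < rk j} \<subseteq> ?J"
      using that S by auto
    \<comment> \<open>Passing from \<open>C j\<close> back to the family \<open>E\<close> keeps
      coefficients in vZ[v], which is closed under products.\<close>
    have "g j *l (C j - E j) \<in> combinations (*l) v_poly ?J E"
      using C(2)[OF j(1)] combinations_mono[OF order.refl j(2)] g(1)[OF that]
      by (intro combinations_scale[of v_poly]) (auto intro: v_poly_mult)
    moreover have "g j *l E j \<in> combinations (*l) v_poly ?J E"
      using j g(1)[OF that] by (intro combinations_base)
    ultimately have "g j *l (C j - E j) + g j *l E j \<in> combinations (*l) v_poly ?J E"
      by (intro combinations_add v_poly_closed)
    then show ?thesis
      by (simp add: scale_right_diff_distrib)
  qed
  then have "?C - E i \<in> combinations (*l) v_poly ?J E"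
    by (simp add: combinations_sum v_poly_closed)
  ultimately show ?case by blast
qed

text \<open>Triangularity makes the coefficients of top rank bar-invariant, and vZ[v] contains no
  nonzero bar-invariant element. This gives uniqueness.\<close>

lemma bar_invariant_v_combination:
  assumes z: "z \<in> combinations (*l) v_poly I E" and "br z = z"
  shows "z = 0"
proof -
  obtain S c where S: "finite S" "S \<subseteq> I" "\<And>i. c i \<in> v_poly" "z = (\<Sum>i\<in>S. c i *l E i)"
    using z unfolding combinations_eq[OF v_poly_closed(1)] by blast
  define S' where "S' = {j \<in> S. c j \<noteq> 0}"
  have S': "finite S'" "S' \<subseteq> I" "z = (\<Sum>i\<in>S'. c i *l E i)"
    using S by (auto simp: S'_def intro!: sum.mono_neutral_right)
  have "S' = {}"
  proof (rule ccontr)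
    assume ne: "S' \<noteq> {}"
    define r where "r = Max (rk ` S')"
    have "r \<in> rk ` S'"
      unfolding r_def using S' ne by (intro Max_in) auto
    then obtain i where i: "i \<in> S'" "r = rk i" by blast
    have le: "rk k \<le> r" if "k \<in> S'" for k
      using that S' by (simp add: r_def)
    have "br z = (\<Sum>j\<in>S'. bar_laurent (c j) *l br (E j))"
      unfolding S'(3) using S'(2) by (subst br_sum) (auto simp: E_M span_scale br_scale intro!: sum.cong)
    then have "(\<Sum>j\<in>S'. bar_laurent (c j) *l E j) + (\<Sum>j\<in>S'. bar_laurent (c j) *l (br (E j) - E j)) = z"
      using assms(2) by (simp add: scale_right_diff_distrib sum_subtractf)
    then have "(\<Sum>j\<in>S'. (bar_laurent (c j) - c j) *l E j) + (\<Sum>j\<in>S'. bar_laurent (c j) *l (br (E j) - E j)) = 0"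
      using S'(3) by (simp add: scale_left_diff_distrib sum_subtractf algebra_simps)
    moreover have "(\<Sum>j\<in>S'. bar_laurent (c j) *l (br (E j) - E j)) \<in> lower r"
      using br_triangular S'(2) lower_mono[OF le] by (intro span_sum span_scale) blast
    ultimately have "bar_laurent (c i) - c i = 0"
      using S' i by (intro top_coefficient[of S' _ r "\<lambda>j. bar_laurent (c j) - c j" i]) auto
    then have "c i = 0"
      using S(3) v_poly_bar_invariant by simp
    then show False
      using i by (simp add: S'_def)
  qed
  then show ?thesis
    using S' by simp
qed

lemma family_basis_E: "family_basis (*l) I E M"
  unfolding family_basis_def using family_independent_basis[OF independent] by simp

theorem bar_invariant_basis:
  "\<exists>C. family_basis (*l) I C M \<and>
    (\<forall>i\<in>I. br (C i) = C i \<and> C i - E i \<in> combinations (*l) v_poly I E) \<and>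
    (\<forall>C'. (\<forall>i\<in>I. C' i \<in> M \<and> br (C' i) = C' i \<and> C' i - E i \<in> combinations (*l) v_poly I E) \<longrightarrow>
      (\<forall>i\<in>I. C' i = C i))"
proof -
  have "\<forall>i\<in>I. \<exists>C. br C = C \<and> C - E i \<in> combinations (*l) v_poly {j \<in> I. rk j < rk i} E"
    using exists_bar_invariant by blast
  from bchoice[OF this] obtain C where C: "\<And>i. i \<in> I \<Longrightarrow> br (C i) = C i"
      "\<And>i. i \<in> I \<Longrightarrow> C i - E i \<in> combinations (*l) v_poly {j \<in> I. rk j < rk i} E"
    by blast
  have Clow: "C i - E i \<in> lower (rk i)" if "i \<in> I" for i
    using C(2)[OF that] by (rule subsetD[OF combinations_span])
  have CI: "C i - E i \<in> combinations (*l) v_poly I E" if "i \<in> I" for i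
    using C(2)[OF that] combinations_mono[of v_poly v_poly "{j \<in> I. rk j < rk i}" I E] by blast
  have CM: "C i \<in> M" if "i \<in> I" for i
    by (rule lower_diff_M[OF Clow[OF that] that])
  have "span (C ` I) = M"
  proof
    show "span (C ` I) \<subseteq> M"
      using CM by (intro span_minimal) auto
    have "E i \<in> span (C ` I)" if "i \<in> I" for i
    proof -
      \<comment> \<open>The auxiliary bound is strict, so the successor is needed to include the
        rank of \<open>i\<close> itself.\<close>
      have "E i \<in> span (C ` {j \<in> I. rk j < Suc (rk i)})"
        using Clow that by (intro E_in_span_unitriangular) auto
      then show ?thesis
        using span_mono[of "C ` {j \<in> I. rk j < Suc (rk i)}" "C ` I"] by blast
    qed
    then show "M \<subseteq> span (C ` I)"
      by (intro span_minimal) auto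
  qed
  moreover have "family_independent I C"
    using Clow by (intro unitriangular_independent) auto
  ultimately have basis: "family_basis (*l) I C M"
    unfolding family_basis_def using family_independent_basis by auto
  have unique: "C' i = C i"
    if i: "i \<in> I" and C': "C' i \<in> M" "br (C' i) = C' i" "C' i - E i \<in> combinations (*l) v_poly I E" for C' i
  proof -
    have "(- 1) *l (C i - E i) \<in> combinations (*l) v_poly I E"
      using CI[OF i] by (rule combinations_scale[rotated]) (auto intro: v_poly_closed)
    then have "(C' i - E i) + (- 1) *l (C i - E i) \<in> combinations (*l) v_poly I E"
      using C'(3) by (intro combinations_add v_poly_closed)
    then have "C' i - C i \<in> combinations (*l) v_poly I E"
      by simp
    moreover have "br (C' i - C i) = C' i - C i"
      using C' C(1)[OF i] CM[OF i] by (simp add: br_diff)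
    ultimately show ?thesis
      using bar_invariant_v_combination by fastforce
  qed
  show ?thesis
    using basis C(1) CI unique by (intro exI[of _ C]) blast
qed

end

section \<open>Sorted enumerations\<close>

text \<open>The list is built from its end by removing an element that may come last. The condition
  refers to subsets because the sign relation used for the exchange matrix is in general not
  transitive.\<close>

lemma sorted_enumeration_exists:
  assumes "finite A"
    and "\<And>A'. A' \<subseteq> A \<Longrightarrow> A' \<noteq> {} \<Longrightarrow> \<exists>x\<in>A'. \<forall>y\<in>A'. y \<noteq> x \<longrightarrow> Q y x"
  shows "\<exists>xs. set xs = A \<and> distinct xs \<and> sorted_wrt Q xs"
  using assms
proof (induction A rule: finite_psubset_induct)
  case (psubset A)
  show ?case
  proof (cases "A = {}")
    case False
    then obtain x where x: "x \<in> A" "\<forall>y\<in>A. y \<noteq> x \<longrightarrow> Q y x"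
      using psubset.prems[of A] by blast
    have "\<exists>xs. set xs = A - {x} \<and> distinct xs \<and> sorted_wrt Q xs"
      using x(1) psubset.prems by (intro psubset.IH) auto
    then obtain xs where "set xs = A - {x}" "distinct xs" "sorted_wrt Q xs"
      by blast
    then show ?thesis
      using x by (intro exI[of _ "xs @ [x]"]) (auto simp: sorted_wrt_append)
  qed simp
qed

lemma sorted_enumeration_unique:
  assumes "antisym r" "set xs = set ys" "distinct xs" "distinct ys"
    "sorted_wrt (\<lambda>i j. (i, j) \<in> r) xs" "sorted_wrt (\<lambda>i j. (i, j) \<in> r) ys"
  shows "xs = ys"
  using assms(2-)
proof (induction xs arbitrary: ys)
  case (Cons x xs)
  then obtain y ys' where ys: "ys = y # ys'"
    by (cases ys) auto
  have "x = y"
  proof (rule ccontr)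
    assume "x \<noteq> y"
    then have "x \<in> set ys'" "y \<in> set xs"
      using Cons.prems(1) ys by auto
    then have "(y, x) \<in> r" "(x, y) \<in> r"
      using Cons.prems ys by auto
    then show False
      using \<open>x \<noteq> y\<close> assms(1) by (auto dest: antisymD)
  qed
  moreover have "xs = ys'"
    using Cons.prems ys \<open>x = y\<close> by (intro Cons.IH) auto
  ultimately show ?case
    using ys by simp
qed simp

lemma increasing_list:
  assumes "finite A" "linear_order_on A r"
  shows "set (increasing_list A r) = A" "distinct (increasing_list A r)"
proof -
  have r: "trans r" "antisym r" "total_on A r"
    using assms(2) by (auto simp: order_on_defs)
  have "\<exists>x\<in>A'. \<forall>y\<in>A'. y \<noteq> x \<longrightarrow> (y, x) \<in> r" if A': "A' \<subseteq> A" "A' \<noteq> {}" for A'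
  proof -
    have "asymp_on A' (\<lambda>x y. (x, y) \<in> r \<and> x \<noteq> y)" "transp_on A' (\<lambda>x y. (x, y) \<in> r \<and> x \<noteq> y)"
      using r(1,2) by (auto intro!: asymp_onI transp_onI dest: antisymD transD)
    then obtain x where "x \<in> A'" "\<forall>y\<in>A'. y \<noteq> x \<longrightarrow> \<not> ((x, y) \<in> r \<and> x \<noteq> y)"
      using Finite_Set.bex_max_element[OF finite_subset[OF A'(1) assms(1)] _ _ A'(2)] by blast
    then show ?thesis
      using r(3) A'(1) by (intro bexI[of _ x]) (auto simp: total_on_def)
  qed
  then have "\<exists>xs. set xs = A \<and> distinct xs \<and> sorted_wrt (\<lambda>i j. (i, j) \<in> r) xs"
    using assms(1) by (intro sorted_enumeration_exists)
  then have "\<exists>!xs. set xs = A \<and> distinct xs \<and> sorted_wrt (\<lambda>i j. (i, j) \<in> r) xs"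
    using sorted_enumeration_unique[OF r(2)] by blast
  from theI'[OF this] show "set (increasing_list A r) = A" "distinct (increasing_list A r)"
    unfolding increasing_list_def by blast+
qed

text \<open>A positive \<open>B y x\<close> is an edge from x to y. An element from which no other
  element of the subset is reachable exists by acyclicity, and it may be placed last.\<close>

lemma acyclic_enumeration:
  assumes "acyclic_seed n B"
  obtains ks where "set ks = {1..n}" "distinct ks" "sorted_wrt (\<lambda>i j. B i j \<le> 0) ks"
proof -
  let ?r = "{(j, i). i \<in> {1..n} \<and> j \<in> {1..n} \<and> B i j > 0}"
  have "\<exists>x\<in>A. \<forall>y\<in>A. y \<noteq> x \<longrightarrow> B y x \<le> 0" if A: "A \<subseteq> {1..n}" "A \<noteq> {}" for A
  proof -
    have irrefl: "(x, x) \<notin> ?r\<^sup>+" for x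
      using assms unfolding acyclic_seed_def acyclic_def by blast
    have "asymp_on A (\<lambda>x y. (x, y) \<in> ?r\<^sup>+)"
      using irrefl trancl_trans[of _ _ ?r] by (intro asymp_onI) blast
    moreover have "transp_on A (\<lambda>x y. (x, y) \<in> ?r\<^sup>+)"
      using trancl_trans[of _ _ ?r] by (intro transp_onI) blast
    ultimately obtain x where x: "x \<in> A" "\<forall>y\<in>A. y \<noteq> x \<longrightarrow> (x, y) \<notin> ?r\<^sup>+"
      using Finite_Set.bex_max_element[OF finite_subset[OF A(1)] _ _ A(2)] by blast
    have "B y x \<le> 0" if "y \<in> A" "y \<noteq> x" for y
    proof (rule ccontr)
      assume "\<not> B y x \<le> 0"
      then have "(x, y) \<in> ?r"
        using that x(1) A(1) by auto
      then show False
        using x(2) that by blast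
    qed
    then show ?thesis
      using x(1) by blast
  qed
  then show ?thesis
    using that sorted_enumeration_exists[of "{1..n}" "\<lambda>i j. B i j \<le> 0"] by blast
qed

section \<open>The initial seed and the bar-involution\<close>

text \<open>Laurent polynomials are formal integer combinations of powers of v, so it suffices to
  reduce to powers in one factor after the other.\<close>

lemma bar_laurent_mult: "bar_laurent (f * g) = bar_laurent f * bar_laurent g"
proof -
  have diff: "bar_laurent (f - g) = bar_laurent f - bar_laurent g" for f g
    by (rule poly_mapping_eqI) (simp add: lookup_minus)
  have *: "bar_laurent (single k 1 * g) = single (- k) 1 * bar_laurent g" for k
  proof (rule frag_induction[where S = UNIV and c = g])
    fix a c :: laurent
    assume "bar_laurent (single k 1 * a) = single (- k) 1 * bar_laurent a"
      "bar_laurent (single k 1 * c) = single (- k) 1 * bar_laurent c"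
    then show "bar_laurent (single k 1 * (a - c)) = single (- k) 1 * bar_laurent (a - c)"
      by (simp add: right_diff_distrib diff)
  qed (simp_all add: mult_single)
  show ?thesis
  proof (rule frag_induction[where S = UNIV and c = f])
    fix a c :: laurent
    assume "bar_laurent (a * g) = bar_laurent a * bar_laurent g"
      "bar_laurent (c * g) = bar_laurent c * bar_laurent g"
    then show "bar_laurent ((a - c) * g) = bar_laurent (a - c) * bar_laurent g"
      by (simp add: left_diff_distrib diff)
  qed (simp_all add: *)
qed

lemma lookup_bar_torus [simp]: "lookup (bar_torus t) e = bar_laurent (lookup t e)"
  by (simp add: bar_torus_def Poly_Mapping.map.rep_eq when_def)

lemma torus_iff: "t \<in> torus m \<longleftrightarrow> (\<forall>e. e \<notin> zlattice m \<longrightarrow> lookup t e = 0)"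
  by (auto simp: torus_def in_keys_iff subset_iff)

lemma torus_add [simp]: "s \<in> torus m \<Longrightarrow> t \<in> torus m \<Longrightarrow> s + t \<in> torus m"
  and torus_zero [simp]: "0 \<in> torus m"
  and torus_single [simp]: "e \<in> zlattice m \<Longrightarrow> single e c \<in> torus m"
  and torus_bar [simp]: "t \<in> torus m \<Longrightarrow> bar_torus t \<in> torus m"
  by (auto simp: torus_iff lookup_add lookup_single when_def)

lemma poly_mapping_expand: "t = (\<Sum>e\<in>keys t. single e (lookup t e))"
  by (rule poly_mapping_eqI)
    (simp add: lookup_sum lookup_single when_def in_keys_iff)

lemma torus_mult_scalar_left: "torus_mult m L (single 0 c) t = (\<Sum>e\<in>keys t. single e (c * lookup t e))"
  and torus_mult_scalar_right: "torus_mult m L t (single 0 c) = (\<Sum>e\<in>keys t. single e (c * lookup t e))"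
  by (cases "c = 0"; simp add: torus_mult_def mult.commute)+

locale initial_qseed =
  fixes m n :: nat and B L :: "nat \<Rightarrow> nat \<Rightarrow> int" and d :: "nat \<Rightarrow> int"
    and emb :: "torus_elem \<Rightarrow> 'f::division_ring" and ord :: "nat rel"
  assumes seed: "quantum_seed m n B d L"
    and frac: "skew_field_of_fractions m L emb"
    and acyclic: "acyclic_seed n B"
    and linear: "linear_order_on {1..n} ord"
begin

definition scal :: "laurent \<Rightarrow> 'f" where "scal c = emb (single 0 c)"
definition X :: "ivec \<Rightarrow> 'f" where "X e = emb (single e 1)"

lemma emb_inj: "s \<in> torus m \<Longrightarrow> t \<in> torus m \<Longrightarrow> emb s = emb t \<Longrightarrow> s = t"
  using frac by (auto simp: skew_field_of_fractions_def dest: inj_onD)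

lemma emb_add: "s \<in> torus m \<Longrightarrow> t \<in> torus m \<Longrightarrow> emb (s + t) = emb s + emb t"
  and emb_mult: "s \<in> torus m \<Longrightarrow> t \<in> torus m \<Longrightarrow> emb (torus_mult m L s t) = emb s * emb t"
  and emb_one: "emb 1 = 1"
  using frac by (auto simp: skew_field_of_fractions_def)

lemma emb_zero: "emb 0 = 0"
  using emb_add[of 0 0] by simp

lemma emb_sum: "(\<And>i. i \<in> S \<Longrightarrow> f i \<in> torus m) \<Longrightarrow> emb (sum f S) = (\<Sum>i\<in>S. emb (f i)) \<and> sum f S \<in> torus m"
  by (induction S rule: infinite_finite_induct) (auto simp: emb_zero emb_add)

text \<open>A scalar commutes with the torus, hence with inverses of its elements, and every element
  of F is a fraction.\<close>

lemma scal_central: "scal c * x = x * scal c"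
proof -
  have *: "scal c * emb t = emb t * scal c" if "t \<in> torus m" for t
    using that by (simp add: scal_def torus_mult_scalar_left torus_mult_scalar_right flip: emb_mult)
  obtain s t where st: "s \<in> torus m" "t \<in> torus m" "t \<noteq> 0" "x = emb s * inverse (emb t)"
    using frac unfolding skew_field_of_fractions_def by blast
  have "emb t \<noteq> 0"
    using st emb_inj[of t 0] emb_zero by auto
  then have "scal c * inverse (emb t) = inverse (emb t) * scal c"
    using *[OF st(2)]
    by (metis (no_types, lifting) left_inverse mult.assoc mult.right_neutral mult_1 right_inverse)
  then show ?thesis
    using *[OF st(1)] by (metis mult.assoc st(4))
qed

sublocale central_scalars scal
proof
  show "scal 1 = 1"
    using emb_one by (simp add: scal_def)
  show "scal (c + c') = scal c + scal c'" for c c'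
    by (simp add: scal_def single_add emb_add)
  show "scal (c * c') = scal c * scal c'" for c c'
    using emb_mult[of "single 0 c" "single 0 c'"]
    by (cases "c' = 0") (simp_all add: scal_def torus_mult_scalar_left emb_zero)
qed (rule scal_central)

lemma sc_eq_scale: "sc = scale emb"
  by (intro ext) (simp add: sc_def scale_def scal_def)

lemma emb_single: "e \<in> zlattice m \<Longrightarrow> emb (single e c) = sc c (X e)"
  using emb_mult[of "single 0 c" "single e 1"] by (simp add: sc_def scal_def X_def torus_mult_scalar_left)

lemma emb_expand: "t \<in> torus m \<Longrightarrow> emb t = (\<Sum>e\<in>keys t. sc (lookup t e) (X e))"
proof -
  assume t: "t \<in> torus m"
  then have k: "e \<in> zlattice m" if "e \<in> keys t" for e
    using that by (auto simp: torus_def)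
  have "emb t = emb (\<Sum>e\<in>keys t. single e (lookup t e))"
    using poly_mapping_expand[of t] by simp
  also have "\<dots> = (\<Sum>e\<in>keys t. sc (lookup t e) (X e))"
    using emb_sum[of "keys t" "\<lambda>e. single e (lookup t e)"] k by (simp add: emb_single)
  finally show ?thesis .
qed

sublocale qseed scal m L X n B d
proof
  show "\<forall>i\<in>{1..m}. \<forall>j\<in>{1..m}. L i j = - L j i"
    using seed unfolding quantum_seed_def by blast
  show "X 0 = 1"
    by (simp add: X_def emb_one)
  show "X e * X f = vp (bil m L e f) * X (e + f)" if "e \<in> zlattice m" "f \<in> zlattice m" for e f
  proof -
    have "X e * X f = emb (single (e + f) (single (bil m L e f) 1))"
      using that emb_mult[of "single e 1" "single f 1"] by (simp add: torus_mult_monomials X_def)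
    also have "\<dots> = sc (single (bil m L e f) 1) (X (e + f))"
      using that by (intro emb_single) auto
    finally show ?thesis
      by (simp add: sc_vp)
  qed
  show "c e = 0" if S: "finite S" "S \<subseteq> zlattice m" "(\<Sum>e\<in>S. sc (c e) (X e)) = 0" "e \<in> S" for S c e
  proof -
    let ?t = "\<Sum>e\<in>S. single e (c e)"
    have "emb ?t = (\<Sum>e\<in>S. emb (single e (c e))) \<and> ?t \<in> torus m"
      by (rule emb_sum) (use S(2) in auto)
    moreover have "(\<Sum>e\<in>S. emb (single e (c e))) = (\<Sum>e\<in>S. sc (c e) (X e))"
      using S(2) by (intro sum.cong refl emb_single) blast
    ultimately have "emb ?t = emb 0" "?t \<in> torus m"
      using S(3) emb_zero by simp_all
    then have "?t = 0"
      by (intro emb_inj) auto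
    then have "lookup ?t e = 0"
      by simp
    then show ?thesis
      using S(1,4) by (simp add: lookup_sum lookup_single when_def)
  qed
qed (rule seed)

lemma represents_emb: "t \<in> torus m \<Longrightarrow> represents (emb t) (lookup t)"
  by (rule represents_intro[of "keys t"]) (auto simp: emb_expand torus_def in_keys_iff)

lemma emb_torus_span [simp]: "t \<in> torus m \<Longrightarrow> emb t \<in> torus_span"
  using represents_emb represents_torus by blast

lemma cf_emb: "t \<in> torus m \<Longrightarrow> cf (emb t) e = lookup t e"
  using cf_eq[OF represents_emb] by simp

lemma torus_span_emb: "y \<in> torus_span \<Longrightarrow> \<exists>t\<in>torus m. y = emb t"
proof (induction rule: torus_induct)
  case zero
  then show ?case
    by (intro bexI[of _ 0]) (simp_all add: emb_zero)
next
  case (step c f z)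
  then obtain t where "t \<in> torus m" "z = emb t" by blast
  then show ?case
    using step by (intro bexI[of _ "single f c + t"]) (simp_all add: emb_add emb_single)
qed

section \<open>The bar-involution on the torus\<close>

abbreviation br :: "'f \<Rightarrow> 'f" where "br \<equiv> bar m emb"

lemma br_emb: "t \<in> torus m \<Longrightarrow> br (emb t) = emb (bar_torus t)"
  using frac by (simp add: bar_def skew_field_of_fractions_def)

lemma br_torus [simp]: "y \<in> torus_span \<Longrightarrow> br y \<in> torus_span"
  using torus_span_emb by (force simp: br_emb)

lemma cf_br: "y \<in> torus_span \<Longrightarrow> cf (br y) e = bar_laurent (cf y e)"
  using torus_span_emb by (force simp: br_emb cf_emb)

lemma br_add: "y \<in> torus_span \<Longrightarrow> z \<in> torus_span \<Longrightarrow> br (y + z) = br y + br z"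
  by (rule torus_eqI) (simp_all add: cf_br cf_add bar_laurent_add)

lemma br_sc: "y \<in> torus_span \<Longrightarrow> br (sc c y) = sc (bar_laurent c) (br y)"
  by (rule torus_eqI) (simp_all add: cf_br cf_scale bar_laurent_mult)

lemma br_br: "y \<in> torus_span \<Longrightarrow> br (br y) = y"
  by (rule torus_eqI) (simp_all add: cf_br)

lemma br_X: "e \<in> Z \<Longrightarrow> br (X e) = X e"
  by (rule torus_eqI) (simp_all add: cf_br cf_X)

lemma br_vp: "y \<in> torus_span \<Longrightarrow> br (vp k * y) = vp (- k) * br y"
  using br_sc[of y "single k 1"] by (simp add: sc_vp)

text \<open>Inverting the power of v created by a left factor gives, by skew-symmetry of the form,
  the power created by the same factor on the right.\<close>

lemma br_X_mult:
  assumes "f \<in> Z" "y \<in> torus_span"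
  shows "br (X f * y) = br y * X f"
proof (rule torus_eqI)
  fix e
  show "cf (br (X f * y)) e = cf (br y * X f) e"
    using assms Lam_skew[of f "e - f"]
    by (simp add: cf_br cf_X_mult cf_mult_X bar_laurent_mult)
qed (use assms in auto)

lemma br_mult:
  assumes "x \<in> torus_span" "y \<in> torus_span"
  shows "br (x * y) = br y * br x"
  using assms(1)
proof (induction x rule: torus_induct)
  case zero
  show ?case
    using br_sc[of 0 0] by simp
next
  case (step c f z)
  then show ?case
    using assms(2)
    by (simp add: distrib_right distrib_left br_add br_sc br_X_mult br_X sc_mult[symmetric])
qed

lemma supp_br: "y \<in> torus_span \<Longrightarrow> supp (br y) \<subseteq> supp y"
  by (auto simp: supp_def cf_br)

lemma Y_eq: "new_variable m (initial_seed B L emb) k = Y k"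
  by (simp add: new_variable_def initial_seed_def Y_def p_def q_def b_def X_def)

section \<open>The elements E_a of the initial seed\<close>

abbreviation os :: "nat list" where "os \<equiv> increasing_list {1..n} ord"

lemma os: "set os = I" "distinct os"
  using increasing_list[OF _ linear] by auto

lemma E_expr_eq:
  "E_expr m n emb ord y a =
     X (nonneg_part a) * prod_list (map (\<lambda>k. y k ^ nat (pos (- lookup a k))) os)"
  by (simp add: E_expr_def ordered_prod_def X_def nonneg_part_def)

lemma E_circ_eq:
  "E_circ m n B L emb ord a =
     X (nonneg_part a) * prod_list (map (\<lambda>k. Y k ^ nat (pos (- lookup a k))) os)"
  by (simp add: E_circ_def E_expr_eq Y_eq)

lemma leads_E_circ:
  assumes "a \<in> Z"
  shows "leads (E_circ m n B L emb ord a) (LT_E m n B emb ord a) (lead_exp a) (\<lambda>k. pos (- lookup a k))"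
proof -
  have "leads (E_circ m n B L emb ord a) (LT_E m n B emb ord a)
      (nonneg_part a + (\<Sum>k\<in>set os. frag_cmul (int (nat (pos (- lookup a k)))) (p k)))
      (\<lambda>k. if k \<in> set os then 0 + int (nat (pos (- lookup a k))) else 0)"
    unfolding E_circ_eq LT_E_def E_expr_eq p_def[symmetric] X_def[symmetric]
    using leads_X[OF nonneg_part_in_Z[OF assms]] os by (intro leads_prod_list) auto
  moreover have "below e (\<lambda>k. if k \<in> set os then 0 + int (nat (pos (- lookup a k))) else 0) =
      below e (\<lambda>k. pos (- lookup a k))" for e
    unfolding below_def os(1) by (intro Collect_cong ex_cong1) auto
  moreover have "nonneg_part a + (\<Sum>k\<in>set os. frag_cmul (int (nat (pos (- lookup a k)))) (p k)) = lead_exp a"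
    unfolding lead_exp_def os(1) by simp
  ultimately show ?thesis
    by (simp only: leads_def)
qed

abbreviation E :: "ivec \<Rightarrow> 'f" where "E \<equiv> E_elt m n B L emb ord"

text \<open>The leading term is v^N times a bar-invariant monomial, so \<open>- N\<close> is the
  only exponent that makes it invariant; the same \<open>N\<close> occurs in the leading coefficient
  of the unnormalized product.\<close>

lemma E_normalized:
  assumes "a \<in> Z"
  obtains N where "E a = vp (- N) * E_circ m n B L emb ord a"
    "cf (E_circ m n B L emb ord a) (lead_exp a) = single N 1"
proof -
  let ?e = "lead_exp a"
  obtain N where N: "LT_E m n B emb ord a = vp N * X ?e"
      "cf (E_circ m n B L emb ord a) ?e = single N 1" and e: "?e \<in> Z"
    using leads_E_circ[OF assms] unfolding leads_def by blast
  have "br (scale emb (single N' 1) (LT_E m n B emb ord a)) = scale emb (single N' 1) (LT_E m n B emb ord a)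
      \<longleftrightarrow> N' = - N" for N'
  proof -
    have eq: "scale emb (single N' 1) (LT_E m n B emb ord a) = vp (N' + N) * X ?e"
      by (simp add: N(1) vp_vp sc_vp flip: sc_eq_scale)
    have "vp (- (N' + N)) * X ?e = vp (N' + N) * X ?e \<longleftrightarrow> N' = - N"
    proof
      assume "vp (- (N' + N)) * X ?e = vp (N' + N) * X ?e"
      then have "cf (vp (- (N' + N)) * X ?e) ?e = cf (vp (N' + N) * X ?e) ?e"
        by (simp only:)
      then have "single (- (N' + N)) (1::int) = single (N' + N) 1"
        using e by (simp add: cf_vp cf_X)
      then show "N' = - N"
        by (auto simp: frag_of_eq)
    qed simp
    then show ?thesis
      unfolding eq using e by (simp only: br_vp[OF torus_closed(7)] br_X)
  qed
  then have "nu m n B emb ord a = - N"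
    unfolding nu_def by simp
  then have "E a = vp (- N) * E_circ m n B L emb ord a"
    by (simp add: E_elt_def sc_vp flip: sc_eq_scale)
  then show ?thesis
    using that N(2) by blast
qed

lemma prod_list_closed:
  assumes "1 \<in> M" "\<And>x y. x \<in> M \<Longrightarrow> y \<in> M \<Longrightarrow> x * y \<in> M" "\<And>k. k \<in> set ks \<Longrightarrow> f k \<in> M"
  shows "prod_list (map (\<lambda>k. f k ^ r k) ks) \<in> (M :: 'f set)"
proof -
  have "x ^ i \<in> M" if "x \<in> M" for x i
    by (induction i) (use that assms in auto)
  then show ?thesis
    using assms(3) by (induction ks) (auto intro: assms)
qed

lemma U_one: "1 \<in> U"
  using U_X[of 0] by simp

text \<open>The elements that lie in U together with their bar conjugates are closed under products,
  since the involution reverses them, and all factors of the product are bar-invariant.\<close>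

lemma E_circ_br_U:
  assumes "a \<in> Z"
  shows "E_circ m n B L emb ord a \<in> {y \<in> U. br y \<in> U}"
proof -
  let ?M = "{y \<in> U. br y \<in> U}"
  have mult: "x * y \<in> ?M" if "x \<in> ?M" "y \<in> ?M" for x y
    using that U_torus by (auto simp: br_mult intro: U_closed)
  have "X (nonneg_part a) \<in> ?M"
    using nonneg_part_in_Z[OF assms] U_X[of "nonneg_part a"] assms
    by (auto simp: br_X lookup_nonneg_part)
  moreover have "Y k \<in> ?M" if "k \<in> I" for k
  proof -
    have "br (Y k) = Y k"
      using that by (simp add: Y_def br_add br_X)
    then show ?thesis
      using U_closed(7)[OF that] by simp
  qed
  moreover have "1 \<in> ?M"
    using U_one br_X[of 0] by simp
  ultimately show ?thesis
    unfolding E_circ_eq using mult os(1) by (intro mult prod_list_closed) auto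
qed

lemma ex_topological: "\<exists>ks. distinct ks \<and> set ks = {1..n} \<and>
    (\<forall>M N. M < N \<longrightarrow> N < n \<longrightarrow> B (ks ! M) (ks ! N) \<le> 0)"
proof -
  obtain ks where ks: "set ks = {1..n}" "distinct ks" "sorted_wrt (\<lambda>i j. B i j \<le> 0) ks"
    using acyclic by (rule acyclic_enumeration)
  have "length ks = n"
    using distinct_card[OF ks(2)] ks(1) by simp
  then show ?thesis
    using ks by (auto simp: sorted_wrt_iff_nth_less)
qed

text \<open>A fixed choice, since the interpretation that follows needs one particular list.\<close>

definition topological :: "nat list" where
  "topological = (SOME ks. distinct ks \<and> set ks = {1..n} \<and>
    (\<forall>M N. M < N \<longrightarrow> N < n \<longrightarrow> B (ks ! M) (ks ! N) \<le> 0))"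

sublocale standard_monomials scal m L X n B d topological E
proof
  note top = someI_ex[OF ex_topological, folded topological_def]
  show "distinct topological" "set topological = {1..n}"
    using top by blast+
  show "B (topological ! M) (topological ! N) \<le> 0" if "M < N" "N < n" for M N
    using top that by blast
  fix a assume a: "a \<in> zlattice m"
  obtain N where N: "E a = vp (- N) * E_circ m n B L emb ord a"
      "cf (E_circ m n B L emb ord a) (lead_exp a) = single N 1"
    using E_normalized[OF a] by blast
  have circ: "E_circ m n B L emb ord a \<in> U" "E_circ m n B L emb ord a \<in> torus_span"
      "supp (E_circ m n B L emb ord a) \<subseteq> below (lead_exp a) (\<lambda>k. pos (- lookup a k))"
    using E_circ_br_U[OF a] U_torus leads_E_circ[OF a] by (auto simp: leads_def)
  show "E a \<in> U"
    unfolding N(1) using U_closed(5)[OF circ(1), of "single (- N) 1"] by (simp add: sc_vp)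
  show "supp (E a) \<subseteq> below (lead_exp a) (\<lambda>k. pos (- lookup a k))"
    unfolding N(1) using supp_scale[OF circ(2), of "single (- N) 1"] circ(3) by (simp add: sc_vp)
  show "cf (E a) (lead_exp a) = 1"
    unfolding N(1) using circ(2) N(2) by (simp add: cf_vp mult_single)
qed

text \<open>Conjugation preserves the support, and the leading coefficient 1 cancels in the
  difference; this leaves exactly the situation of \<open>triangular\<close>.\<close>

lemma br_E_triangular:
  assumes a: "a \<in> Z"
  shows "br (E a) - E a \<in> span (E ` {a' \<in> Z. prec n a' a})"
proof (rule triangular[OF a])
  obtain N where N: "E a = vp (- N) * E_circ m n B L emb ord a"
    using E_normalized[OF a] by blast
  have T: "E a \<in> torus_span" "br (E a) \<in> torus_span"
    using E_U[OF a] U_torus by auto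
  have "E_circ m n B L emb ord a \<in> torus_span"
    using E_circ_br_U[OF a] U_torus by blast
  then have "br (E a) = sc (single N 1) (br (E_circ m n B L emb ord a))"
    unfolding N by (simp add: br_vp sc_vp)
  then have "br (E a) \<in> U"
    using E_circ_br_U[OF a] U_closed(5) by simp
  then show "br (E a) - E a \<in> U"
    using E_U[OF a] U_closed(3) by blast
  show "supp (br (E a) - E a) \<subseteq> below (lead_exp a) (neg_part a)"
    using supp_diff[OF T(2,1)] supp_br[OF T(1)] E_supp[OF a] by blast
  show "lead_exp a \<notin> supp (br (E a) - E a)"
    using T E_lead[OF a] by (simp add: supp_def cf_diff cf_br)
qed

section \<open>The cluster algebra\<close>

abbreviation A :: "'f set" where "A \<equiv> cluster_algebra m n B L emb"

text \<open>Validity of the seed is carried along with the inclusion, because the next mutation step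
  applies only to a frame already known to be based.\<close>

lemma reachable_qseed:
  assumes "s \<in> reachable_seeds m n (v_elt emb) (initial_seed B L emb)"
  shows "qseed scal m (gram s) (frame s) n (exmat s) d \<and>
    qseed.U scal m (frame s) n (exmat s) \<subseteq> U"
  using assms
proof (induction rule: reachable_seeds.induct)
  case initial
  have "frame (initial_seed B L emb) = X" "exmat (initial_seed B L emb) = B" "gram (initial_seed B L emb) = L"
    by (auto simp: initial_seed_def X_def)
  then show ?case
    using qseed_axioms by simp
next
  case (step s k)
  interpret s: qseed scal m "gram s" "frame s" n "exmat s" d
    using step.IH by blast
  interpret sm: qseed_mutation scal m "gram s" "frame s" n "exmat s" d k
    by unfold_locales (rule step.hyps)
  have "v_elt emb = vp 1"
    by (simp add: v_elt_def vp_def scal_def)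
  moreover have "new_variable m s k = s.Y k"
    by (simp add: new_variable_def s.Y_def s.p_def s.q_def s.b_def)
  then have "(\<lambda>i. if i = k then new_variable m s k else frame s (unit_vec i)) = sm.x'"
    by (intro ext) (simp add: sm.x'_def)
  ultimately have "frame (mutate m (v_elt emb) k s) = sm.X'" "exmat (mutate m (v_elt emb) k s) = sm.B'"
      "gram (mutate m (v_elt emb) k s) = sm.L'"
    by (simp_all add: mutate_def Let_def sm.X'_def sm.L'_def sm.B'_def)
  then show ?case
    using sm.s'.qseed_axioms sm.U_mutation step.IH by auto
qed

lemma A_subset_U: "A \<subseteq> U"
proof
  fix x assume "x \<in> A"
  then show "x \<in> U"
  proof (induction rule: cluster_algebra.induct)
    case (coeff x)
    then obtain t where t: "x = emb t" "\<forall>e\<in>keys t. keys e \<subseteq> {n+1..m}"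
      unfolding ZP_def by blast
    have "e \<in> Z \<and> (\<forall>j\<in>I. lookup e j = 0)" if "e \<in> keys t" for e
      using t(2) that by (force simp: zlattice_def in_keys_iff)
    then have "t \<in> torus m" "\<And>e. e \<in> keys t \<Longrightarrow> X e \<in> U"
      by (auto simp: torus_def intro!: U_X)
    moreover have "sum f S \<in> U" if "\<And>i. i \<in> S \<Longrightarrow> f i \<in> U" for f and S :: "ivec set"
      using that by (induction S rule: infinite_finite_induct) (auto intro: U_closed)
    ultimately show ?case
      unfolding t(1) by (simp add: emb_expand U_closed)
  next
    case (cluster s i)
    then interpret s: qseed scal m "gram s" "frame s" n "exmat s" d
      using reachable_qseed by blast
    have "unit_vec i \<in> Z"
      using I_le_m[OF cluster(2)] zlattice_simps(2) by blast
    then have "frame s (unit_vec i) \<in> s.U"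
      by (intro s.U_X) (auto simp: lookup_single when_def)
    then show ?case
      using reachable_qseed[OF cluster(1)] by blast
  qed (auto intro: U_closed)
qed

lemma A_X_frozen: "keys e \<subseteq> {n+1..m} \<Longrightarrow> X e \<in> A"
  unfolding X_def ZP_def by (rule cluster_algebra.coeff) (auto simp: ZP_def)

lemma A_scal: "scal c \<in> A"
  unfolding scal_def by (rule cluster_algebra.coeff) (auto simp: ZP_def)

lemma A_sc: "x \<in> A \<Longrightarrow> sc c x \<in> A"
  unfolding sc_def by (rule cluster_algebra.mult[OF A_scal])

lemma A_zero: "0 \<in> A"
  using A_scal[of 0] by (simp add: scal_def emb_zero)

lemma A_one: "1 \<in> A"
  using A_X_frozen[of 0] by simp

lemma A_vp: "x \<in> A \<Longrightarrow> vp k * x \<in> A"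
  using A_sc[of x "single k 1"] by (simp add: sc_vp)

lemma A_cluster: "i \<in> I \<Longrightarrow> X (unit_vec i) \<in> A"
proof -
  assume "i \<in> I"
  then have "frame (initial_seed B L emb) (unit_vec i) \<in> A"
    by (intro cluster_algebra.cluster reachable_seeds.initial)
  then show ?thesis
    by (simp add: initial_seed_def X_def)
qed

lemma A_Y: "k \<in> I \<Longrightarrow> Y k \<in> A"
proof -
  assume k: "k \<in> I"
  interpret sm: qseed_mutation scal m L X n B d k
    by unfold_locales (rule k)
  have "frame (mutate m (v_elt emb) k (initial_seed B L emb)) (unit_vec k) = Y k"
  proof -
    have "v_elt emb = vp 1"
      by (simp add: v_elt_def vp_def scal_def)
    moreover have "(\<lambda>i. if i = k then new_variable m (initial_seed B L emb) k
        else frame (initial_seed B L emb) (unit_vec i)) = sm.x'"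
      by (intro ext) (simp add: sm.x'_def Y_eq, simp add: initial_seed_def X_def)
    ultimately have "frame (mutate m (v_elt emb) k (initial_seed B L emb)) = sm.X'"
      by (simp add: mutate_def Let_def sm.X'_def sm.L'_def) (simp add: initial_seed_def)
    then show ?thesis
      using sm.X'_unit[OF sm.k_in_m] by (simp add: sm.x'_def)
  qed
  moreover have "frame (mutate m (v_elt emb) k (initial_seed B L emb)) (unit_vec k) \<in> A"
    using k by (intro cluster_algebra.cluster reachable_seeds.step reachable_seeds.initial)
  ultimately show ?thesis
    by simp
qed

text \<open>The normalized monomial is assembled from a frozen monomial by adding one cluster
  variable at a time; each step costs a power of v, which is a unit of the algebra.\<close>

lemma A_nonneg_part:
  assumes "a \<in> Z"
  shows "X (nonneg_part a) \<in> A"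
proof -
  let ?f = "\<Sum>i=n+1..m. single i (lookup a i)"
  have f: "keys ?f \<subseteq> {n+1..m}"
    using keys_sum[of "\<lambda>i. single i (lookup a i)" "{n+1..m}"] by (auto split: if_splits)
  then have fZ: "?f \<in> Z"
    by (auto simp: zlattice_def)
  have "X (?f + (\<Sum>j\<in>J. single j (pos (lookup a j)))) \<in> A \<and> (\<Sum>j\<in>J. single j (pos (lookup a j))) \<in> Z"
    if "finite J" "J \<subseteq> I" for J
    using that
  proof (induction J rule: finite_induct)
    case empty
    then show ?case
      using A_X_frozen[OF f] by simp
  next
    case (insert j J)
    let ?s = "\<Sum>j\<in>J. single j (pos (lookup a j))" and ?j = "single j (pos (lookup a j))"
    have j: "j \<in> I" "unit_vec j \<in> Z" "?j \<in> Z"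
      using insert I_le_m[of j] zlattice_simps(2) by blast+
    have "?j = frag_cmul (int (nat (pos (lookup a j)))) (unit_vec j)"
      by (rule poly_mapping_eqI) (simp add: lookup_single when_def)
    then have "X ?j = X (unit_vec j) ^ nat (pos (lookup a j))"
      using X_power[OF j(2)] by simp
    moreover have "X (unit_vec j) ^ r \<in> A" for r
      using A_cluster[OF j(1)] A_one by (induction r) (auto intro: cluster_algebra.mult)
    ultimately have "X (?f + ?s) * X ?j \<in> A"
      using insert by (auto intro: cluster_algebra.mult)
    then have "vp (- Lam (?f + ?s) ?j) * (X (?f + ?s) * X ?j) \<in> A"
      by (rule A_vp)
    moreover have "X (?f + ?s + ?j) = vp (- Lam (?f + ?s) ?j) * (X (?f + ?s) * X ?j)"
      using insert fZ j by (intro X_add) auto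
    ultimately have "X (?f + ?s + ?j) \<in> A"
      by (simp only:)
    then show ?case
      using insert j by (simp add: add_ac)
  qed
  from this[of I] show ?thesis
    by (simp add: nonneg_part_def)
qed

lemma E_A: "a \<in> Z \<Longrightarrow> E a \<in> A"
proof -
  assume a: "a \<in> Z"
  have "E_circ m n B L emb ord a \<in> A"
    unfolding E_circ_eq using A_nonneg_part[OF a] A_Y os(1) A_one
    by (intro cluster_algebra.mult prod_list_closed) auto
  then show "E a \<in> A"
    using E_normalized[OF a] A_vp by metis
qed

text \<open>The elements E_a lie in the algebra, and the algebra lies in U, which they span. The
  acyclic cluster algebra thus equals the upper bound of its initial seed.\<close>

lemma A_eq_span: "A = span (E ` Z)"
proof
  show "A \<subseteq> span (E ` Z)"
    using A_subset_U U_eq_span by blast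
  show "span (E ` Z) \<subseteq> A"
    by (rule span_minimal) (auto intro!: E_A subspaceI A_zero A_sc cluster_algebra.add)
qed

lemma neg_total_nonneg: "0 \<le> neg_total n a"
  unfolding neg_total_def by (rule sum_nonneg) simp

sublocale family: bar_triangular_family sc Z E "\<lambda>a. nat (neg_total n a)" br
proof -
  interpret lm: laurent_module sc
    by unfold_locales
  have prec: "{a' \<in> Z. nat (neg_total n a') < nat (neg_total n a)} = {a' \<in> Z. prec n a' a}" for a
    by (auto simp: prec_def intro: le_less_trans[OF neg_total_nonneg])
  have T: "x \<in> torus_span" if "x \<in> span (E ` Z)" for x
    using that U_eq_span U_torus by blast
  show "bar_triangular_family sc Z E (\<lambda>a. nat (neg_total n a)) br"
  proof
    show "lm.family_independent Z E"
      unfolding lm.family_independent_def using E_independent by blast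
    show "br (E a) - E a \<in> span (E ` {a' \<in> Z. nat (neg_total n a') < nat (neg_total n a)})" if "a \<in> Z" for a
      unfolding prec using br_E_triangular[OF that] .
  qed (use T br_add br_sc br_br in auto)
qed

lemma acyclic_bar_invariant_basis:
  "family_basis (scale emb) Z E A \<and>
    (\<forall>a\<in>Z. br (E a) - E a \<in> combinations (scale emb) UNIV {a' \<in> Z. prec n a' a} E) \<and>
    (\<exists>C. family_basis (scale emb) Z C A \<and>
      (\<forall>a\<in>Z. br (C a) = C a \<and> C a - E a \<in> combinations (scale emb) v_poly Z E) \<and>
      (\<forall>C'. (\<forall>a\<in>Z. C' a \<in> A \<and> br (C' a) = C' a \<and>
          C' a - E a \<in> combinations (scale emb) v_poly Z E) \<longrightarrow> (\<forall>a\<in>Z. C' a = C a)))"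
  unfolding sc_eq_scale[symmetric] A_eq_span
  using family.family_basis_E family.bar_invariant_basis br_E_triangular
  by (simp add: family.combinations_UNIV)

end

theorem theorem1p4:
  fixes m n :: nat
    and B L :: "nat \<Rightarrow> nat \<Rightarrow> int"
    and d :: "nat \<Rightarrow> int"
    and emb :: "torus_elem \<Rightarrow> 'f::division_ring"
    and ord :: "nat rel"
  defines "A \<equiv> cluster_algebra m n B L emb"
    and "E \<equiv> E_elt m n B L emb ord"
  assumes "quantum_seed m n B d L"
    and "skew_field_of_fractions m L emb"
    and "acyclic_seed n B"
    and "linear_order_on {1..n} ord"
  shows "family_basis (scale emb) (zlattice m) E A \<and>
    (\<forall>a\<in>zlattice m.
       bar m emb (E a) - E a \<in> combinations (scale emb) UNIV {a'\<in>zlattice m. prec n a' a} E) \<and>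
    (\<exists>C. family_basis (scale emb) (zlattice m) C A \<and>
         (\<forall>a\<in>zlattice m. bar m emb (C a) = C a \<and>
            C a - E a \<in> combinations (scale emb) v_poly (zlattice m) E) \<and>
         (\<forall>C'. (\<forall>a\<in>zlattice m. C' a \<in> A \<and> bar m emb (C' a) = C' a \<and>
                  C' a - E a \<in> combinations (scale emb) v_poly (zlattice m) E) \<longrightarrow>
               (\<forall>a\<in>zlattice m. C' a = C a)))"
proof -
  interpret initial_qseed m n B L d emb ord
    using assms(3-) by unfold_locales
  show ?thesis
    unfolding A_def E_def by (rule acyclic_bar_invariant_basis)
qed

end
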